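(* Let $F$ be a finitely generated free group, $q\ge2$ an integer, $r\in\gamma_q(F)\setminus\gamma_{q+1}(F)$, and $G=F/\langle\!\langle r\rangle\!\rangle$. Assume the simplicial volume of $G$ is nonzero. Then $\mathrm{W}(G,\gamma_{q-1}(G))=0$ and $\dim_{\mathbb{R}}\mathrm{W}(G,\gamma_q(G))=1$. In particular $\dim_{\mathbb{R}}\mathcal{W}(G,\gamma_{q-1}(G),\gamma_q(G))=1$.
   Context: $\gamma_1(H)=H$, $\gamma_{k+1}(H)=[H,\gamma_k(H)]$; $\langle\!\langle r\rangle\!\rangle$ is the normal closure of $r$ in $F$. For such $G$ (with $1\ne r\in[F,F]$), $\mathrm{H}_2(G;\mathbb{Z})\cong\mathbb{Z}$, and the simplicial volume of $G$ is the $\ell^1$-seminorm (induced from the $\ell^1$-norm on real bar chains) of the image in $\mathrm{H}_2(G;\mathbb{R})$ of a generator of $\mathrm{H}_2(G;\mathbb{Z})$. For normal subgroups $L\geqslant N$ of $G$: $\mathrm{Q}(N)^G$ homogeneous quasimorphisms on $N$ invariant under $G$-conjugation, $\mathrm{H}^1(N)^G$ $G$-invariant homomorphisms, $\mathcal{W}(G,L,N)=\mathrm{Q}(N)^G/(\mathrm{H}^1(N)^G+\{\psi|_N:\psi\in\mathrm{Q}(L)^G\})$, $\mathrm{W}(G,N)=\mathcal{W}(G,G,N)$. *)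

theory Defs
  imports "HOL-Algebra.Algebra" "HOL-Library.Extended_Nat"
begin

text \<open>Letters are pairs (i, b): generator x_i if b = True, its inverse if b = False.\<close>

fun fg_reduce :: "(nat \<times> bool) list \<Rightarrow> (nat \<times> bool) list" where
  "fg_reduce [] = []"
| "fg_reduce (x # xs) =
     (case fg_reduce xs of
        [] \<Rightarrow> [x]
      | y # ys \<Rightarrow> (if fst y = fst x \<and> snd y \<noteq> snd x then ys else x # y # ys))"

definition fg_reduced :: "(nat \<times> bool) list \<Rightarrow> bool" where
  "fg_reduced w \<longleftrightarrow> fg_reduce w = w"

definition free_grp :: "nat \<Rightarrow> (nat \<times> bool) list monoid" where
  "free_grp n = \<lparr> carrier = {w. fg_reduced w \<and> (\<forall>a\<in>set w. fst a < n)},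
                   monoid.mult = (\<lambda>x y. fg_reduce (x @ y)),
                   one = [] \<rparr>"

definition normal_closure :: "('a, 'b) monoid_scheme \<Rightarrow> 'a set \<Rightarrow> 'a set" where
  "normal_closure G S =
     generate G (\<Union>g\<in>carrier G. (\<lambda>s. g \<otimes>\<^bsub>G\<^esub> s \<otimes>\<^bsub>G\<^esub> inv\<^bsub>G\<^esub> g) ` S)"

primrec lcs_aux :: "('a, 'b) monoid_scheme \<Rightarrow> nat \<Rightarrow> 'a set" where
  "lcs_aux G 0 = carrier G"
| "lcs_aux G (Suc k) = generate G
     (\<Union>h\<in>carrier G. \<Union>x\<in>lcs_aux G k.
        {h \<otimes>\<^bsub>G\<^esub> x \<otimes>\<^bsub>G\<^esub> inv\<^bsub>G\<^esub> h \<otimes>\<^bsub>G\<^esub> inv\<^bsub>G\<^esub> x})"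

text \<open>gamma G k is the k-th term of the lower central series, k \<ge> 1:
  gamma G 1 = G, gamma G (k+1) = [G, gamma G k].\<close>
definition gamma :: "('a, 'b) monoid_scheme \<Rightarrow> nat \<Rightarrow> 'a set" where
  "gamma G k = lcs_aux G (k - 1)"

definition chain2 :: "('a, 'b) monoid_scheme \<Rightarrow> ('a \<times> 'a \<Rightarrow> 'c::zero) \<Rightarrow> bool" where
  "chain2 G c \<longleftrightarrow> finite {p. c p \<noteq> 0} \<and> (\<forall>p. c p \<noteq> 0 \<longrightarrow> fst p \<in> carrier G \<and> snd p \<in> carrier G)"

definition chain3 :: "('a, 'b) monoid_scheme \<Rightarrow> ('a \<times> 'a \<times> 'a \<Rightarrow> 'c::zero) \<Rightarrow> bool" where
  "chain3 G c \<longleftrightarrow> finite {p. c p \<noteq> 0} \<and>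
     (\<forall>a1 a2 a3. c (a1, a2, a3) \<noteq> 0 \<longrightarrow> a1 \<in> carrier G \<and> a2 \<in> carrier G \<and> a3 \<in> carrier G)"

definition bar_d2 :: "('a, 'b) monoid_scheme \<Rightarrow> ('a \<times> 'a \<Rightarrow> 'c::comm_ring_1) \<Rightarrow> 'a \<Rightarrow> 'c" where
  "bar_d2 G c h = (\<Sum>p\<in>{p. c p \<noteq> 0}.
      (if snd p = h then c p else 0) - (if fst p \<otimes>\<^bsub>G\<^esub> snd p = h then c p else 0)
      + (if fst p = h then c p else 0))"

definition bar_d3 :: "('a, 'b) monoid_scheme \<Rightarrow> ('a \<times> 'a \<times> 'a \<Rightarrow> 'c::comm_ring_1) \<Rightarrow> 'a \<times> 'a \<Rightarrow> 'c" where
  "bar_d3 G b g = (\<Sum>t\<in>{t. b t \<noteq> 0}. case t of (a1, a2, a3) \<Rightarrow>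
      (if (a2, a3) = g then b t else 0)
      - (if (a1 \<otimes>\<^bsub>G\<^esub> a2, a3) = g then b t else 0)
      + (if (a1, a2 \<otimes>\<^bsub>G\<^esub> a3) = g then b t else 0)
      - (if (a1, a2) = g then b t else 0))"

definition cycle2 :: "('a, 'b) monoid_scheme \<Rightarrow> ('a \<times> 'a \<Rightarrow> 'c::comm_ring_1) \<Rightarrow> bool" where
  "cycle2 G c \<longleftrightarrow> chain2 G c \<and> (\<forall>h. bar_d2 G c h = 0)"

definition boundary2 :: "('a, 'b) monoid_scheme \<Rightarrow> ('a \<times> 'a \<Rightarrow> 'c::comm_ring_1) \<Rightarrow> bool" where
  "boundary2 G c \<longleftrightarrow> (\<exists>b. chain3 G b \<and> c = bar_d3 G b)"

definition H2_generator :: "('a, 'b) monoid_scheme \<Rightarrow> ('a \<times> 'a \<Rightarrow> int) \<Rightarrow> bool" where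
  "H2_generator G z \<longleftrightarrow> cycle2 G z \<and>
     (\<forall>c::'a \<times> 'a \<Rightarrow> int. cycle2 G c \<longrightarrow> (\<exists>k::int. boundary2 G (\<lambda>p. c p - k * z p)))"

definition l1_norm :: "('a \<times> 'a \<Rightarrow> real) \<Rightarrow> real" where
  "l1_norm c = (\<Sum>p\<in>{p. c p \<noteq> 0}. \<bar>c p\<bar>)"

definition l1_seminorm_H2 :: "('a, 'b) monoid_scheme \<Rightarrow> ('a \<times> 'a \<Rightarrow> int) \<Rightarrow> real" where
  "l1_seminorm_H2 G z = Inf {l1_norm c | c. cycle2 G c \<and> boundary2 G (\<lambda>p. c p - real_of_int (z p))}"

definition simplicial_volume :: "('a, 'b) monoid_scheme \<Rightarrow> real" where
  "simplicial_volume G = l1_seminorm_H2 G (SOME z. H2_generator G z)"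

text \<open>Real-valued functions on N are represented by functions vanishing outside N.\<close>
definition hom_qm :: "('a, 'b) monoid_scheme \<Rightarrow> 'a set \<Rightarrow> ('a \<Rightarrow> real) \<Rightarrow> bool" where
  "hom_qm G N \<phi> \<longleftrightarrow> (\<forall>x. x \<notin> N \<longrightarrow> \<phi> x = 0)
     \<and> (\<exists>D. \<forall>x\<in>N. \<forall>y\<in>N. \<bar>\<phi> (x \<otimes>\<^bsub>G\<^esub> y) - \<phi> x - \<phi> y\<bar> \<le> D)
     \<and> (\<forall>x\<in>N. \<forall>n::int. \<phi> (x [^]\<^bsub>G\<^esub> n) = of_int n * \<phi> x)"

definition Q_inv :: "('a, 'b) monoid_scheme \<Rightarrow> 'a set \<Rightarrow> ('a \<Rightarrow> real) set" where
  "Q_inv G N = {\<phi>. hom_qm G N \<phi> \<and>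
     (\<forall>g\<in>carrier G. \<forall>x\<in>N. \<phi> (g \<otimes>\<^bsub>G\<^esub> x \<otimes>\<^bsub>G\<^esub> inv\<^bsub>G\<^esub> g) = \<phi> x)}"

definition H1_inv :: "('a, 'b) monoid_scheme \<Rightarrow> 'a set \<Rightarrow> ('a \<Rightarrow> real) set" where
  "H1_inv G N = {\<phi>. (\<forall>x. x \<notin> N \<longrightarrow> \<phi> x = 0)
     \<and> (\<forall>x\<in>N. \<forall>y\<in>N. \<phi> (x \<otimes>\<^bsub>G\<^esub> y) = \<phi> x + \<phi> y)
     \<and> (\<forall>g\<in>carrier G. \<forall>x\<in>N. \<phi> (g \<otimes>\<^bsub>G\<^esub> x \<otimes>\<^bsub>G\<^esub> inv\<^bsub>G\<^esub> g) = \<phi> x)}"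

definition restr_Q :: "('a, 'b) monoid_scheme \<Rightarrow> 'a set \<Rightarrow> 'a set \<Rightarrow> ('a \<Rightarrow> real) set" where
  "restr_Q G L N = {(\<lambda>x. if x \<in> N then \<psi> x else 0) | \<psi>. \<psi> \<in> Q_inv G L}"

definition fspan :: "('a \<Rightarrow> real) set \<Rightarrow> ('a \<Rightarrow> real) set" where
  "fspan B = {(\<lambda>x. \<Sum>b\<in>B. u b * b x) | u. True}"

text \<open>Dimension of the quotient space V/U (U \<subseteq> V subspaces):
  the least size of a finite B \<subseteq> V with V \<subseteq> U + span B; infinity if none.\<close>
definition quot_dim :: "('a \<Rightarrow> real) set \<Rightarrow> ('a \<Rightarrow> real) set \<Rightarrow> enat" where
  "quot_dim V U = Inf {enat (card B) | B. finite B \<and> B \<subseteq> V \<and>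
                       V \<subseteq> {(\<lambda>x. u x + s x) | u s. u \<in> U \<and> s \<in> fspan B}}"

definition dim_W3 :: "('a, 'b) monoid_scheme \<Rightarrow> 'a set \<Rightarrow> 'a set \<Rightarrow> enat" where
  "dim_W3 G L N = quot_dim (Q_inv G N)
     {(\<lambda>x. a x + b x) | a b. a \<in> H1_inv G N \<and> b \<in> restr_Q G L N}"

definition dim_W :: "('a, 'b) monoid_scheme \<Rightarrow> 'a set \<Rightarrow> enat" where
  "dim_W G N = dim_W3 G (carrier G) N"

end

theory Submission
  imports Defs "HOL-Library.List_Lexorder" "HOL-Library.Function_Algebras"
begin

text \<open>Pull everything back to the free group \<open>F\<close>, with \<open>R\<close> the normal closure of \<open>r\<close>.

  A cocycle on the amenable group \<open>F / \<gamma>\<^sub>k F\<close> absorbs the obstruction to extending an invariant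
  quasimorphism from \<open>\<gamma>\<^sub>k F\<close>, and it splits on \<open>F\<close>; so every such quasimorphism is an invariant
  homomorphism plus the restriction of a quasimorphism on \<open>F\<close>. Both summands descend to the quotient
  as soon as they vanish on \<open>R\<close>. For \<open>k = q - 1\<close> this is automatic, because the homomorphism kills
  \<open>\<gamma>\<^sub>q F\<close>, which contains \<open>r\<close>. For \<open>k = q\<close> the only obstruction is the value of the homomorphism
  at \<open>r\<close>, so the quotient is at most one-dimensional.

  It is spanned by \<open>\<mu> - h\<close>. Here \<open>h\<close> is an invariant homomorphism on \<open>\<gamma>\<^sub>q F\<close> with \<open>h r = 1\<close>, a coefficient
  of the Magnus expansion; it exists because Lyndon commutators generate \<open>\<gamma>\<^sub>q F / \<gamma>\<^sub>q\<^sub>+\<^sub>1 F\<close> and have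
  unitriangular leading terms. And \<open>\<mu>\<close> is a quasimorphism on \<open>F\<close> that is additive on \<open>R\<close> with \<open>\<mu> r = 1\<close>:
  nonvanishing simplicial volume gives, by Hahn-Banach duality, a bounded cocycle that pairs
  nontrivially with the generator, and \<open>\<mu>\<close> comes from splitting its pullback to \<open>F\<close>. If \<open>\<mu> - h\<close> were
  extendable, some quasimorphism on \<open>F\<close> would be additive on \<open>\<gamma>\<^sub>q F\<close> but nonzero at \<open>r\<close>; additivity on
  \<open>\<gamma>\<^sub>q F\<close> forces additivity on \<open>F\<close>, a contradiction.\<close>

section \<open>Commutator calculus and the lower central series\<close>

text \<open>Some obstacles lie behind these steps. \<open>simplicial_volume\<close> picks a
  generator with \<open>SOME\<close>, so it says something only once every 2-cycle of G is known to
  be homologous to a multiple of a single one; this is why cocycles on \<open>F\<close> are split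
  not only with real values but also with values in integral chains modulo boundaries. An element
  outside the next term of a lower central series could be torsion in the quotient, invisible to
  every real homomorphism; Magnus coefficients rule this out in \<open>F\<close>. Amenability of the
  nilpotent quotients is built up one central layer at a time, and functions on a quotient stay
  functions on the group that are constant on cosets. After homogenization no further limits of
  quasimorphisms are taken: an identity is proved by an operation that doubles its bounded defect,
  and this is also how additivity climbs from a term of the lower central series to the whole of
  \<open>F\<close>.\<close>

context group
begin

definition cmt :: "'a \<Rightarrow> 'a \<Rightarrow> 'a" where
  "cmt x y = x \<otimes> y \<otimes> inv x \<otimes> inv y"

lemma inv_mult_cancel_left:
  assumes "x \<in> carrier G" "y \<in> carrier G"
  shows "inv x \<otimes> (x \<otimes> y) = y" "x \<otimes> (inv x \<otimes> y) = y"
  using assms by (simp_all add: m_assoc[symmetric])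

text \<open>Together with the default simp rules these bring a group word to right-nested, freely
  reduced form, so that identities of free groups such as \<open>hall_witt\<close> are settled by
  \<open>simp\<close>.\<close>

lemmas group_word_simps = m_assoc inv_mult_group inv_mult_cancel_left

lemma cmt_closed [simp, intro]: "x \<in> carrier G \<Longrightarrow> y \<in> carrier G \<Longrightarrow> cmt x y \<in> carrier G"
  by (simp add: cmt_def)

lemma inv_cmt: "x \<in> carrier G \<Longrightarrow> y \<in> carrier G \<Longrightarrow> inv (cmt x y) = cmt y x"
  by (simp add: cmt_def group_word_simps)

lemma cmt_mult_left:
  assumes "x \<in> carrier G" "y \<in> carrier G" "z \<in> carrier G"
  shows "cmt (x \<otimes> y) z = x \<otimes> cmt y z \<otimes> inv x \<otimes> cmt x z"
  using assms by (simp add: cmt_def group_word_simps)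

lemma cmt_mult_right:
  assumes "x \<in> carrier G" "y \<in> carrier G" "z \<in> carrier G"
  shows "cmt x (y \<otimes> z) = cmt x y \<otimes> (y \<otimes> cmt x z \<otimes> inv y)"
  using assms by (simp add: cmt_def group_word_simps)

lemma cmt_inv_left:
  assumes "x \<in> carrier G" "z \<in> carrier G"
  shows "cmt (inv x) z = inv x \<otimes> inv (cmt x z) \<otimes> x"
  using assms by (simp add: cmt_def group_word_simps)

lemma hall_witt:
  assumes "x \<in> carrier G" "y \<in> carrier G" "z \<in> carrier G"
  shows "cmt (cmt x y) (y \<otimes> z \<otimes> inv y) \<otimes> cmt (cmt y z) (z \<otimes> x \<otimes> inv z)
    \<otimes> cmt (cmt z x) (x \<otimes> y \<otimes> inv x) = \<one>"
  using assms by (simp add: cmt_def group_word_simps)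

lemma conj_mem: "N \<lhd> G \<Longrightarrow> x \<in> carrier G \<Longrightarrow> y \<in> N \<Longrightarrow> x \<otimes> y \<otimes> inv x \<in> N"
  by (rule normal.inv_op_closed2)

lemma conj_mem': "N \<lhd> G \<Longrightarrow> x \<in> carrier G \<Longrightarrow> y \<in> N \<Longrightarrow> inv x \<otimes> y \<otimes> x \<in> N"
  by (rule normal.inv_op_closed1)

lemma normal_mult_mem: "N \<lhd> G \<Longrightarrow> x \<in> N \<Longrightarrow> y \<in> N \<Longrightarrow> x \<otimes> y \<in> N"
  by (simp add: normal_imp_subgroup subgroup.m_closed)

lemma normal_inv_mem: "N \<lhd> G \<Longrightarrow> x \<in> N \<Longrightarrow> inv x \<in> N"
  by (simp add: normal_imp_subgroup subgroup.m_inv_closed)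

lemma cmt_mem_swap:
  "N \<lhd> G \<Longrightarrow> x \<in> carrier G \<Longrightarrow> y \<in> carrier G \<Longrightarrow> cmt x y \<in> N \<Longrightarrow> cmt y x \<in> N"
  using inv_cmt normal_inv_mem by metis

text \<open>Modulo the normal subgroup \<open>N\<close> the centralizer of \<open>z\<close> is a
  subgroup, so generators suffice.\<close>

lemma cmt_generate_left:
  assumes N: "N \<lhd> G" and A: "A \<subseteq> carrier G" and z: "z \<in> carrier G"
    and base: "\<And>a. a \<in> A \<Longrightarrow> cmt a z \<in> N" and x: "x \<in> generate G A"
  shows "cmt x z \<in> N"
  using x
proof (induction rule: generate.induct)
  case one
  show ?case using z N by (simp add: cmt_def normal_imp_subgroup subgroup.one_closed)
next
  case (incl h) then show ?case by (rule base)
next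
  case (inv h)
  then have h: "h \<in> carrier G" "cmt h z \<in> N" using A base by auto
  show ?case unfolding cmt_inv_left[OF h(1) z] by (intro conj_mem' normal_inv_mem N h)
next
  case (eng h1 h2)
  then have h: "h1 \<in> carrier G" "h2 \<in> carrier G" using A generate_in_carrier by auto
  show ?case unfolding cmt_mult_left[OF h z] by (intro normal_mult_mem conj_mem N h eng)
qed

lemma cmt_generate_right:
  assumes N: "N \<lhd> G" and A: "A \<subseteq> carrier G" and z: "z \<in> carrier G"
    and base: "\<And>a. a \<in> A \<Longrightarrow> cmt z a \<in> N" and x: "x \<in> generate G A"
  shows "cmt z x \<in> N"
  using cmt_mem_swap[OF N _ z cmt_generate_left[OF N A z _ x]] cmt_mem_swap[OF N z _ base] A
    generate_in_carrier[OF A x] z x by blast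

text \<open>The Jacobi identity, phrased through membership so that no graded Lie ring has to be formed.\<close>
lemma jacobi_mem:
  assumes N: "N \<lhd> G" and c: "a \<in> carrier G" "b \<in> carrier G" "c \<in> carrier G"
    and 1: "cmt (cmt b c) a \<in> N" "cmt (cmt c a) b \<in> N"
    and 2: "cmt (cmt b c) (cmt c a) \<in> N" "cmt (cmt c a) (cmt a b) \<in> N"
      "cmt (cmt a b) (cmt b c) \<in> N"
  shows "cmt (cmt a b) c \<in> N"
proof -
  \<comment> \<open>Hall-Witt has conjugates as second entries. Writing such a conjugate as a
    commutator times the plain element costs only commutators of two commutators, which hypothesis
    \<open>2\<close> places in \<open>N\<close>.\<close>
  have conj: "y \<otimes> z \<otimes> inv y = cmt y z \<otimes> z" if "y \<in> carrier G" "z \<in> carrier G" for y z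
    using that by (simp add: cmt_def group_word_simps)
  have e: "cmt u (cmt y z \<otimes> z) = cmt u (cmt y z) \<otimes> (cmt y z \<otimes> cmt u z \<otimes> inv (cmt y z))"
    if "u \<in> carrier G" "y \<in> carrier G" "z \<in> carrier G" for u y z
    using that by (intro cmt_mult_right) auto
  have A: "cmt (cmt b c) (c \<otimes> a \<otimes> inv c) \<in> N" "cmt (cmt c a) (a \<otimes> b \<otimes> inv a) \<in> N"
    unfolding conj[OF c(3,1)] conj[OF c(1,2)] e[OF cmt_closed[OF c(2,3)] c(3,1)] e[OF cmt_closed[OF c(3,1)] c(1,2)]
    using c 1 2 by (simp_all add: normal_mult_mem conj_mem N)
  let ?x = "cmt (cmt a b) (b \<otimes> c \<otimes> inv b)"
  let ?y = "cmt (cmt b c) (c \<otimes> a \<otimes> inv c)" and ?z = "cmt (cmt c a) (a \<otimes> b \<otimes> inv a)"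
  have cl: "?x \<in> carrier G" "?y \<in> carrier G" "?z \<in> carrier G" using c by auto
  have "?x \<otimes> (?y \<otimes> ?z) = \<one>" using hall_witt[OF c] cl by (simp add: m_assoc)
  then have "?x = inv (?y \<otimes> ?z)" using cl by (intro inv_equality[symmetric]) auto
  also have "\<dots> \<in> N" by (rule normal_inv_mem[OF N normal_mult_mem[OF N A]])
  finally have "cmt (cmt a b) (cmt b c) \<otimes> (cmt b c \<otimes> cmt (cmt a b) c \<otimes> inv (cmt b c)) \<in> N"
    unfolding conj[OF c(2,3)] e[OF cmt_closed[OF c(1,2)] c(2,3)] .
  then have "inv (cmt (cmt a b) (cmt b c)) \<otimes> (cmt (cmt a b) (cmt b c) \<otimes>
      (cmt b c \<otimes> cmt (cmt a b) c \<otimes> inv (cmt b c))) \<in> N"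
    by (rule normal_mult_mem[OF N normal_inv_mem[OF N 2(3)]])
  then have "cmt b c \<otimes> cmt (cmt a b) c \<otimes> inv (cmt b c) \<in> N"
    using c by (simp add: inv_mult_cancel_left)
  then have "inv (cmt b c) \<otimes> (cmt b c \<otimes> cmt (cmt a b) c \<otimes> inv (cmt b c)) \<otimes> cmt b c \<in> N"
    using c by (simp only: conj_mem'[OF N] cmt_closed)
  moreover have "inv (cmt b c) \<otimes> (cmt b c \<otimes> cmt (cmt a b) c \<otimes> inv (cmt b c)) \<otimes> cmt b c = cmt (cmt a b) c"
    using c by (simp add: m_assoc inv_mult_cancel_left)
  ultimately show ?thesis by simp
qed

lemma lcs_Suc: "lcs_aux G (Suc k) = generate G (\<Union>h\<in>carrier G. \<Union>x\<in>lcs_aux G k. {cmt h x})"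
  by (simp only: lcs_aux.simps cmt_def)

declare lcs_aux.simps(2) [simp del]

lemma lcs_normal: "lcs_aux G k \<lhd> G"
proof (induction k)
  case 0 show ?case by (simp add: normal_self)
next
  case (Suc k)
  have sub: "lcs_aux G k \<subseteq> carrier G" using Suc by (simp add: normal_imp_subgroup subgroup.subset)
  show ?case unfolding lcs_Suc
  proof (rule normal_generateI)
    show "(\<Union>h\<in>carrier G. \<Union>x\<in>lcs_aux G k. {cmt h x}) \<subseteq> carrier G" using sub by auto
    fix h g assume "h \<in> (\<Union>h\<in>carrier G. \<Union>x\<in>lcs_aux G k. {cmt h x})" and g: "g \<in> carrier G"
    then obtain y x where y: "y \<in> carrier G" "x \<in> lcs_aux G k" "h = cmt y x" by blast
    have "g \<otimes> h \<otimes> inv g = cmt (g \<otimes> y \<otimes> inv g) (g \<otimes> x \<otimes> inv g)"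
      using y(1) g subsetD[OF sub y(2)] by (simp add: y(3) cmt_def group_word_simps)
    moreover have "g \<otimes> x \<otimes> inv g \<in> lcs_aux G k" by (rule conj_mem[OF Suc g y(2)])
    ultimately show "g \<otimes> h \<otimes> inv g \<in> (\<Union>h\<in>carrier G. \<Union>x\<in>lcs_aux G k. {cmt h x})"
      using y(1) g by (intro UN_I[of "g \<otimes> y \<otimes> inv g"] UN_I[of "g \<otimes> x \<otimes> inv g"]) auto
  qed
qed

lemma lcs_subgroup: "subgroup (lcs_aux G k) G"
  using lcs_normal by (rule normal_imp_subgroup)

lemma lcs_carrier: "x \<in> lcs_aux G k \<Longrightarrow> x \<in> carrier G"
  using lcs_subgroup subgroup.mem_carrier by metis

lemma cmt_lcs_Suc: "h \<in> carrier G \<Longrightarrow> x \<in> lcs_aux G k \<Longrightarrow> cmt h x \<in> lcs_aux G (Suc k)"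
  unfolding lcs_Suc by (rule generate.incl) blast

lemma cmt_lcs_Suc': "h \<in> carrier G \<Longrightarrow> x \<in> lcs_aux G k \<Longrightarrow> cmt x h \<in> lcs_aux G (Suc k)"
  using cmt_lcs_Suc cmt_mem_swap[OF lcs_normal] lcs_carrier by metis

lemma lcs_Suc_subset: "lcs_aux G (Suc k) \<subseteq> lcs_aux G k"
  unfolding lcs_Suc
proof (rule generate_subgroup_incl[OF _ lcs_subgroup], safe)
  fix h x assume h: "h \<in> carrier G" and x: "x \<in> lcs_aux G k"
  show "cmt h x \<in> lcs_aux G k" unfolding cmt_def
    using h x by (intro normal_mult_mem[OF lcs_normal] conj_mem[OF lcs_normal] normal_inv_mem[OF lcs_normal])
qed

lemma lcs_antimono: "i \<le> j \<Longrightarrow> lcs_aux G j \<subseteq> lcs_aux G i"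
  by (rule lift_Suc_antimono_le[where f="lcs_aux G"]) (rule lcs_Suc_subset)

text \<open>The \<open>Suc\<close> is the index shift: \<open>lcs_aux G k\<close> is the (k+1)-st
  term. For a generator \<open>cmt h x\<close> of the (i+1)-st level, Hall-Witt trades its
  commutator with \<open>y\<close> for two others, one with inner bracket of \<open>x\<close> and
  \<open>z\<close>, one with inner bracket of \<open>z\<close> and \<open>h\<close>; the induction
  hypothesis for \<open>i\<close> covers both.\<close>

lemma cmt_lcs: "x \<in> lcs_aux G i \<Longrightarrow> y \<in> lcs_aux G j \<Longrightarrow> cmt x y \<in> lcs_aux G (Suc (i + j))"
proof (induction i arbitrary: j x y)
  case 0 then show ?case using cmt_lcs_Suc by simp
next
  case (Suc i)
  let ?N = "lcs_aux G (Suc (Suc i + j))"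
  have y: "y \<in> carrier G" using Suc.prems lcs_carrier by blast
  show ?case
  proof (rule cmt_generate_left[OF lcs_normal _ y _ Suc.prems(1)[unfolded lcs_Suc]])
    show "(\<Union>h\<in>carrier G. \<Union>x\<in>lcs_aux G i. {cmt h x}) \<subseteq> carrier G" using lcs_carrier by auto
    fix a assume "a \<in> (\<Union>h\<in>carrier G. \<Union>x\<in>lcs_aux G i. {cmt h x})"
    then obtain h x where h: "h \<in> carrier G" and x: "x \<in> lcs_aux G i" and a: "a = cmt h x" by blast
    have xc: "x \<in> carrier G" using x lcs_carrier by blast
    \<comment> \<open>Chosen so that the conjugate of \<open>z\<close> by \<open>x\<close>, which is
      what Hall-Witt produces, is \<open>y\<close>.\<close>
    define z where "z = inv x \<otimes> y \<otimes> x"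
    have z: "z \<in> lcs_aux G j" unfolding z_def using conj_mem'[OF lcs_normal xc Suc.prems(2)] .
    have zc: "z \<in> carrier G" using z lcs_carrier by blast
    have yz: "y = x \<otimes> z \<otimes> inv x" unfolding z_def using xc y by (simp add: group_word_simps)
    have "cmt (cmt x z) (z \<otimes> h \<otimes> inv z) \<in> ?N"
      using cmt_lcs_Suc'[of "z \<otimes> h \<otimes> inv z" "cmt x z" "Suc (i+j)"] Suc.IH[OF x z] zc h by simp
    moreover have "cmt (cmt z h) (h \<otimes> x \<otimes> inv h) \<in> ?N"
    proof -
      have "cmt z h \<in> lcs_aux G (Suc j)" using cmt_lcs_Suc'[OF h z] .
      moreover have "h \<otimes> x \<otimes> inv h \<in> lcs_aux G i" using conj_mem[OF lcs_normal h x] .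
      ultimately have "cmt (h \<otimes> x \<otimes> inv h) (cmt z h) \<in> lcs_aux G (Suc (i + Suc j))"
        by (rule Suc.IH[rotated])
      then have "cmt (h \<otimes> x \<otimes> inv h) (cmt z h) \<in> ?N" by simp
      then show ?thesis by (rule cmt_mem_swap[OF lcs_normal, rotated 2]) (use h zc xc in auto)
    qed
    ultimately have mem: "inv (cmt (cmt x z) (z \<otimes> h \<otimes> inv z) \<otimes> cmt (cmt z h) (h \<otimes> x \<otimes> inv h)) \<in> ?N"
      by (rule normal_inv_mem[OF lcs_normal normal_mult_mem[OF lcs_normal]])
    have "cmt (cmt h x) (x \<otimes> z \<otimes> inv x) \<otimes> (cmt (cmt x z) (z \<otimes> h \<otimes> inv z) \<otimes> cmt (cmt z h) (h \<otimes> x \<otimes> inv h)) = \<one>"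
      using hall_witt[OF h xc zc] h xc zc by (simp add: m_assoc)
    then have "cmt (cmt h x) (x \<otimes> z \<otimes> inv x) = inv (cmt (cmt x z) (z \<otimes> h \<otimes> inv z) \<otimes> cmt (cmt z h) (h \<otimes> x \<otimes> inv h))"
      using h xc zc by (intro inv_equality[symmetric]) auto
    then show "cmt a y \<in> ?N" unfolding a yz using mem by simp
  qed
qed

end

lemma (in group_hom) hom_lcs:
  assumes "h ` carrier G = carrier H"
  shows "lcs_aux H k = h ` lcs_aux G k"
proof (induction k)
  case 0 show ?case using assms by simp
next
  case (Suc k)
  have *: "(\<Union>y\<in>carrier H. \<Union>x\<in>lcs_aux H k. {H.cmt y x}) = h ` (\<Union>y\<in>carrier G. \<Union>x\<in>lcs_aux G k. {G.cmt y x})"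
  proof -
    have "H.cmt (h y) (h x) = h (G.cmt y x)" if "y \<in> carrier G" "x \<in> lcs_aux G k" for x y
      using that G.lcs_carrier[of x k] by (simp add: G.cmt_def H.cmt_def)
    then show ?thesis unfolding Suc assms[symmetric] by (simp add: image_UN)
  qed
  show ?case unfolding G.lcs_Suc H.lcs_Suc *
    by (rule generate_img) (use G.lcs_carrier[of _ k] in auto)
qed

section \<open>Free groups\<close>

text \<open>One step of \<open>fg_reduce\<close>, viewed as a letter acting on reduced words. This
  is van der Waerden's device: once letters act invertibly (\<open>push_flip\<close>), associativity
  of the free group is composition of actions.\<close>

definition push :: "nat \<times> bool \<Rightarrow> (nat \<times> bool) list \<Rightarrow> (nat \<times> bool) list" where
  "push x w = (case w of [] \<Rightarrow> [x]
     | y # ys \<Rightarrow> (if fst y = fst x \<and> snd y \<noteq> snd x then ys else x # w))"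

definition flip :: "nat \<times> bool \<Rightarrow> nat \<times> bool" where
  "flip x = (fst x, \<not> snd x)"

fun no_cancel :: "(nat \<times> bool) list \<Rightarrow> bool" where
  "no_cancel (x # y # w) \<longleftrightarrow> y \<noteq> flip x \<and> no_cancel (y # w)"
| "no_cancel _ \<longleftrightarrow> True"

lemma flip_simps [simp]: "fst (flip x) = fst x" "snd (flip x) = (\<not> snd x)" "flip (flip x) = x"
  "flip x \<noteq> x" "x \<noteq> flip x"
  by (auto simp: flip_def prod_eq_iff)

lemma push_alt: "push x w = (case w of [] \<Rightarrow> [x] | y # ys \<Rightarrow> if y = flip x then ys else x # w)"
  by (auto simp: push_def flip_def prod_eq_iff split: list.split)

lemma fg_reduce_foldr: "fg_reduce w = foldr push w []"
  by (induction w) (simp_all add: push_def split: list.split)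

lemma no_cancel_Cons: "no_cancel (x # w) \<Longrightarrow> no_cancel w"
  by (cases w) auto

lemma no_cancel_push: "no_cancel w \<Longrightarrow> no_cancel (push x w)"
  by (auto simp: push_alt no_cancel_Cons split: list.split)

lemma no_cancel_foldr: "no_cancel w \<Longrightarrow> no_cancel (foldr push u w)"
  by (induction u) (auto simp: no_cancel_push)

lemma push_no_cancel: "no_cancel (x # w) \<Longrightarrow> push x w = x # w"
  by (cases w) (auto simp: push_alt)

lemma fg_reduce_no_cancel: "no_cancel w \<Longrightarrow> fg_reduce w = w"
  by (induction w) (use push_no_cancel no_cancel_Cons in \<open>auto simp: fg_reduce_foldr\<close>)

lemma fg_reduced_iff: "fg_reduced w \<longleftrightarrow> no_cancel w"
  unfolding fg_reduced_def
  by (metis fg_reduce_no_cancel fg_reduce_foldr no_cancel_foldr no_cancel.simps(2))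

lemma push_flip: "no_cancel w \<Longrightarrow> push x (push (flip x) w) = w"
  by (cases w; cases "tl w") (auto simp: push_alt)

lemma foldr_push_push:
  assumes "no_cancel w"
  shows "foldr push (push x u) w = push x (foldr push u w)"
proof (cases u)
  case (Cons y v)
  then show ?thesis
    using push_flip[OF no_cancel_foldr[OF assms, of v], of x] by (auto simp: push_alt)
qed (simp add: push_alt)

text \<open>Cancelling inside \<open>u\<close> does not change how \<open>u\<close> acts on reduced
  words, since cancelling letters act as mutual inverses; associativity in
  \<open>free_grp_group\<close> rests on this.\<close>

lemma foldr_push_reduce: "no_cancel w \<Longrightarrow> foldr push (fg_reduce u) w = foldr push u w"
  by (induction u) (simp_all add: fg_reduce_foldr foldr_push_push)

lemma fg_reduce_append: "no_cancel w \<Longrightarrow> fg_reduce (u @ w) = foldr push u w"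
  using fg_reduce_no_cancel[of w] by (simp add: fg_reduce_foldr)

lemma set_foldr_push: "set (foldr push u w) \<subseteq> set u \<union> set w"
proof (induction u)
  case (Cons x u)
  have "set (push x v) \<subseteq> insert x (set v)" for v
    by (auto simp: push_alt split: list.split)
  then show ?case using Cons by fastforce
qed simp

lemma free_grp_simps:
  "carrier (free_grp n) = {w. no_cancel w \<and> (\<forall>a\<in>set w. fst a < n)}"
  "\<one>\<^bsub>free_grp n\<^esub> = []"
  "no_cancel w \<Longrightarrow> u \<otimes>\<^bsub>free_grp n\<^esub> w = foldr push u w"
  by (simp_all add: free_grp_def fg_reduced_iff fg_reduce_append)

lemma free_grp_mult_closed:
  "u \<in> carrier (free_grp n) \<Longrightarrow> w \<in> carrier (free_grp n) \<Longrightarrow>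
    foldr push u w \<in> carrier (free_grp n)"
  using set_foldr_push[of u w] by (auto simp: free_grp_simps(1) no_cancel_foldr)

lemma foldr_push_rev: "no_cancel w \<Longrightarrow> foldr push (rev (map flip u)) (foldr push u w) = w"
proof (induction u arbitrary: w)
  case (Cons x u)
  have "push (flip x) (push x (foldr push u w)) = foldr push u w"
    using push_flip[OF no_cancel_foldr[OF Cons.prems], of "flip x" u] by simp
  then show ?case using Cons by simp
qed simp

lemma free_grp_group: "group (free_grp n)"
proof (rule groupI)
  fix x assume x: "x \<in> carrier (free_grp n)"
  define y where "y = fg_reduce (rev (map flip x))"
  have "no_cancel y" "set y \<subseteq> flip ` set x"
    using no_cancel_foldr[of "[]" "rev (map flip x)"] set_foldr_push[of "rev (map flip x)" "[]"]
    by (simp_all add: y_def fg_reduce_foldr)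
  moreover have "fst a < n" if "a \<in> set y" for a
    using that x subsetD[OF \<open>set y \<subseteq> flip ` set x\<close> that] by (auto simp: free_grp_simps(1))
  ultimately have y: "y \<in> carrier (free_grp n)" by (simp add: free_grp_simps(1))
  have nx: "no_cancel x" using x by (simp add: free_grp_simps(1))
  have "y \<otimes>\<^bsub>free_grp n\<^esub> x = foldr push (rev (map flip x)) (foldr push x [])"
    using nx fg_reduce_no_cancel[OF nx]
    by (simp add: free_grp_simps(3) y_def foldr_push_reduce) (simp add: fg_reduce_foldr)
  also have "\<dots> = []" by (rule foldr_push_rev) simp
  finally show "\<exists>y\<in>carrier (free_grp n). y \<otimes>\<^bsub>free_grp n\<^esub> x = \<one>\<^bsub>free_grp n\<^esub>"
    using y by (auto simp: free_grp_simps(2))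
next
  fix x y z assume "x \<in> carrier (free_grp n)" "y \<in> carrier (free_grp n)" "z \<in> carrier (free_grp n)"
  then have n: "no_cancel x" "no_cancel y" "no_cancel z" by (auto simp: free_grp_simps)
  have "foldr push (foldr push x y) z = foldr push (x @ y) z"
    using foldr_push_reduce[OF n(3), of "x @ y"] fg_reduce_append[OF n(2)] by simp
  then show "x \<otimes>\<^bsub>free_grp n\<^esub> y \<otimes>\<^bsub>free_grp n\<^esub> z = x \<otimes>\<^bsub>free_grp n\<^esub> (y \<otimes>\<^bsub>free_grp n\<^esub> z)"
    using n by (simp add: free_grp_simps(3) no_cancel_foldr)
qed (auto simp: free_grp_simps free_grp_mult_closed no_cancel_foldr dest: subsetD[OF set_foldr_push])

lemma free_grp_Cons:
  assumes "a # w \<in> carrier (free_grp n)"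
  shows "w \<in> carrier (free_grp n)" "[a] \<in> carrier (free_grp n)" "a # w = [a] \<otimes>\<^bsub>free_grp n\<^esub> w"
  using assms push_no_cancel[of a w] no_cancel_Cons[of a w]
  by (auto simp: free_grp_simps)

lemma free_grp_flip:
  assumes "[a] \<in> carrier (free_grp n)"
  shows "[flip a] \<in> carrier (free_grp n)" "[a] \<otimes>\<^bsub>free_grp n\<^esub> [flip a] = \<one>\<^bsub>free_grp n\<^esub>"
    "inv\<^bsub>free_grp n\<^esub> [a] = [flip a]"
proof -
  show 1: "[flip a] \<in> carrier (free_grp n)" using assms by (auto simp: free_grp_simps)
  show 2: "[a] \<otimes>\<^bsub>free_grp n\<^esub> [flip a] = \<one>\<^bsub>free_grp n\<^esub>"
    by (simp add: free_grp_simps push_alt)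
  have "[flip a] \<otimes>\<^bsub>free_grp n\<^esub> [a] = \<one>\<^bsub>free_grp n\<^esub>"
    by (simp add: free_grp_simps push_alt)
  then show "inv\<^bsub>free_grp n\<^esub> [a] = [flip a]"
    using assms 1 group.inv_equality[OF free_grp_group] by metis
qed

lemma free_grp_generate:
  "carrier (free_grp n) = generate (free_grp n) {[(i, True)] | i. i < n}" (is "_ = generate ?F ?S")
proof -
  interpret group ?F by (rule free_grp_group)
  have S: "?S \<subseteq> carrier ?F" by (auto simp: free_grp_simps)
  have let_gen: "[a] \<in> generate ?F ?S" if "[a] \<in> carrier ?F" for a
  proof (cases "snd a")
    case True
    then show ?thesis using that by (cases a) (auto simp: free_grp_simps intro!: generate.incl)
  next
    case False
    then have "flip a = (fst a, True)" by (simp add: flip_def)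
    then have "inv\<^bsub>?F\<^esub> [flip a] \<in> generate ?F ?S"
      using that by (intro generate.inv) (auto simp: free_grp_simps)
    then show ?thesis using free_grp_flip[of "flip a" n] free_grp_flip[OF that] by simp
  qed
  have "w \<in> generate ?F ?S" if "w \<in> carrier ?F" for w
    using that
  proof (induction w)
    case Nil then show ?case using generate.one[of ?F] by (simp add: free_grp_simps(2))
  next
    case (Cons a w)
    note C = free_grp_Cons[OF Cons.prems]
    show ?case unfolding C(3) by (intro generate.eng let_gen C Cons.IH)
  qed
  then show ?thesis using generate_incl[OF S] by blast
qed

text \<open>The values live in \<open>'p\<close> modulo a subgroup \<open>B\<close>, so that no quotient type is needed.\<close>
lemma free_grp_cocycle:
  fixes \<omega> :: "(nat \<times> bool) list \<Rightarrow> (nat \<times> bool) list \<Rightarrow> 'p::ab_group_add" and B :: "'p set"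
  assumes B0: "0 \<in> B" and Bd: "\<And>a b. a \<in> B \<Longrightarrow> b \<in> B \<Longrightarrow> a - b \<in> B"
    and coc: "\<And>x y z. x \<in> carrier (free_grp n) \<Longrightarrow> y \<in> carrier (free_grp n) \<Longrightarrow>
      z \<in> carrier (free_grp n) \<Longrightarrow>
      \<omega> y z - \<omega> (x \<otimes>\<^bsub>free_grp n\<^esub> y) z + \<omega> x (y \<otimes>\<^bsub>free_grp n\<^esub> z) - \<omega> x y \<in> B"
  shows "\<exists>f. \<forall>x\<in>carrier (free_grp n). \<forall>y\<in>carrier (free_grp n).
    f x + f y - f (x \<otimes>\<^bsub>free_grp n\<^esub> y) - \<omega> x y \<in> B"
proof -
  let ?F = "free_grp n"
  interpret group ?F by (rule free_grp_group)
  \<comment> \<open>The cocycle is not assumed normalized: modulo \<open>B\<close> its values at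
    pairs with an empty entry are all \<open>?w0\<close>, which is therefore the value of
    \<open>f\<close> at the identity.\<close>
  let ?w0 = "\<omega> [] []"
  have Bm: "- a \<in> B" if "a \<in> B" for a using Bd[OF B0 that] by simp
  have Ba: "a + b \<in> B" if "a \<in> B" "b \<in> B" for a b using Bd[OF that(1) Bm[OF that(2)]] by simp
  have one: "[] \<in> carrier ?F" using one_closed by (simp add: free_grp_simps(2))
  have oneL: "[] \<otimes>\<^bsub>?F\<^esub> x = x" "x \<otimes>\<^bsub>?F\<^esub> [] = x" if "x \<in> carrier ?F" for x
    using that l_one r_one by (simp_all add: free_grp_simps(2))
  have L: "\<omega> [] x - ?w0 \<in> B" if "x \<in> carrier ?F" for x
    using coc[OF one one that] one that by (simp add: oneL)
  have R: "?w0 - \<omega> x [] \<in> B" if "x \<in> carrier ?F" for x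
    using coc[OF that one one] one that by (simp add: oneL)
  \<comment> \<open>Positive letters may get any value, here 0. For a negative letter
    \<open>a\<close> the equation for the pair \<open>[flip a]\<close>, \<open>[a]\<close>, whose
    product is the identity with value \<open>?w0\<close>, then dictates the value.\<close>
  define f1 where "f1 a = (if snd a then 0 else ?w0 + \<omega> [flip a] [a])" for a
  define f where "f = rec_list ?w0 (\<lambda>a w v. f1 a + v - \<omega> [a] w)"
  have f_simps: "f [] = ?w0" "f (a # w) = f1 a + f w - \<omega> [a] w" for a w
    by (simp_all add: f_def)
  have inv_pair: "?w0 + \<omega> [a] [flip a] - (f1 a + f1 (flip a)) \<in> B" if a: "[a] \<in> carrier ?F" for a
  proof (cases "snd a")
    case True then show ?thesis using B0 by (simp add: f1_def)
  next
    case False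
    note fl = free_grp_flip[OF a] free_grp_flip(2)[of "flip a" n, simplified, OF free_grp_flip(1)[OF a]]
    have "\<omega> [flip a] [a] - \<omega> [] [a] + \<omega> [a] [] - \<omega> [a] [flip a] \<in> B"
      using coc[OF a fl(1) a] fl by (simp add: free_grp_simps(2))
    from Bm[OF Ba[OF Ba[OF this L[OF a]] R[OF a]]]
    show ?thesis using False by (simp add: f1_def algebra_simps)
  qed
  \<comment> \<open>For a reduced \<open>a # w\<close> the recursion defining \<open>f\<close> is
    the wanted equation itself, so only the case in which \<open>a\<close> cancels the head of
    \<open>w\<close> needs the cocycle identity.\<close>
  have step: "f1 a + f w - \<omega> [a] w - f ([a] \<otimes>\<^bsub>?F\<^esub> w) \<in> B"
    if a: "[a] \<in> carrier ?F" and w: "w \<in> carrier ?F" for a w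
  proof (cases "push a w = a # w")
    case True
    then show ?thesis using w B0 by (simp add: free_grp_simps f_simps)
  next
    case False
    then obtain v where v: "w = flip a # v" "push a w = v"
      by (cases w) (auto simp: push_alt split: if_splits)
    note vc = free_grp_Cons[OF w[unfolded v(1)]]
    have "\<omega> [flip a] v - \<omega> [] v + \<omega> [a] w - \<omega> [a] [flip a] \<in> B"
      using coc[OF a vc(2,1)] free_grp_flip[OF a] vc(3) v(1) by (simp add: free_grp_simps(2))
    from Bm[OF Ba[OF Ba[OF this L[OF vc(1)]] inv_pair[OF a]]]
    have "f1 a + (f1 (flip a) + f v - \<omega> [flip a] v) - \<omega> [a] w - f v \<in> B"
      by (simp add: algebra_simps)
    then show ?thesis using v w by (simp add: free_grp_simps f_simps)
  qed
  have "f u + f w - f (u \<otimes>\<^bsub>?F\<^esub> w) - \<omega> u w \<in> B" if "u \<in> carrier ?F" "w \<in> carrier ?F" for u w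
    using that(1)
  proof (induction u)
    case Nil
    then show ?case using Bm[OF L[OF that(2)]] that(2) by (simp add: f_simps oneL)
  next
    case (Cons a u)
    note C = free_grp_Cons[OF Cons.prems]
    note w = that(2)
    have e: "(a # u) \<otimes>\<^bsub>?F\<^esub> w = [a] \<otimes>\<^bsub>?F\<^esub> (u \<otimes>\<^bsub>?F\<^esub> w)"
      unfolding C(3) using C w by (simp add: m_assoc)
    have "\<omega> u w - \<omega> (a # u) w + \<omega> [a] (u \<otimes>\<^bsub>?F\<^esub> w) - \<omega> [a] u \<in> B"
      using coc[OF C(2,1) w] C(3) by simp
    from Ba[OF Ba[OF this Cons.IH[OF C(1)]] step[OF C(2) m_closed[OF C(1) w]]]
    show ?case unfolding e by (simp add: f_simps algebra_simps)
  qed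
  then show ?thesis by blast
qed

section \<open>Magnus expansion\<close>

text \<open>Noncommutative integral power series, a word being a monomial. A separate type carries
  the concatenation product, whereas the product on plain functions is pointwise.\<close>

datatype ncps = NCPS (coeff: "nat list \<Rightarrow> int")

lemma ncps_eqI: "(\<And>w. coeff f w = coeff g w) \<Longrightarrow> f = g"
  by (cases f; cases g) auto

instantiation ncps :: ring_1
begin
definition "0 = NCPS (\<lambda>_. 0)"
definition "1 = NCPS (\<lambda>w. if w = [] then 1 else 0)"
definition "f + g = NCPS (\<lambda>w. coeff f w + coeff g w)"
definition "- f = NCPS (\<lambda>w. - coeff f w)"
definition "f - g = NCPS (\<lambda>w. coeff f w - coeff g w)"
definition "f * g = NCPS (\<lambda>w. \<Sum>i\<le>length w. coeff f (take i w) * coeff g (drop i w))"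

lemma coeff_simps [simp]:
  "coeff 0 w = 0" "coeff 1 w = (if w = [] then 1 else 0)"
  "coeff (f + g) w = coeff f w + coeff g w" "coeff (- f) w = - coeff f w"
  "coeff (f - g) w = coeff f w - coeff g w"
  by (simp_all add: zero_ncps_def one_ncps_def plus_ncps_def uminus_ncps_def minus_ncps_def)

lemma coeff_mult: "coeff (f * g) w = (\<Sum>i\<le>length w. coeff f (take i w) * coeff g (drop i w))"
  by (simp add: times_ncps_def)

instance
proof
  fix a b c :: ncps
  \<comment> \<open>Both sides run over the splittings of a word into three pieces: on the left
    \<open>j\<close> is the length of the first two together, on the right that of the first
    alone.\<close>
  have tri: "(\<Sum>j\<le>n. \<Sum>i\<le>j. g i (j - i)) = (\<Sum>j\<le>n. \<Sum>i\<le>n - j. g j i)"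
    for n :: nat and g :: "nat \<Rightarrow> nat \<Rightarrow> int"
    by (induction n) (simp_all add: Suc_diff_le sum.distrib add.assoc)
  show "a * b * c = a * (b * c)"
  proof (rule ncps_eqI)
    fix w :: "nat list"
    let ?g = "\<lambda>i m. coeff a (take i w) * coeff b (take m (drop i w)) * coeff c (drop (i + m) w)"
    have "coeff (a * b * c) w = (\<Sum>j\<le>length w. \<Sum>i\<le>j. ?g i (j - i))"
      unfolding coeff_mult sum_distrib_right
      by (intro sum.cong refl) (auto simp: min_def drop_take)
    also have "\<dots> = (\<Sum>j\<le>length w. \<Sum>i\<le>length w - j. ?g j i)" by (rule tri)
    also have "\<dots> = coeff (a * (b * c)) w"
      unfolding coeff_mult sum_distrib_left
      by (intro sum.cong refl) (auto simp: mult.assoc add.commute)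
    finally show "coeff (a * b * c) w = coeff (a * (b * c)) w" .
  qed
  show "1 * a = a"
  proof (rule ncps_eqI)
    fix w :: "nat list"
    have "coeff (1 * a) w = (\<Sum>i\<in>{0}. coeff 1 (take i w) * coeff a (drop i w))"
      unfolding coeff_mult by (rule sum.mono_neutral_right) auto
    then show "coeff (1 * a) w = coeff a w" by simp
  qed
  show "a * 1 = a"
  proof (rule ncps_eqI)
    fix w :: "nat list"
    have "coeff (a * 1) w = (\<Sum>i\<in>{length w}. coeff a (take i w) * coeff 1 (drop i w))"
      unfolding coeff_mult by (rule sum.mono_neutral_right) auto
    then show "coeff (a * 1) w = coeff a w" by simp
  qed
  have "coeff (0::ncps) [] \<noteq> coeff 1 []" by simp
  then show "(0::ncps) \<noteq> 1" by metis
qed (auto intro!: ncps_eqI simp: coeff_mult algebra_simps sum.distrib)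

end

definition ord_ge :: "nat \<Rightarrow> ncps \<Rightarrow> bool" where
  "ord_ge k f \<longleftrightarrow> (\<forall>w. length w < k \<longrightarrow> coeff f w = 0)"

lemma ord_ge_simps: "ord_ge k 0" "ord_ge 0 f" "ord_ge k f \<Longrightarrow> ord_ge k g \<Longrightarrow> ord_ge k (f + g)"
  "ord_ge k f \<Longrightarrow> ord_ge k (- f)" "ord_ge k f \<Longrightarrow> ord_ge k g \<Longrightarrow> ord_ge k (f - g)"
  by (simp_all add: ord_ge_def)

lemma ord_ge_mult:
  assumes "ord_ge a f" "ord_ge b g" shows "ord_ge (a + b) (f * g)"
  unfolding ord_ge_def
proof safe
  fix w :: "nat list" assume "length w < a + b"
  then have "coeff f (take i w) * coeff g (drop i w) = 0" if "i \<le> length w" for i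
    using assms that by (cases "i < a") (simp_all add: ord_ge_def)
  then show "coeff (f * g) w = 0" unfolding coeff_mult by (intro sum.neutral) auto
qed

lemma coeff_mult_lowest:
  assumes "ord_ge a f" "ord_ge b g" "length w = a + b"
  shows "coeff (f * g) w = coeff f (take a w) * coeff g (drop a w)"
proof -
  have "coeff f (take i w) * coeff g (drop i w) = 0" if "i \<noteq> a" "i \<le> length w" for i
    using assms that by (cases "i < a") (simp_all add: ord_ge_def)
  then have "coeff (f * g) w = (\<Sum>i\<in>{a}. coeff f (take i w) * coeff g (drop i w))"
    unfolding coeff_mult using assms(3) by (intro sum.mono_neutral_right) auto
  then show ?thesis by simp
qed

text \<open>The Magnus images: 1 + X for a generator, and the geometric series in -X for its
  inverse, whose monomials are the words in that one letter.\<close>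

definition mgen :: "nat \<times> bool \<Rightarrow> ncps" where
  "mgen a = NCPS (\<lambda>w. if snd a then (if w = [] \<or> w = [fst a] then 1 else 0)
     else if set w \<subseteq> {fst a} then (-1) ^ length w else 0)"

lemma mgen_flip: "mgen a * mgen (flip a) = 1"
proof (rule ncps_eqI)
  fix w :: "nat list"
  obtain i b where a: "a = (i, b)" by (cases a)
  show "coeff (mgen a * mgen (flip a)) w = coeff 1 w"
  proof (cases b)
    case True
    \<comment> \<open>The factor 1 + X has just two nonzero coefficients, so at most two splittings
      of \<open>w\<close> contribute; in positive degree they cancel. When \<open>b\<close> is false
      the same happens at the other end of the word.\<close>
    have z: "coeff (mgen a) (take j w) * coeff (mgen (flip a)) (drop j w) = 0"
      if "j \<le> length w" "j \<noteq> 0" "j \<noteq> 1" for j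
      using that True by (auto simp: mgen_def a flip_def take_eq_Nil dest: arg_cong[of _ _ length])
    show ?thesis
    proof (cases w)
      case Nil then show ?thesis using True by (simp add: coeff_mult mgen_def a flip_def)
    next
      case (Cons x v)
      have "coeff (mgen a * mgen (flip a)) w =
          (\<Sum>j\<in>{0,1}. coeff (mgen a) (take j w) * coeff (mgen (flip a)) (drop j w))"
        unfolding coeff_mult using z Cons by (intro sum.mono_neutral_right) auto
      then show ?thesis using Cons True by (simp add: mgen_def a flip_def)
    qed
  next
    case False
    have z: "coeff (mgen a) (take j w) * coeff (mgen (flip a)) (drop j w) = 0"
      if "j \<le> length w" "j \<noteq> length w" "j \<noteq> length w - 1" for j
      using that False by (auto simp: mgen_def a flip_def dest: arg_cong[of _ _ length])
    show ?thesis
    proof (cases w rule: rev_cases)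
      case Nil then show ?thesis using False by (simp add: coeff_mult mgen_def a flip_def)
    next
      case (snoc v x)
      have "coeff (mgen a * mgen (flip a)) w =
          (\<Sum>j\<in>{length v, Suc (length v)}. coeff (mgen a) (take j w) * coeff (mgen (flip a)) (drop j w))"
        unfolding coeff_mult using z snoc by (intro sum.mono_neutral_right) auto
      then show ?thesis using snoc False by (simp add: mgen_def a flip_def)
    qed
  qed
qed

definition magnus :: "(nat \<times> bool) list \<Rightarrow> ncps" where
  "magnus w = foldr (\<lambda>a f. mgen a * f) w 1"

lemma magnus_simps [simp]: "magnus [] = 1" "magnus (a # w) = mgen a * magnus w"
  by (simp_all add: magnus_def)

lemma magnus_push: "magnus (push a w) = mgen a * magnus w"
  using mgen_flip[of a] by (auto simp: push_alt mult.assoc[symmetric] split: list.split)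

lemma magnus_mult:
  assumes "w \<in> carrier (free_grp n)"
  shows "magnus (u \<otimes>\<^bsub>free_grp n\<^esub> w) = magnus u * magnus w"
proof -
  have "magnus (foldr push u w) = magnus u * magnus w"
    by (induction u) (simp_all add: magnus_push mult.assoc)
  then show ?thesis using assms by (simp add: free_grp_simps)
qed

lemma magnus_inv:
  assumes "x \<in> carrier (free_grp n)"
  shows "magnus x * magnus (inv\<^bsub>free_grp n\<^esub> x) = 1"
proof -
  interpret group "free_grp n" by (rule free_grp_group)
  have "magnus x * magnus (inv\<^bsub>free_grp n\<^esub> x) = magnus \<one>\<^bsub>free_grp n\<^esub>"
    using assms magnus_mult[of "inv\<^bsub>free_grp n\<^esub> x" n x] by simp
  then show ?thesis by (simp add: free_grp_simps(2))
qed

lemma magnus_ord_1: "ord_ge 1 (magnus w - 1)"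
proof (induction w)
  case (Cons a w)
  have "ord_ge 1 (mgen a - 1)" by (auto simp: ord_ge_def mgen_def)
  from ord_ge_simps(3)[OF ord_ge_mult[OF this ord_ge_simps(2), of "magnus w", unfolded add_0_right] Cons]
  show ?case by (simp add: algebra_simps)
qed (simp add: ord_ge_simps)

text \<open>A commutator is (xy) times the inverse of (yx), so its image minus 1 is a ring
  commutator times \<open>V\<close>, the image of that inverse. The ring commutator does not change
  when 1 is subtracted from both entries, and \<open>V\<close> has constant term 1, hence no
  influence in lowest degree.\<close>

lemma magnus_cmt_aux:
  assumes "x \<in> carrier (free_grp n)" "y \<in> carrier (free_grp n)"
    and "ord_ge a (magnus x - 1)" "ord_ge b (magnus y - 1)"
  obtains V where "magnus (group.cmt (free_grp n) x y) - 1 =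
      ((magnus x - 1) * (magnus y - 1) - (magnus y - 1) * (magnus x - 1)) * V"
    "ord_ge 1 (V - 1)"
proof -
  interpret group "free_grp n" by (rule free_grp_group)
  let ?c = "cmt x y" and ?yx = "y \<otimes>\<^bsub>free_grp n\<^esub> x" and ?X = "magnus x" and ?Y = "magnus y"
  let ?V = "magnus (inv\<^bsub>free_grp n\<^esub> ?yx)"
  have e: "?c = (x \<otimes>\<^bsub>free_grp n\<^esub> y) \<otimes>\<^bsub>free_grp n\<^esub> inv\<^bsub>free_grp n\<^esub> ?yx"
    using assms by (simp add: cmt_def group_word_simps)
  have "magnus ?c = ?X * ?Y * ?V"
    unfolding e using assms by (simp add: magnus_mult)
  moreover have "?Y * ?X * ?V = 1" using magnus_inv[of ?yx n] assms by (simp add: magnus_mult)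
  ultimately have "magnus ?c - 1 = (?X * ?Y - ?Y * ?X) * ?V" by (simp add: algebra_simps)
  also have "?X * ?Y - ?Y * ?X = (?X - 1) * (?Y - 1) - (?Y - 1) * (?X - 1)"
    by (simp add: algebra_simps)
  finally show ?thesis using that magnus_ord_1 by blast
qed

lemma magnus_cmt:
  assumes "x \<in> carrier (free_grp n)" "y \<in> carrier (free_grp n)"
    and ord: "ord_ge a (magnus x - 1)" "ord_ge b (magnus y - 1)"
  shows "ord_ge (a + b) (magnus (group.cmt (free_grp n) x y) - 1)"
    "length w = a + b \<Longrightarrow> coeff (magnus (group.cmt (free_grp n) x y) - 1) w =
      coeff (magnus x - 1) (take a w) * coeff (magnus y - 1) (drop a w) -
      coeff (magnus y - 1) (take b w) * coeff (magnus x - 1) (drop b w)"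
proof -
  let ?XY = "(magnus x - 1) * (magnus y - 1)" and ?YX = "(magnus y - 1) * (magnus x - 1)"
  obtain V where V: "magnus (group.cmt (free_grp n) x y) - 1 = (?XY - ?YX) * V" "ord_ge 1 (V - 1)"
    using magnus_cmt_aux[OF assms] by blast
  have XY: "ord_ge (a + b) (?XY - ?YX)"
    using ord_ge_mult[OF ord] ord_ge_mult[OF ord(2,1)] by (intro ord_ge_simps) (auto simp: add.commute)
  show "ord_ge (a + b) (magnus (group.cmt (free_grp n) x y) - 1)"
    unfolding V(1) using ord_ge_mult[OF XY ord_ge_simps(2), of V] by simp
  assume w: "length w = a + b"
  have "ord_ge (a + b + 1) ((?XY - ?YX) * (V - 1))" by (rule ord_ge_mult[OF XY V(2)])
  then have "coeff ((?XY - ?YX) * (V - 1)) w = 0" using w by (simp add: ord_ge_def)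
  moreover have "(?XY - ?YX) * V = (?XY - ?YX) + (?XY - ?YX) * (V - 1)" by (simp add: algebra_simps)
  ultimately have "coeff (magnus (group.cmt (free_grp n) x y) - 1) w = coeff ?XY w - coeff ?YX w"
    unfolding V(1) by (metis add.right_neutral coeff_simps(3,5))
  then show "coeff (magnus (group.cmt (free_grp n) x y) - 1) w =
      coeff (magnus x - 1) (take a w) * coeff (magnus y - 1) (drop a w) -
      coeff (magnus y - 1) (take b w) * coeff (magnus x - 1) (drop b w)"
    unfolding coeff_mult_lowest[OF ord w] coeff_mult_lowest[OF ord(2,1) w[unfolded add.commute[of a]]] .
qed

text \<open>The easy half of Magnus' theorem, by additivity of degrees in \<open>magnus_cmt\<close>;
  \<open>lead_detects\<close> supplies the other half.\<close>

lemma magnus_lcs: "x \<in> lcs_aux (free_grp n) k \<Longrightarrow> ord_ge (Suc k) (magnus x - 1)"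
proof (induction k arbitrary: x)
  case 0 then show ?case using magnus_ord_1 by simp
next
  case (Suc k)
  interpret group "free_grp n" by (rule free_grp_group)
  let ?A = "\<Union>h\<in>carrier (free_grp n). \<Union>x\<in>lcs_aux (free_grp n) k. {cmt h x}"
  have A: "?A \<subseteq> carrier (free_grp n)" using lcs_carrier by auto
  have base: "ord_ge (Suc (Suc k)) (magnus a - 1)" if "a \<in> ?A" for a
  proof -
    obtain h x where h: "h \<in> carrier (free_grp n)" "x \<in> lcs_aux (free_grp n) k" "a = cmt h x"
      using \<open>a \<in> ?A\<close> by blast
    show ?thesis unfolding h(3)
      using magnus_cmt(1)[OF h(1) lcs_carrier[OF h(2)] magnus_ord_1 Suc.IH[OF h(2)]] by simp
  qed
  show ?case using Suc.prems unfolding lcs_Suc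
  proof (induction rule: generate.induct)
    case one show ?case by (simp add: free_grp_simps(2) ord_ge_simps)
  next
    case (incl h) then show ?case by (rule base)
  next
    case (inv h)
    have "ord_ge (Suc (Suc k) + 0) ((magnus h - 1) * magnus (inv\<^bsub>free_grp n\<^esub> h))"
      by (rule ord_ge_mult[OF base[OF inv] ord_ge_simps(2)])
    moreover have "magnus h * magnus (inv\<^bsub>free_grp n\<^esub> h) = 1"
      by (rule magnus_inv) (use A inv in blast)
    ultimately have "ord_ge (Suc (Suc k)) (1 - magnus (inv\<^bsub>free_grp n\<^esub> h))"
      by (simp add: algebra_simps)
    from ord_ge_simps(4)[OF this] show ?case by simp
  next
    case (eng h1 h2)
    have "ord_ge (Suc (Suc k) + 0) ((magnus h1 - 1) * magnus h2)"
      by (rule ord_ge_mult[OF eng.IH(1) ord_ge_simps(2)])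
    from ord_ge_simps(3)[OF this[unfolded add_0_right] eng.IH(2)]
    show ?case using generate_in_carrier[OF A eng.hyps(2)] by (simp add: magnus_mult algebra_simps)
  qed
qed

definition lead :: "nat list \<Rightarrow> (nat \<times> bool) list \<Rightarrow> int" where
  "lead w x = coeff (magnus x) w"

text \<open>The product of the two tails has degree at least 2k+2, so in degree k+1 the coefficients
  simply add.\<close>

lemma lead_mult:
  assumes "x \<in> lcs_aux (free_grp n) k" "y \<in> lcs_aux (free_grp n) k" "length w = Suc k"
  shows "lead w (x \<otimes>\<^bsub>free_grp n\<^esub> y) = lead w x + lead w y"
proof -
  interpret group "free_grp n" by (rule free_grp_group)
  let ?X = "magnus x - 1" and ?Y = "magnus y - 1"
  have "ord_ge (Suc k + Suc k) (?X * ?Y)" by (rule ord_ge_mult[OF assms(1,2)[THEN magnus_lcs]])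
  then have z: "coeff (?X * ?Y) w = 0" using assms by (simp add: ord_ge_def)
  have "magnus (x \<otimes>\<^bsub>free_grp n\<^esub> y) = magnus x + magnus y + ?X * ?Y - 1"
    using lcs_carrier[OF assms(2)] by (simp add: magnus_mult algebra_simps)
  then show ?thesis using z assms(3) by (auto simp: lead_def)
qed

lemma lead_lcs_Suc:
  assumes "x \<in> lcs_aux (free_grp n) (Suc k)" "length w = Suc k" shows "lead w x = 0"
  using magnus_lcs[OF assms(1)] assms(2) by (auto simp: ord_ge_def lead_def)

lemma lead_conj:
  assumes g: "g \<in> carrier (free_grp n)" and x: "x \<in> lcs_aux (free_grp n) k" and w: "length w = Suc k"
  shows "lead w (g \<otimes>\<^bsub>free_grp n\<^esub> x \<otimes>\<^bsub>free_grp n\<^esub> inv\<^bsub>free_grp n\<^esub> g) = lead w x"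
proof -
  interpret group "free_grp n" by (rule free_grp_group)
  have c: "cmt g x \<in> lcs_aux (free_grp n) (Suc k)" by (rule cmt_lcs_Suc[OF g x])
  have "g \<otimes>\<^bsub>free_grp n\<^esub> x \<otimes>\<^bsub>free_grp n\<^esub> inv\<^bsub>free_grp n\<^esub> g = cmt g x \<otimes>\<^bsub>free_grp n\<^esub> x"
    using g lcs_carrier[OF x] by (simp add: cmt_def group_word_simps)
  then show ?thesis
    using lead_mult[OF subsetD[OF lcs_Suc_subset c] x w] lead_lcs_Suc[OF c w] by simp
qed

section \<open>Lyndon trees\<close>

datatype ltree = Leaf nat | Node ltree ltree

primrec word :: "ltree \<Rightarrow> nat list" where
  "word (Leaf i) = [i]"
| "word (Node u v) = word u @ word v"

text \<open>These are the trees of iterated standard factorizations of Lyndon words; the last condition says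
  that \<open>word v\<close> is the longest proper Lyndon suffix of \<open>word u @ word v\<close>.\<close>
fun lyndon :: "ltree \<Rightarrow> bool" where
  "lyndon (Leaf i) \<longleftrightarrow> True"
| "lyndon (Node u v) \<longleftrightarrow> lyndon u \<and> lyndon v \<and> word u < word v \<and>
     (case u of Leaf _ \<Rightarrow> True | Node _ u2 \<Rightarrow> word v \<le> word u2)"

lemma word_nonempty [simp]: "word t \<noteq> []"
  by (induction t) auto

lemma length_word_pos: "0 < length (word t)"
  by simp

lemma less_append_same: "(u @ v < u @ w) = (v < (w :: nat list))"
  by (induction u) auto

lemma less_eq_append: "(u :: nat list) \<le> u @ v"
  by (induction u) auto

text \<open>Either \<open>u\<close> is a proper prefix, or the words differ at a common position,
  and then the comparison survives arbitrary extensions of both.\<close>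

lemma less_list_cases:
  fixes u v :: "nat list"
  assumes "u < v"
  obtains s where "s \<noteq> []" "v = u @ s" | "\<And>a b. u @ a < v @ b"
proof -
  have "(\<exists>s. s \<noteq> [] \<and> v = u @ s) \<or> (\<forall>a b. u @ a < v @ b)"
    using assms
  proof (induction u arbitrary: v)
    case Nil then show ?case by (cases v) auto
  next
    case (Cons x u) then show ?case by (cases v) auto
  qed
  then show ?thesis using that by blast
qed

lemma less_append_eq_length:
  fixes u v :: "nat list"
  assumes "u < v" "length u = length v" shows "u @ a < v @ b"
  using assms(1) by (rule less_list_cases) (use assms(2) in auto)

text \<open>Both parts come from one induction. A suffix cutting properly into \<open>word u\<close>
  has the form \<open>us @ word v\<close>, and the induction hypothesis with the standardness clause
  gives \<open>word v \<le> word u2 \<le> us\<close>. So \<open>word v\<close> is the least proper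
  suffix, and it exceeds the whole word.\<close>

lemma lyndon_suffix:
  assumes "lyndon t" "word t = a @ s" "a \<noteq> []" "s \<noteq> []"
  shows "word t < s" "t = Node u v \<Longrightarrow> word v \<le> s"
proof -
  have "word t < s \<and> (\<forall>u v. t = Node u v \<longrightarrow> word v \<le> s)" using assms
  proof (induction t arbitrary: a s)
    case (Leaf i) then show ?case by (cases a) auto
  next
    case (Node u v)
    have uv: "word u < word v" "lyndon u" "lyndon v" using Node.prems by auto
    have "word u @ word v < word v" using uv(1)
    proof (cases rule: less_list_cases)
      case (1 s')
      then have "word v < s'" using Node.IH(2)[OF uv(3), of "word u" s'] by simp
      then have "word u @ word v < word u @ s'" by (simp add: less_append_same)
      then show ?thesis using 1 by simp
    next
      case 2 then show ?thesis using 2[of "word v" "[]"] by simp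
    qed
    moreover have "word v \<le> s"
    proof -
      have "(\<exists>us. word u @ us = a \<and> word v = us @ s) \<or> (\<exists>us. word u = a @ us \<and> us @ word v = s)"
        using Node.prems(2) by (auto simp: append_eq_append_conv2)
      then show ?thesis
      proof (elim disjE exE conjE)
        fix us assume us: "word u @ us = a" "word v = us @ s"
        then show ?thesis using Node.IH(2)[OF uv(3) us(2) _ Node.prems(4)] by (cases "us = []") auto
      next
        fix us assume us: "word u = a @ us" "us @ word v = s"
        show ?thesis
        proof (cases "us = []")
          case False
          then obtain u1 u2 where u: "u = Node u1 u2" using us Node.prems(3) by (cases u; cases a) auto
          have "word u2 \<le> us" using Node.IH(1)[OF uv(2) us(1) Node.prems(3) False] u by auto
          moreover have "word v \<le> word u2" using Node.prems(1) u by auto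
          ultimately show ?thesis using less_eq_append[of us "word v"] us(2) by auto
        qed (use us in simp)
      qed
    qed
    ultimately show ?case using less_le_trans by auto
  qed
  then show "word t < s" "t = Node u v \<Longrightarrow> word v \<le> s" by auto
qed

text \<open>Excludes two factorizations of one word cut at different places:
  \<open>s @ word v\<close> would be at least \<open>word v\<close>, because
  \<open>word v \<le> s\<close>, and also below it, because it is a Lyndon word with
  \<open>word v\<close> as a proper suffix.\<close>

lemma lyndon_factor_unique:
  assumes "lyndon (Node u v)" "lyndon v'" "word u = a @ s" "a \<noteq> []" "s \<noteq> []" "word v' = s @ word v"
  shows False
proof -
  obtain u1 u2 where u: "u = Node u1 u2" using assms(3-5) by (cases u; cases a) auto
  have "word v \<le> word u2" using assms(1) u by auto
  also have "word u2 \<le> s" using lyndon_suffix(2)[OF _ assms(3-5) u] assms(1) by simp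
  also have "s \<le> s @ word v" by (rule less_eq_append)
  also have "s @ word v < word v" using lyndon_suffix(1)[OF assms(2,6,5)] assms(6) by simp
  finally show False by simp
qed

lemma lyndon_word_inj: "lyndon t \<Longrightarrow> lyndon t' \<Longrightarrow> word t = word t' \<Longrightarrow> t = t'"
proof (induction t arbitrary: t')
  case (Leaf i)
  then show ?case
    by (cases t') (auto simp: append_eq_Cons_conv Cons_eq_append_conv)
next
  case (Node u v)
  then obtain u' v' where t': "t' = Node u' v'"
    by (cases t') (auto simp: append_eq_Cons_conv)
  have w: "word u @ word v = word u' @ word v'" using Node.prems t' by simp
  show ?case
  proof (cases "length (word u) = length (word u')")
    case True
    then show ?thesis using w Node t' by auto
  next
    case False
    from w consider us where "word u = word u' @ us" "us @ word v = word v'"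
      | us where "word u @ us = word u'" "word v = us @ word v'"
      unfolding append_eq_append_conv2 by blast
    then show ?thesis
    proof cases
      case 1
      then have "us \<noteq> []" using False by auto
      then show ?thesis
        using lyndon_factor_unique[OF Node.prems(1) _ 1(1) word_nonempty _ 1(2)[symmetric]] Node.prems(2) t'
        by simp
    next
      case 2
      then have "us \<noteq> []" using False by auto
      then show ?thesis
        using lyndon_factor_unique[OF Node.prems(2)[unfolded t'] _ 2(1)[symmetric] word_nonempty _ 2(2)] Node.prems(1)
        by simp
    qed
  qed
qed

section \<open>Lyndon commutators generate the layers of the lower central series\<close>

primrec ltree_eval :: "('a, 'b) monoid_scheme \<Rightarrow> (nat \<Rightarrow> 'a) \<Rightarrow> ltree \<Rightarrow> 'a" where
  "ltree_eval G e (Leaf i) = e i"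
| "ltree_eval G e (Node u v) = group.cmt G (ltree_eval G e u) (ltree_eval G e v)"

definition lyndon_trees :: "nat \<Rightarrow> nat \<Rightarrow> ltree set" where
  "lyndon_trees n m = {t. lyndon t \<and> set (word t) \<subseteq> {..<n} \<and> length (word t) = m}"

lemma finite_lyndon_trees: "finite (lyndon_trees n m)"
proof (rule inj_on_finite)
  show "inj_on word (lyndon_trees n m)"
    by (auto simp: inj_on_def lyndon_trees_def intro: lyndon_word_inj)
  show "word ` lyndon_trees n m \<subseteq> {w. set w \<subseteq> {..<n} \<and> length w = m}"
    by (auto simp: lyndon_trees_def)
qed (simp add: finite_lists_length_eq)

context group
begin

text \<open>Here \<open>m\<close> is a weight and \<open>lcs_aux G m\<close> is the (m+1)-st term:
  for trees with \<open>m\<close> leaves this is the preimage of the subgroup that they generate in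
  the m-th term modulo the next one.\<close>

definition lyndon_span :: "(nat \<Rightarrow> 'a) \<Rightarrow> nat \<Rightarrow> ltree set \<Rightarrow> 'a set" where
  "lyndon_span e m T = generate G (lcs_aux G m \<union> ltree_eval G e ` T)"

lemma ltree_eval_lcs:
  assumes "\<And>i. i < n \<Longrightarrow> e i \<in> carrier G" "set (word t) \<subseteq> {..<n}"
  shows "ltree_eval G e t \<in> lcs_aux G (length (word t) - 1)"
  using assms(2)
proof (induction t)
  case (Leaf i) then show ?case using assms(1) by simp
next
  case (Node u v)
  have "Suc ((length (word u) - 1) + (length (word v) - 1)) = length (word (Node u v)) - 1"
    using length_word_pos[of u] length_word_pos[of v] unfolding word.simps length_append by linarith
  then show ?case using cmt_lcs[of "ltree_eval G e u" _ "ltree_eval G e v"] Node by fastforce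
qed

lemma ltree_eval_carrier:
  assumes "\<And>i. i < n \<Longrightarrow> e i \<in> carrier G" "set (word t) \<subseteq> {..<n}"
  shows "ltree_eval G e t \<in> carrier G"
  by (rule lcs_carrier[OF ltree_eval_lcs[OF assms]])

text \<open>Modulo \<open>lcs_aux G (Suc k)\<close> the subgroup \<open>lcs_aux G k\<close> is
  central, so every subgroup between the two is normal.\<close>

lemma lyndon_span_normal:
  assumes "\<And>i. i < n \<Longrightarrow> e i \<in> carrier G" "T \<subseteq> lyndon_trees n (Suc k)"
  shows "lyndon_span e (Suc k) T \<lhd> G" "lyndon_span e (Suc k) T \<subseteq> lcs_aux G k"
proof -
  let ?S = "lyndon_span e (Suc k) T"
  have "ltree_eval G e ` T \<subseteq> lcs_aux G k"
    using ltree_eval_lcs[where e=e and n=n] assms by (fastforce simp: lyndon_trees_def)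
  then have sub: "lcs_aux G (Suc k) \<union> ltree_eval G e ` T \<subseteq> lcs_aux G k"
    using lcs_Suc_subset by blast
  then show S: "?S \<subseteq> lcs_aux G k"
    unfolding lyndon_span_def by (rule generate_subgroup_incl[OF _ lcs_subgroup])
  have sg: "subgroup ?S G"
    unfolding lyndon_span_def using sub lcs_carrier by (intro generate_is_subgroup) blast
  have "g \<otimes> s \<otimes> inv g \<in> ?S" if g: "g \<in> carrier G" and s: "s \<in> ?S" for g s
  proof -
    have "cmt g s \<in> lcs_aux G (Suc k)" using cmt_lcs_Suc[OF g] S s by blast
    then have "cmt g s \<in> ?S" unfolding lyndon_span_def by (intro generate.incl) simp
    then have "cmt g s \<otimes> s \<in> ?S" using s sg by (simp add: subgroup.m_closed)
    moreover have "cmt g s \<otimes> s = g \<otimes> s \<otimes> inv g"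
      using g subgroup.mem_carrier[OF sg s] by (simp add: cmt_def group_word_simps)
    ultimately show ?thesis by simp
  qed
  then show "?S \<lhd> G" using sg by (simp add: normal_inv_iff)
qed

lemma lyndon_span_lcs: "x \<in> lcs_aux G m \<Longrightarrow> x \<in> lyndon_span e m T"
  unfolding lyndon_span_def by (intro generate.incl) simp

lemma lyndon_span_eval: "t \<in> T \<Longrightarrow> ltree_eval G e t \<in> lyndon_span e m T"
  unfolding lyndon_span_def by (intro generate.incl) simp

lemma lyndon_span_mono: "S \<subseteq> T \<Longrightarrow> lyndon_span e m S \<subseteq> lyndon_span e m T"
  unfolding lyndon_span_def by (intro mono_generate) blast

lemma lyndon_span_induct_left:
  assumes e: "\<And>i. i < n \<Longrightarrow> e i \<in> carrier G" and T: "T \<subseteq> lyndon_trees n (Suc k)"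
    and N: "N \<lhd> G" and z: "z \<in> carrier G" and x: "x \<in> lyndon_span e (Suc k) T"
    and 1: "\<And>y. y \<in> lcs_aux G (Suc k) \<Longrightarrow> cmt y z \<in> N"
    and 2: "\<And>t. t \<in> T \<Longrightarrow> cmt (ltree_eval G e t) z \<in> N"
  shows "cmt x z \<in> N"
proof (rule cmt_generate_left[OF N _ z _ x[unfolded lyndon_span_def]])
  show "lcs_aux G (Suc k) \<union> ltree_eval G e ` T \<subseteq> carrier G"
    using lcs_carrier ltree_eval_carrier[where e=e and n=n] e T by (fastforce simp: lyndon_trees_def)
qed (use 1 2 in auto)

text \<open>The straightening step. Take \<open>word u < word v\<close>. If \<open>Node u v\<close>
  is not itself a Lyndon tree, then \<open>u = Node a b\<close> with \<open>word b < word v\<close>,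
  and Jacobi replaces the bracket by those of (b,v) with \<open>a\<close> and of (v,a) with
  \<open>b\<close>. The inner brackets have smaller weight and expand into trees strictly below
  \<open>word v\<close>; bracketing these with \<open>a\<close> or \<open>b\<close> has a smaller
  maximal word. The strict bound in the conclusion is what lets this second induction run.\<close>

lemma lyndon_bracket:
  assumes e: "\<And>i. i < n \<Longrightarrow> e i \<in> carrier G"
    and u: "lyndon u" "set (word u) \<subseteq> {..<n}" and v: "lyndon v" "set (word v) \<subseteq> {..<n}"
    and N: "N = length (word u) + length (word v)"
  shows "cmt (ltree_eval G e u) (ltree_eval G e v) \<in>
    lyndon_span e N {t \<in> lyndon_trees n N. word t < max (word u) (word v)}"
  using u v N
proof (induction N arbitrary: u v rule: less_induct)
  case (less N)
  \<comment> \<open>The lexicographic order on lists is not well-founded, but on the finitely many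
    words of length at most \<open>N\<close> over \<open>n\<close> letters the position can serve as
    an induction measure.\<close>
  define rank where "rank w = card {x. set x \<subseteq> {..<n} \<and> length x \<le> N \<and> x < w}" for w :: "nat list"
  have rank_less: "rank w < rank w'" if "w < w'" "set w \<subseteq> {..<n}" "length w \<le> N" for w w'
    unfolding rank_def
  proof (rule psubset_card_mono)
    show "finite {x. set x \<subseteq> {..<n} \<and> length x \<le> N \<and> x < w'}"
      by (rule finite_subset[OF _ finite_lists_length_le[of "{..<n}" N]]) auto
    show "{x. set x \<subseteq> {..<n} \<and> length x \<le> N \<and> x < w} \<subset> {x. set x \<subseteq> {..<n} \<and> length x \<le> N \<and> x < w'}"
      using that by auto
  qed
  let ?S = "\<lambda>w. lyndon_span e N {t \<in> lyndon_trees n N. word t < w}"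
  let ?ev = "ltree_eval G e"
  have evc: "?ev t \<in> carrier G" if "set (word t) \<subseteq> {..<n}" for t
    using ltree_eval_carrier[OF e that] .
  have "0 < N" using less.prems(5) length_word_pos[of u] by linarith
  then obtain M where M: "N = Suc M" by (cases N) auto
  have Snormal: "?S w \<lhd> G" for w unfolding M by (rule lyndon_span_normal(1)[OF e]) auto
  show ?case using less.prems
  proof (induction "rank (max (word u) (word v))" arbitrary: u v rule: less_induct)
    case (less u v)
    note outer = \<open>\<And>y u v. y < N \<Longrightarrow> lyndon u \<Longrightarrow> set (word u) \<subseteq> {..<n} \<Longrightarrow> lyndon v \<Longrightarrow>
      set (word v) \<subseteq> {..<n} \<Longrightarrow> y = length (word u) + length (word v) \<Longrightarrow>
      cmt (?ev u) (?ev v) \<in> lyndon_span e y {t \<in> lyndon_trees n y. word t < max (word u) (word v)}\<close>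
    note inner = less.hyps
    \<comment> \<open>Stated for fresh \<open>u\<close> and \<open>v\<close> with the inner
      hypothesis as a premise, so that it also applies with the two trees exchanged.\<close>
    have main: "cmt (?ev u) (?ev v) \<in> ?S (word v)"
      if uv: "word u < word v" and u: "lyndon u" "set (word u) \<subseteq> {..<n}"
        and v: "lyndon v" "set (word v) \<subseteq> {..<n}" and N: "N = length (word u) + length (word v)"
        and inn: "\<And>u' v'. rank (max (word u') (word v')) < rank (word v) \<Longrightarrow>
          lyndon u' \<Longrightarrow> set (word u') \<subseteq> {..<n} \<Longrightarrow> lyndon v' \<Longrightarrow> set (word v') \<subseteq> {..<n} \<Longrightarrow>
          N = length (word u') + length (word v') \<Longrightarrow> cmt (?ev u') (?ev v') \<in> ?S (max (word u') (word v'))"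
      for u v
    proof (cases "lyndon (Node u v)")
      case True
      then have "word (Node u v) < word v" using lyndon_suffix(1)[of "Node u v" "word u" "word v"] by simp
      then have "Node u v \<in> {t \<in> lyndon_trees n N. word t < word v}"
        using True u v N by (simp add: lyndon_trees_def)
      from lyndon_span_eval[OF this, of e N] show ?thesis by simp
    next
      case False
      then obtain a b where ab: "u = Node a b" "word b < word v"
        using u v uv by (cases u) auto
      have la: "lyndon a" "lyndon b" "set (word a) \<subseteq> {..<n}" "set (word b) \<subseteq> {..<n}"
        using u ab by auto
      have "word a \<le> word u" using ab less_eq_append by simp
      then have av: "word a < word v" using uv by simp
      let ?V = "?ev v" and ?A = "?ev a" and ?B = "?ev b"
      have c: "?V \<in> carrier G" "?A \<in> carrier G" "?B \<in> carrier G" using evc v la by auto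
      define i where "i = length (word a) - 1"
      define j where "j = length (word b) - 1"
      define k where "k = length (word v) - 1"
      have ijk: "length (word a) = Suc i" "length (word b) = Suc j" "length (word v) = Suc k"
        unfolding i_def j_def k_def using length_word_pos by (simp_all only: Suc_diff_1)
      have Nijk: "N = Suc (Suc (Suc (i + j + k)))" using N ab ijk by simp
      have lc: "?A \<in> lcs_aux G i" "?B \<in> lcs_aux G j" "?V \<in> lcs_aux G k"
        using ltree_eval_lcs[OF e la(3)] ltree_eval_lcs[OF e la(4)] ltree_eval_lcs[OF e v(2)] ijk by auto
      have lcsS: "x \<in> ?S (word v)" if "x \<in> lcs_aux G d" "N \<le> d" for x d
        using lyndon_span_lcs[of x N] lcs_antimono[OF that(2)] that(1) by blast
      have brBV: "cmt ?B ?V \<in> lcs_aux G (Suc (j + k))" and brVA: "cmt ?V ?A \<in> lcs_aux G (Suc (k + i))"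
        and brAB: "cmt ?A ?B \<in> lcs_aux G (Suc (i + j))" by (intro cmt_lcs lc)+
      \<comment> \<open>One Jacobi term: the outer hypothesis expands the inner bracket, and each
        resulting tree lies, like \<open>z\<close>, below \<open>word v\<close>, so the inner
        hypothesis handles its bracket with \<open>z\<close>.\<close>
      have step: "cmt (cmt (?ev x) (?ev y)) (?ev z) \<in> ?S (word v)"
        if x: "lyndon x" "set (word x) \<subseteq> {..<n}" and y: "lyndon y" "set (word y) \<subseteq> {..<n}"
          and z: "lyndon z" "set (word z) \<subseteq> {..<n}" and len: "length (word x) + length (word y) + length (word z) = N"
          and mx: "max (word x) (word y) = word v" and zv: "word z < word v" for x y z
      proof -
        define m where "m = length (word x) + length (word y) - 1"
        have m: "Suc m = length (word x) + length (word y)" using length_word_pos[of x] unfolding m_def by linarith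
        have mN: "Suc m < N" using m len length_word_pos[of z] by linarith
        have br: "cmt (?ev x) (?ev y) \<in> lyndon_span e (Suc m) {t \<in> lyndon_trees n (Suc m). word t < word v}"
          using outer[OF mN x y m] unfolding mx .
        show ?thesis
        proof (rule lyndon_span_induct_left[OF e _ Snormal evc[OF z(2)] br])
          fix w assume "w \<in> lcs_aux G (Suc m)"
          from cmt_lcs[OF this ltree_eval_lcs[OF e z(2)]]
          moreover have "N \<le> Suc (Suc m + (length (word z) - 1))"
            using m len Suc_diff_1[OF length_word_pos[of z]] by linarith
          ultimately show "cmt w (?ev z) \<in> ?S (word v)" by (rule lcsS)
        next
          fix t assume "t \<in> {t \<in> lyndon_trees n (Suc m). word t < word v}"
          then have t: "lyndon t" "set (word t) \<subseteq> {..<n}" "length (word t) = Suc m" "word t < word v"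
            by (auto simp: lyndon_trees_def)
          have mv: "max (word t) (word z) < word v" using t zv by simp
          have "rank (max (word t) (word z)) < rank (word v)"
            by (rule rank_less[OF mv]) (use t z m len mN in \<open>auto simp: max_def\<close>)
          then have "cmt (?ev t) (?ev z) \<in> ?S (max (word t) (word z))"
            by (intro inn t z) (use m len t in auto)
          also have "\<dots> \<subseteq> ?S (word v)" by (rule lyndon_span_mono) (use mv order_less_trans in blast)
          finally show "cmt (?ev t) (?ev z) \<in> ?S (word v)" .
        qed auto
      qed
      have "cmt (cmt ?A ?B) ?V \<in> ?S (word v)"
      proof (rule jacobi_mem[OF Snormal])
        show "cmt (cmt ?B ?V) ?A \<in> ?S (word v)"
          by (rule step) (use la v ab av N in \<open>auto simp: max_def\<close>)
        show "cmt (cmt ?V ?A) ?B \<in> ?S (word v)"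
          by (rule step) (use la v ab av N in \<open>auto simp: max_def\<close>)
        \<comment> \<open>In these brackets of two brackets one of \<open>a\<close>,
          \<open>b\<close>, \<open>v\<close> occurs twice, so their weight exceeds \<open>N\<close>
          and they lie in \<open>lcs_aux G N\<close>.\<close>
        show "cmt (cmt ?B ?V) (cmt ?V ?A) \<in> ?S (word v)"
          by (rule lcsS[OF cmt_lcs[OF brBV brVA]]) (simp add: Nijk)
        show "cmt (cmt ?V ?A) (cmt ?A ?B) \<in> ?S (word v)"
          by (rule lcsS[OF cmt_lcs[OF brVA brAB]]) (simp add: Nijk)
        show "cmt (cmt ?A ?B) (cmt ?B ?V) \<in> ?S (word v)"
          by (rule lcsS[OF cmt_lcs[OF brAB brBV]]) (simp add: Nijk)
      qed (use c in auto)
      then show ?thesis by (simp add: ab)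
    qed
    consider "word u < word v" | "word v < word u" | "word u = word v" by (rule linorder_cases)
    then show ?case
    proof cases
      case 1
      then have mx: "max (word u) (word v) = word v" by simp
      show ?thesis unfolding mx by (rule main[OF 1 less.prems inner[unfolded mx]])
    next
      case 2
      then have mx: "max (word u) (word v) = word u" by simp
      have N: "N = length (word v) + length (word u)" using less.prems(5) by simp
      have "cmt (?ev v) (?ev u) \<in> ?S (word u)"
        by (rule main[OF 2 less.prems(3,4,1,2) N inner[unfolded mx]])
      then have "cmt (?ev u) (?ev v) \<in> ?S (word u)"
        using cmt_mem_swap[OF Snormal] evc less.prems by blast
      then show ?thesis unfolding mx .
    next
      case 3
      then have "u = v" using lyndon_word_inj less.prems by blast
      then have "cmt (?ev u) (?ev v) = \<one>" using evc less.prems by (simp add: cmt_def group_word_simps)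
      then show ?thesis using normal_imp_subgroup[OF Snormal] by (simp add: subgroup.one_closed)
    qed
  qed
qed

text \<open>Modulo the span at the next level, commuting with \<open>h\<close> only has to be tested
  on trees and, for each tree, on the generators; the commutator of a tree with a generator is a
  case of \<open>lyndon_bracket\<close> with a leaf.\<close>

lemma lcs_lyndon_span:
  assumes e: "\<And>i. i < n \<Longrightarrow> e i \<in> carrier G" and gen: "carrier G = generate G (e ` {..<n})"
  shows "lcs_aux G k = lyndon_span e (Suc k) (lyndon_trees n (Suc k))"
proof
  show "lyndon_span e (Suc k) (lyndon_trees n (Suc k)) \<subseteq> lcs_aux G k"
    by (rule lyndon_span_normal(2)[OF e order_refl])
  show "lcs_aux G k \<subseteq> lyndon_span e (Suc k) (lyndon_trees n (Suc k))"
  proof (induction k)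
    case 0
    have "e ` {..<n} \<subseteq> ltree_eval G e ` lyndon_trees n (Suc 0)"
    proof safe
      fix i assume "i < n"
      then have "Leaf i \<in> lyndon_trees n (Suc 0)" by (simp add: lyndon_trees_def)
      then show "e i \<in> ltree_eval G e ` lyndon_trees n (Suc 0)" by force
    qed
    then show ?case unfolding lyndon_span_def lcs_aux.simps(1)
      by (subst (1) gen) (intro mono_generate, blast)
  next
    case (Suc k)
    let ?S = "lyndon_span e (Suc (Suc k)) (lyndon_trees n (Suc (Suc k)))"
    have N: "?S \<lhd> G" by (rule lyndon_span_normal(1)[OF e order_refl])
    have "cmt h x \<in> ?S" if h: "h \<in> carrier G" and x: "x \<in> lcs_aux G k" for h x
    proof -
      have "cmt x h \<in> ?S"
      proof (rule lyndon_span_induct_left[OF e order_refl N h subsetD[OF Suc x]])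
        fix y assume "y \<in> lcs_aux G (Suc k)"
        from cmt_lcs_Suc'[OF h this] show "cmt y h \<in> ?S" by (rule lyndon_span_lcs)
      next
        fix t assume t: "t \<in> lyndon_trees n (Suc k)"
        then have tc: "ltree_eval G e t \<in> carrier G"
          by (intro ltree_eval_carrier[OF e]) (auto simp: lyndon_trees_def)
        show "cmt (ltree_eval G e t) h \<in> ?S"
        proof (rule cmt_generate_right[OF N _ tc _ h[unfolded gen]])
          fix a assume "a \<in> e ` {..<n}"
          then obtain i where i: "i < n" "a = ltree_eval G e (Leaf i)" by auto
          have "cmt (ltree_eval G e t) (ltree_eval G e (Leaf i)) \<in> lyndon_span e (Suc (Suc k))
              {s \<in> lyndon_trees n (Suc (Suc k)). word s < max (word t) (word (Leaf i))}"
            by (rule lyndon_bracket[OF e]) (use t i in \<open>auto simp: lyndon_trees_def\<close>)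
          also have "\<dots> \<subseteq> ?S" by (rule lyndon_span_mono) auto
          finally show "cmt (ltree_eval G e t) a \<in> ?S" using i by simp
        qed (use e in auto)
      qed
      then show ?thesis using cmt_mem_swap[OF N _ h] x lcs_carrier by blast
    qed
    then show ?case unfolding lcs_Suc
      by (intro generate_subgroup_incl normal_imp_subgroup N) auto
  qed
qed

end

section \<open>Leading Magnus coefficients of Lyndon commutators\<close>

lemma free_grp_letter: "i < n \<Longrightarrow> [(i, True)] \<in> carrier (free_grp n)"
  by (simp add: free_grp_simps)

abbreviation letter_eval :: "nat \<Rightarrow> ltree \<Rightarrow> (nat \<times> bool) list" where
  "letter_eval n \<equiv> ltree_eval (free_grp n) (\<lambda>i. [(i, True)])"

lemma coeff_minus_one: "w \<noteq> [] \<Longrightarrow> coeff (f - 1) w = coeff f w"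
  by simp

lemma letter_eval_lcs:
  assumes "set (word t) \<subseteq> {..<n}"
  shows "letter_eval n t \<in> lcs_aux (free_grp n) (length (word t) - 1)"
  by (rule group.ltree_eval_lcs[OF free_grp_group _ assms]) (rule free_grp_letter)

text \<open>In lowest degree the image of a node is a difference of two products. By induction the
  first starts at \<open>word u @ word v\<close> with coefficient 1; the second starts no earlier
  than \<open>word v @ word u\<close>, which is larger because the whole word lies below its suffix
  \<open>word v\<close>.\<close>

lemma lead_lyndon:
  assumes "lyndon t" "set (word t) \<subseteq> {..<n}" "length w = length (word t)"
  shows "w < word t \<Longrightarrow> lead w (letter_eval n t) = 0" "lead (word t) (letter_eval n t) = 1"
proof -
  interpret group "free_grp n" by (rule free_grp_group)
  have "(w < word t \<longrightarrow> lead w (letter_eval n t) = 0) \<and> (w = word t \<longrightarrow> lead w (letter_eval n t) = 1)"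
    if "length w = length (word t)" for w
    using assms(1,2) that
  proof (induction t arbitrary: w)
    case (Leaf i)
    then show ?case by (cases w) (auto simp: lead_def mgen_def)
  next
    case (Node u v)
    have uv: "lyndon u" "lyndon v" "set (word u) \<subseteq> {..<n}" "set (word v) \<subseteq> {..<n}" using Node.prems by auto
    let ?a = "length (word u)" and ?b = "length (word v)"
    let ?U = "letter_eval n u" and ?V = "letter_eval n v"
    have mem: "?U \<in> carrier (free_grp n)" "?V \<in> carrier (free_grp n)"
      using letter_eval_lcs uv lcs_carrier by blast+
    have ord: "ord_ge ?a (magnus ?U - 1)" "ord_ge ?b (magnus ?V - 1)"
      using magnus_lcs[OF letter_eval_lcs[OF uv(3)]] magnus_lcs[OF letter_eval_lcs[OF uv(4)]]
        Suc_diff_1[OF length_word_pos] by simp_all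
    have len: "length w = ?a + ?b" using Node.prems by simp
    have ne: "w \<noteq> []" "take ?a w \<noteq> []" "take ?b w \<noteq> []" "drop ?a w \<noteq> []" "drop ?b w \<noteq> []"
      using len length_word_pos[of u] length_word_pos[of v] by (auto simp del: length_word_pos)
    have lead: "lead w (letter_eval n (Node u v)) =
        lead (take ?a w) ?U * lead (drop ?a w) ?V - lead (take ?b w) ?V * lead (drop ?b w) ?U"
      using magnus_cmt(2)[OF mem ord len] unfolding coeff_minus_one[OF ne(1)] coeff_minus_one[OF ne(2)]
        coeff_minus_one[OF ne(3)] coeff_minus_one[OF ne(4)] coeff_minus_one[OF ne(5)]
      by (simp add: lead_def)
    have lt: "length (take ?a w) = ?a" "length (drop ?a w) = ?b" "length (take ?b w) = ?b" "length (drop ?b w) = ?a"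
      using len by auto
    have below: "w1 @ w2 < w1' @ w2'" if "length w1 = length w1'" "w1 < w1' \<or> w1 = w1' \<and> w2 < w2'"
      for w1 w2 w1' w2' :: "nat list"
      using that less_append_eq_length less_append_same by blast
    have nz1: "word (Node u v) \<le> w" if "lead (take ?a w) ?U * lead (drop ?a w) ?V \<noteq> 0"
    proof -
      have "\<not> take ?a w < word u" "\<not> drop ?a w < word v"
        using that Node.IH(1)[OF uv(1,3) lt(1)] Node.IH(2)[OF uv(2,4) lt(2)] by auto
      then have "\<not> take ?a w @ drop ?a w < word u @ word v"
        using below[of "word u" "take ?a w" "word v" "drop ?a w"] lt(1)
        by (metis antisym_conv3 less_append_same less_asym)
      then show ?thesis by simp
    qed
    have nz2: "word (Node u v) < w" if "lead (take ?b w) ?V * lead (drop ?b w) ?U \<noteq> 0"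
    proof -
      have "\<not> take ?b w < word v" "\<not> drop ?b w < word u"
        using that Node.IH(2)[OF uv(2,4) lt(3)] Node.IH(1)[OF uv(1,3) lt(4)] by auto
      then have "\<not> take ?b w @ drop ?b w < word v @ word u"
        using below[of "word v" "take ?b w" "word u" "drop ?b w"] lt(3)
        by (metis antisym_conv3 less_append_same less_asym)
      then have "word v @ word u \<le> w" by simp
      moreover have "word (Node u v) < word v"
        using lyndon_suffix(1)[OF Node.prems(1), of "word u" "word v"] by simp
      ultimately show ?thesis using less_eq_append[of "word v" "word u"] by order
    qed
    show ?case
    proof (intro conjI impI)
      assume "w < word (Node u v)"
      then show "lead w (letter_eval n (Node u v)) = 0"
        unfolding lead using nz1 nz2 by (metis diff_self leD less_asym)
    next
      assume w: "w = word (Node u v)"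
      have "lead (take ?b w) ?V * lead (drop ?b w) ?U = 0" using nz2 w by blast
      moreover have "lead (take ?a w) ?U = 1" "lead (drop ?a w) ?V = 1"
        using Node.IH(1)[OF uv(1,3) lt(1)] Node.IH(2)[OF uv(2,4) lt(2)] w by simp_all
      ultimately show "lead w (letter_eval n (Node u v)) = 1" unfolding lead by simp
    qed
  qed
  from this[OF assms(3)] this[OF refl]
  show "w < word t \<Longrightarrow> lead w (letter_eval n t) = 0" "lead (word t) (letter_eval n t) = 1" by auto
qed

lemma lead_inv:
  assumes "x \<in> lcs_aux (free_grp n) k" "length w = Suc k"
  shows "lead w (inv\<^bsub>free_grp n\<^esub> x) = - lead w x"
proof -
  interpret group "free_grp n" by (rule free_grp_group)
  have i: "inv\<^bsub>free_grp n\<^esub> x \<in> lcs_aux (free_grp n) k"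
    using assms lcs_subgroup by (simp add: subgroup.m_inv_closed)
  have "lead w \<one>\<^bsub>free_grp n\<^esub> = 0" using assms(2) by (auto simp: lead_def free_grp_simps)
  then show ?thesis using lead_mult[OF assms(1) i assms(2)] lcs_carrier[OF assms(1)] by simp
qed

lemma lead_int_pow:
  assumes "x \<in> lcs_aux (free_grp n) k" "length w = Suc k"
  shows "lead w (x [^]\<^bsub>free_grp n\<^esub> (c::int)) = c * lead w x"
proof -
  interpret group "free_grp n" by (rule free_grp_group)
  have one: "lead w \<one>\<^bsub>free_grp n\<^esub> = 0" using assms(2) by (auto simp: lead_def free_grp_simps)
  have pw: "x [^]\<^bsub>free_grp n\<^esub> (m::nat) \<in> lcs_aux (free_grp n) k" for m
    using assms(1) lcs_subgroup normal_mult_mem[OF lcs_normal]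
    by (induction m) (auto simp: subgroup.one_closed)
  have np: "lead w (x [^]\<^bsub>free_grp n\<^esub> (m::nat)) = int m * lead w x" for m
  proof (induction m)
    case 0
    show ?case using one by (simp only: nat_pow_0 of_nat_0 mult_zero_left)
  next
    case (Suc m)
    have "lead w (x [^]\<^bsub>free_grp n\<^esub> Suc m) = lead w (x [^]\<^bsub>free_grp n\<^esub> m) + lead w x"
      unfolding nat_pow_Suc by (rule lead_mult[OF pw assms])
    also have "\<dots> = int (Suc m) * lead w x" unfolding Suc.IH by (simp add: distrib_right)
    finally show ?case .
  qed
  show ?thesis
  proof (cases c rule: int_cases2)
    case (nonneg m)
    then show ?thesis by (simp only: int_pow_int np)
  next
    case (nonpos m)
    then show ?thesis
      by (simp only: int_pow_neg_int[OF lcs_carrier[OF assms(1)]] lead_inv[OF pw assms(2)] np mult_minus_left)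
  qed
qed

lemma lead_detects:
  assumes r: "r \<in> lcs_aux (free_grp n) k" "r \<notin> lcs_aux (free_grp n) (Suc k)"
  shows "\<exists>w. length w = Suc k \<and> lead w r \<noteq> 0"
proof (rule ccontr)
  interpret group "free_grp n" by (rule free_grp_group)
  let ?F = "free_grp n" and ?e = "\<lambda>i. [(i, True)]"
  assume "\<not> (\<exists>w. length w = Suc k \<and> lead w r \<noteq> 0)"
  then have z: "lead w r = 0" if "length w = Suc k" for w using that by blast
  have e: "[(i, True)] \<in> carrier ?F" if "i < n" for i using that by (rule free_grp_letter)
  have "carrier ?F = generate ?F (?e ` {..<n})"
    unfolding free_grp_generate[of n] by (rule arg_cong[where f="generate ?F"]) auto
  then have "r \<in> lyndon_span ?e (Suc k) (lyndon_trees n (Suc k))"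
    using r(1) lcs_lyndon_span[OF e] by simp
  moreover have "r \<in> lcs_aux ?F (Suc k)"
    if "finite T" "T \<subseteq> lyndon_trees n (Suc k)" "r \<in> lyndon_span ?e (Suc k) T" for T
    using that
  proof (induction "card T" arbitrary: T rule: less_induct)
    case less
    show ?case
    proof (cases "T = {}")
      case True
      then show ?thesis using less.prems(3) generate_subgroup_incl[OF order_refl lcs_subgroup]
        by (auto simp: lyndon_span_def)
    next
      case False
      \<comment> \<open>The least word is the right choice because a tree has coefficient 0 at all
        words below its own.\<close>
      obtain t where t: "t \<in> T" "\<And>s. s \<in> T \<Longrightarrow> word t \<le> word s"
      proof -
        have "Min (word ` T) \<in> word ` T" using less.prems False by (intro Min_in) auto
        then obtain t where "t \<in> T" "word t = Min (word ` T)" by auto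
        then show ?thesis using that less.prems by (metis Min_le finite_imageI image_eqI)
      qed
      define T' where "T' = T - {t}"
      have T': "T' \<subseteq> lyndon_trees n (Suc k)" "finite T'" "card T' < card T"
        using less.prems t card_Diff1_less[of T t] unfolding T'_def by auto
      let ?N = "lyndon_span ?e (Suc k) T'" and ?t = "letter_eval n t"
      have N: "?N \<lhd> ?F" "?N \<subseteq> lcs_aux ?F k" using lyndon_span_normal[OF e T'(1)] by auto
      have t': "lyndon t" "set (word t) \<subseteq> {..<n}" "length (word t) = Suc k"
        using less.prems t by (auto simp: lyndon_trees_def)
      have tl: "?t \<in> lcs_aux ?F k" using letter_eval_lcs[OF t'(2)] t'(3) by simp
      have tc: "?t \<in> carrier ?F" using lcs_carrier[OF tl] .
      have gen: "x \<in> lcs_aux ?F (Suc k) \<union> letter_eval n ` T' \<or> x = ?t"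
        if "x \<in> lcs_aux ?F (Suc k) \<union> letter_eval n ` T" for x
        using that t unfolding T'_def by blast
      have Nc: "y \<in> carrier ?F" if "y \<in> ?N" for y using that N lcs_carrier by blast
      \<comment> \<open>Since \<open>?N\<close> is normal, all powers of \<open>?t\<close> can be
        collected on the left.\<close>
      have dec: "\<exists>c::int. \<exists>y\<in>?N. x = ?t [^]\<^bsub>?F\<^esub> c \<otimes>\<^bsub>?F\<^esub> y"
        if "x \<in> generate ?F (lcs_aux ?F (Suc k) \<union> letter_eval n ` T)" for x
        using that
      proof (induction rule: generate.induct)
        case one
        show ?case
          using subgroup.one_closed[OF normal_imp_subgroup[OF N(1)]]
          by (intro exI[of _ 0] bexI[of _ "\<one>\<^bsub>?F\<^esub>"]) auto
      next
        case (incl h)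
        from gen[OF this] show ?case
        proof
          assume "h \<in> lcs_aux ?F (Suc k) \<union> letter_eval n ` T'"
          then have "h \<in> ?N" unfolding lyndon_span_def by (rule generate.incl)
          then show ?thesis by (intro exI[of _ 0] bexI[of _ h]) (auto simp: Nc)
        next
          assume "h = ?t"
          then show ?thesis
            using tc subgroup.one_closed[OF normal_imp_subgroup[OF N(1)]]
            by (intro exI[of _ 1] bexI[of _ "\<one>\<^bsub>?F\<^esub>"]) auto
        qed
      next
        case (inv h)
        from gen[OF this] show ?case
        proof
          assume "h \<in> lcs_aux ?F (Suc k) \<union> letter_eval n ` T'"
          then have "inv\<^bsub>?F\<^esub> h \<in> ?N" unfolding lyndon_span_def by (rule generate.inv)
          then show ?thesis by (intro exI[of _ 0] bexI[of _ "inv\<^bsub>?F\<^esub> h"]) (auto simp: Nc)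
        next
          assume "h = ?t"
          then show ?thesis
            using tc subgroup.one_closed[OF normal_imp_subgroup[OF N(1)]]
            by (intro exI[of _ "-1"] bexI[of _ "\<one>\<^bsub>?F\<^esub>"]) (auto simp: int_pow_neg)
        qed
      next
        case (eng x1 x2)
        then obtain c d y z where y: "y \<in> ?N" "x1 = ?t [^]\<^bsub>?F\<^esub> (c::int) \<otimes>\<^bsub>?F\<^esub> y"
          and z: "z \<in> ?N" "x2 = ?t [^]\<^bsub>?F\<^esub> (d::int) \<otimes>\<^bsub>?F\<^esub> z" by blast
        let ?p = "?t [^]\<^bsub>?F\<^esub> d"
        have "x1 \<otimes>\<^bsub>?F\<^esub> x2 = ?t [^]\<^bsub>?F\<^esub> (c + d) \<otimes>\<^bsub>?F\<^esub> ((inv\<^bsub>?F\<^esub> ?p \<otimes>\<^bsub>?F\<^esub> y \<otimes>\<^bsub>?F\<^esub> ?p) \<otimes>\<^bsub>?F\<^esub> z)"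
          using y z Nc tc by (simp add: group_word_simps int_pow_mult)
        moreover have "(inv\<^bsub>?F\<^esub> ?p \<otimes>\<^bsub>?F\<^esub> y \<otimes>\<^bsub>?F\<^esub> ?p) \<otimes>\<^bsub>?F\<^esub> z \<in> ?N"
          using y z tc by (intro normal_mult_mem[OF N(1)] conj_mem'[OF N(1)]) auto
        ultimately show ?case by blast
      qed
      obtain c y where y: "y \<in> ?N" "r = ?t [^]\<^bsub>?F\<^esub> (c::int) \<otimes>\<^bsub>?F\<^esub> y"
        using dec less.prems(3) unfolding lyndon_span_def by blast
      have leadN: "lead (word t) x = 0" if "x \<in> ?N" for x
        using that unfolding lyndon_span_def
      proof (induction rule: generate.induct)
        have *: "lead (word t) h = 0 \<and> h \<in> lcs_aux ?F k" if h: "h \<in> lcs_aux ?F (Suc k) \<union> letter_eval n ` T'" for h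
        proof -
          have "h \<in> ?N" using h unfolding lyndon_span_def by (rule generate.incl)
          moreover have "lead (word t) h = 0"
          proof (cases "h \<in> lcs_aux ?F (Suc k)")
            case True then show ?thesis using lead_lcs_Suc t'(3) by blast
          next
            case False
            then obtain s where s: "s \<in> T'" "h = letter_eval n s" using h by blast
            then have s': "lyndon s" "set (word s) \<subseteq> {..<n}" "length (word s) = Suc k"
              using T' by (auto simp: lyndon_trees_def)
            have "word t \<noteq> word s" using lyndon_word_inj[OF t'(1) s'(1)] s by (auto simp: T'_def)
            then have "word t < word s" using t(2)[of s] s(1) by (simp add: T'_def)
            then show ?thesis using lead_lyndon(1)[OF s'(1,2), of "word t"] s t' s' by simp
          qed
          ultimately show ?thesis using N(2) by blast
        qed
        case one show ?case by (simp add: lead_def free_grp_simps)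
        {
          case (incl h) then show ?case using * by blast
        next
          case (inv h) then show ?case using lead_inv[OF _ t'(3)] * by fastforce
        next
          case (eng h1 h2)
          then have "h1 \<in> lcs_aux ?F k" "h2 \<in> lcs_aux ?F k" using N(2) unfolding lyndon_span_def by blast+
          then show ?case using lead_mult[OF _ _ t'(3)] eng by fastforce
        }
      qed
      have yl: "y \<in> lcs_aux ?F k" using y N(2) by blast
      have "?t [^]\<^bsub>?F\<^esub> c \<in> lcs_aux ?F k" by (rule subgroup_int_pow_closed[OF lcs_subgroup tl])
      then have "lead (word t) r = c * lead (word t) ?t + lead (word t) y"
        unfolding y(2) using lead_mult[OF _ yl t'(3)] lead_int_pow[OF tl t'(3)] by simp
      then have "c = 0" using z[OF t'(3)] leadN[OF y(1)] lead_lyndon(2)[OF t'(1,2) refl] by simp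
      then have "r \<in> ?N" using y Nc by simp
      then show ?thesis using less.hyps[OF T'(3,2,1)] by blast
    qed
  qed
  ultimately show False using r(2) finite_lyndon_trees by blast
qed

lemma separating_hom:
  assumes "r \<in> lcs_aux (free_grp n) k" "r \<notin> lcs_aux (free_grp n) (Suc k)"
  obtains h :: "(nat \<times> bool) list \<Rightarrow> real" where "h \<in> H1_inv (free_grp n) (lcs_aux (free_grp n) k)" "h r = 1"
proof -
  let ?F = "free_grp n" and ?L = "lcs_aux (free_grp n) k"
  obtain w where w: "length w = Suc k" "lead w r \<noteq> 0" using lead_detects[OF assms] by blast
  define h where "h x = (if x \<in> ?L then real_of_int (lead w x) / real_of_int (lead w r) else 0)" for x
  have L: "?L \<lhd> ?F" by (rule group.lcs_normal[OF free_grp_group])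
  have "h \<in> H1_inv ?F ?L"
    unfolding H1_inv_def
    using lead_mult[OF _ _ w(1)] lead_conj[OF _ _ w(1)] group.normal_mult_mem[OF free_grp_group L]
      group.conj_mem[OF free_grp_group L]
    by (auto simp: h_def add_divide_distrib)
  moreover have "h r = 1" using w assms by (simp add: h_def)
  ultimately show ?thesis by (rule that)
qed

section \<open>Hahn-Banach\<close>

definition fun_subspace :: "('a \<Rightarrow> real) set \<Rightarrow> bool" where
  "fun_subspace V \<longleftrightarrow> (\<lambda>_. 0) \<in> V \<and> (\<forall>f\<in>V. \<forall>g\<in>V. (\<lambda>x. f x + g x) \<in> V) \<and>
     (\<forall>c. \<forall>f\<in>V. (\<lambda>x. c * f x) \<in> V)"

definition sublinear_on :: "('a \<Rightarrow> real) set \<Rightarrow> (('a \<Rightarrow> real) \<Rightarrow> real) \<Rightarrow> bool" where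
  "sublinear_on V p \<longleftrightarrow> (\<forall>f\<in>V. \<forall>g\<in>V. p (\<lambda>x. f x + g x) \<le> p f + p g) \<and>
     (\<forall>c\<ge>0. \<forall>f\<in>V. p (\<lambda>x. c * f x) = c * p f)"

definition linear_on :: "('a \<Rightarrow> real) set \<Rightarrow> (('a \<Rightarrow> real) \<Rightarrow> real) \<Rightarrow> bool" where
  "linear_on V m \<longleftrightarrow> (\<forall>f\<in>V. \<forall>g\<in>V. m (\<lambda>x. f x + g x) = m f + m g) \<and>
     (\<forall>c. \<forall>f\<in>V. m (\<lambda>x. c * f x) = c * m f)"

lemma fun_subspaceD:
  assumes "fun_subspace V"
  shows "(\<lambda>_. 0) \<in> V" "f \<in> V \<Longrightarrow> g \<in> V \<Longrightarrow> (\<lambda>x. f x + g x) \<in> V"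
    "f \<in> V \<Longrightarrow> (\<lambda>x. c * f x) \<in> V" "f \<in> V \<Longrightarrow> (\<lambda>x. - f x) \<in> V"
    "f \<in> V \<Longrightarrow> g \<in> V \<Longrightarrow> (\<lambda>x. f x - g x) \<in> V"
proof -
  show 1: "(\<lambda>_. 0) \<in> V" "f \<in> V \<Longrightarrow> g \<in> V \<Longrightarrow> (\<lambda>x. f x + g x) \<in> V"
    "f \<in> V \<Longrightarrow> (\<lambda>x. c * f x) \<in> V" for f g c
    using assms by (auto simp: fun_subspace_def)
  show 2: "f \<in> V \<Longrightarrow> (\<lambda>x. - f x) \<in> V" for f using 1(3)[of f "-1"] by simp
  show "f \<in> V \<Longrightarrow> g \<in> V \<Longrightarrow> (\<lambda>x. f x - g x) \<in> V" using 1(2)[OF _ 2] by fastforce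
qed

lemma sublinear_onD:
  assumes "sublinear_on V p"
  shows "f \<in> V \<Longrightarrow> g \<in> V \<Longrightarrow> p (\<lambda>x. f x + g x) \<le> p f + p g"
    "c \<ge> 0 \<Longrightarrow> f \<in> V \<Longrightarrow> p (\<lambda>x. c * f x) = c * p f"
    "f \<in> V \<Longrightarrow> p (\<lambda>_. 0) = 0"
  using assms by (auto simp: sublinear_on_def dest!: spec[of _ "0::real"])

lemma sublinear_lower:
  assumes V: "fun_subspace V" and p: "sublinear_on V p" and f: "f \<in> V" and g: "g \<in> V"
  shows "p g - p (\<lambda>x. - f x) \<le> p (\<lambda>x. f x + g x)"
proof -
  have "p (\<lambda>x. (f x + g x) + (- f x)) \<le> p (\<lambda>x. f x + g x) + p (\<lambda>x. - f x)"
    by (rule sublinear_onD(1)[OF p fun_subspaceD(2)[OF V f g] fun_subspaceD(4)[OF V f]])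
  then show ?thesis by simp
qed

lemma linear_onD:
  assumes "linear_on V m"
  shows "f \<in> V \<Longrightarrow> g \<in> V \<Longrightarrow> m (\<lambda>x. f x + g x) = m f + m g"
    "f \<in> V \<Longrightarrow> m (\<lambda>x. c * f x) = c * m f" "f \<in> V \<Longrightarrow> m (\<lambda>x. - f x) = - m f"
proof -
  show 1: "f \<in> V \<Longrightarrow> g \<in> V \<Longrightarrow> m (\<lambda>x. f x + g x) = m f + m g"
    "f \<in> V \<Longrightarrow> m (\<lambda>x. c * f x) = c * m f" for f g c
    using assms by (auto simp: linear_on_def)
  show "f \<in> V \<Longrightarrow> m (\<lambda>x. - f x) = - m f" using 1(2)[of f "-1"] by simp
qed

lemma linear_on_diff:
  assumes "fun_subspace V" "linear_on V m" "f \<in> V" "g \<in> V"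
  shows "m (\<lambda>x. f x - g x) = m f - m g"
  using linear_onD(1)[OF assms(2,3) fun_subspaceD(4)[OF assms(1,4)]] linear_onD(3)[OF assms(2,4)] by simp

text \<open>Common core of three constructions: slopes, lower bounds of chains in Zorn's lemma, and
  quotient functionals. Conditions \<open>add\<close> and \<open>hom\<close> say that the infimum
  may be estimated by a suitable new index.\<close>

lemma sublinear_on_INF:
  fixes \<phi> :: "'i \<Rightarrow> ('a \<Rightarrow> real) \<Rightarrow> real"
  assumes V: "fun_subspace V" and I: "I \<noteq> {}"
    and bdd: "\<And>f. f \<in> V \<Longrightarrow> bdd_below ((\<lambda>i. \<phi> i f) ` I)"
    and add: "\<And>f g i j. f \<in> V \<Longrightarrow> g \<in> V \<Longrightarrow> i \<in> I \<Longrightarrow> j \<in> I \<Longrightarrow>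
      \<exists>k\<in>I. \<phi> k (\<lambda>x. f x + g x) \<le> \<phi> i f + \<phi> j g"
    and hom: "\<And>f i c. f \<in> V \<Longrightarrow> i \<in> I \<Longrightarrow> 0 < c \<Longrightarrow> \<exists>k\<in>I. \<phi> k (\<lambda>x. c * f x) \<le> c * \<phi> i f"
  shows "sublinear_on V (\<lambda>f. INF i\<in>I. \<phi> i f)"
proof -
  let ?u = "\<lambda>f. INF i\<in>I. \<phi> i f"
  have add': "?u (\<lambda>x. f x + g x) \<le> ?u f + ?u g" if f: "f \<in> V" and g: "g \<in> V" for f g
  proof -
    have a: "?u (\<lambda>x. f x + g x) \<le> \<phi> i f + \<phi> j g" if i: "i \<in> I" and j: "j \<in> I" for i j
    proof -
      obtain k where k: "k \<in> I" "\<phi> k (\<lambda>x. f x + g x) \<le> \<phi> i f + \<phi> j g" using add[OF f g i j] by blast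
      then show ?thesis using cINF_lower2[OF bdd[OF fun_subspaceD(2)[OF V f g]] k] by simp
    qed
    have b: "?u (\<lambda>x. f x + g x) - \<phi> i f \<le> ?u g" if "i \<in> I" for i
    proof (rule cINF_greatest[OF I])
      fix j assume "j \<in> I"
      from a[OF that this] show "?u (\<lambda>x. f x + g x) - \<phi> i f \<le> \<phi> j g" by linarith
    qed
    have "?u (\<lambda>x. f x + g x) - ?u g \<le> \<phi> i f" if "i \<in> I" for i
      using b[OF that] by linarith
    then have "?u (\<lambda>x. f x + g x) - ?u g \<le> ?u f" by (rule cINF_greatest[OF I])
    then show ?thesis by simp
  qed
  have le: "?u (\<lambda>x. c * f x) \<le> c * ?u f" if f: "f \<in> V" and c: "0 < c" for f c
  proof -
    have "?u (\<lambda>x. c * f x) / c \<le> \<phi> i f" if i: "i \<in> I" for i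
    proof -
      obtain k where k: "k \<in> I" "\<phi> k (\<lambda>x. c * f x) \<le> c * \<phi> i f" using hom[OF f i c] by blast
      have "?u (\<lambda>x. c * f x) \<le> c * \<phi> i f" using cINF_lower2[OF bdd[OF fun_subspaceD(3)[OF V f]] k] .
      then show ?thesis using c by (simp add: field_simps)
    qed
    then have "?u (\<lambda>x. c * f x) / c \<le> ?u f" by (rule cINF_greatest[OF I])
    then show ?thesis using c by (simp add: field_simps)
  qed
  \<comment> \<open>Only one inequality is assumed for scaling; the other is the same inequality for
    the factor \<open>1/c\<close>.\<close>
  have eq: "?u (\<lambda>x. c * f x) = c * ?u f" if f: "f \<in> V" and c: "0 < c" for f c
  proof (rule antisym[OF le[OF f c]])
    have "?u (\<lambda>x. (1/c) * (c * f x)) \<le> (1/c) * ?u (\<lambda>x. c * f x)"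
      by (rule le[OF fun_subspaceD(3)[OF V f]]) (use c in simp)
    moreover have "(1/c) * (c * f x) = f x" for x using c by simp
    ultimately have "?u f \<le> (1/c) * ?u (\<lambda>x. c * f x)" by (simp only:)
    then show "c * ?u f \<le> ?u (\<lambda>x. c * f x)" using c by (simp add: field_simps)
  qed
  have "?u (\<lambda>_. 0) = 0" using eq[OF fun_subspaceD(1)[OF V], of 2] by simp
  then have "?u (\<lambda>x. c * f x) = c * ?u f" if "f \<in> V" "c \<ge> 0" for f c
    using eq[OF that(1), of c] that(2) by (cases "c = 0") auto
  then show ?thesis using add' by (simp add: sublinear_on_def)
qed

text \<open>The expression under the infimum does not increase with \<open>t\<close>, so
  \<open>q\<close> is the slope of \<open>p\<close> in direction \<open>z\<close>. At
  \<open>t = 1\<close> it gives \<open>q (- z) \<le> - p z\<close>, which prescribes the value at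
  \<open>z\<close>, and \<open>q f \<le> p (f + z) - p z\<close>, which makes minimal functionals
  additive.\<close>

lemma sublinear_slope:
  assumes V: "fun_subspace V" and p: "sublinear_on V p" and z: "z \<in> V"
  defines "q \<equiv> \<lambda>f. INF t\<in>{0..}. p (\<lambda>x. f x + t * z x) - t * p z"
  shows "sublinear_on V q" "f \<in> V \<Longrightarrow> 0 \<le> t \<Longrightarrow> q f \<le> p (\<lambda>x. f x + t * z x) - t * p z"
proof -
  note tz = fun_subspaceD(3)[OF V z]
  have bdd: "bdd_below ((\<lambda>t. p (\<lambda>x. f x + t * z x) - t * p z) ` {0..})" if f: "f \<in> V" for f
  proof (rule bdd_belowI2)
    fix t :: real assume "t \<in> {0..}"
    then have "p (\<lambda>x. t * z x) = t * p z" using sublinear_onD(2)[OF p _ z] by simp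
    then show "- p (\<lambda>x. - f x) \<le> p (\<lambda>x. f x + t * z x) - t * p z"
      using sublinear_lower[OF V p f tz, of t] by simp
  qed
  show "f \<in> V \<Longrightarrow> 0 \<le> t \<Longrightarrow> q f \<le> p (\<lambda>x. f x + t * z x) - t * p z"
    unfolding q_def by (rule cINF_lower[OF bdd]) auto
  show "sublinear_on V q" unfolding q_def
  proof (rule sublinear_on_INF[OF V _ bdd])
    fix f g and s t :: real
    assume f: "f \<in> V" and g: "g \<in> V" and st: "s \<in> {0..}" "t \<in> {0..}"
    have "p (\<lambda>x. (f x + s * z x) + (g x + t * z x)) \<le> p (\<lambda>x. f x + s * z x) + p (\<lambda>x. g x + t * z x)"
      by (rule sublinear_onD(1)[OF p fun_subspaceD(2)[OF V f tz] fun_subspaceD(2)[OF V g tz]])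
    then show "\<exists>k\<in>{0..}. p (\<lambda>x. f x + g x + k * z x) - k * p z \<le>
        p (\<lambda>x. f x + s * z x) - s * p z + (p (\<lambda>x. g x + t * z x) - t * p z)"
      using st by (intro bexI[of _ "s + t"]) (auto simp: algebra_simps)
  next
    fix f and t c :: real assume f: "f \<in> V" and t: "t \<in> {0..}" and c: "0 < c"
    have "p (\<lambda>x. c * (f x + t * z x)) = c * p (\<lambda>x. f x + t * z x)"
      using sublinear_onD(2)[OF p _ fun_subspaceD(2)[OF V f tz]] c by simp
    then show "\<exists>k\<in>{0..}. p (\<lambda>x. c * f x + k * z x) - k * p z \<le> c * (p (\<lambda>x. f x + t * z x) - t * p z)"
      using t c by (intro bexI[of _ "c * t"]) (auto simp: algebra_simps)
  qed auto
qed

text \<open>A pointwise minimal sublinear functional is linear, since otherwise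
  \<open>sublinear_slope\<close> would lower it.\<close>
lemma hahn_banach:
  assumes V: "fun_subspace V" and p: "sublinear_on V p" and z: "z \<in> V"
  shows "\<exists>m. linear_on V m \<and> (\<forall>f\<in>V. m f \<le> p f) \<and> m z = p z"
proof -
  \<comment> \<open>Passing to \<open>p'\<close> first costs nothing below \<open>p\<close> and
    forces every linear functional below it to attain \<open>p z\<close> at
    \<open>z\<close>.\<close>
  define p' where "p' f = (INF t\<in>{0..}. p (\<lambda>x. f x + t * z x) - t * p z)" for f
  have p': "sublinear_on V p'" "\<And>f t. f \<in> V \<Longrightarrow> 0 \<le> t \<Longrightarrow> p' f \<le> p (\<lambda>x. f x + t * z x) - t * p z"
    unfolding p'_def using sublinear_slope[OF V p z] by simp_all
  have p'p: "p' f \<le> p f" if "f \<in> V" for f using p'(2)[OF that, of 0] by simp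
  \<comment> \<open>Off \<open>V\<close> the functionals are pinned to 0: nothing there would bound
    them below, and no minimal element could exist. The relation \<open>P\<close> is reversed
    because Zorn's lemma delivers maximal elements.\<close>
  define Q where "Q = {q. sublinear_on V q \<and> (\<forall>f\<in>V. q f \<le> p' f) \<and> (\<forall>f. f \<notin> V \<longrightarrow> q f = 0)}"
  define P where "P q q' \<longleftrightarrow> (\<forall>f. q' f \<le> (q f :: real))" for q q' :: "('a \<Rightarrow> real) \<Rightarrow> real"
  have restr: "(\<lambda>f. if f \<in> V then q f else 0) \<in> Q" if "sublinear_on V q" "\<And>f. f \<in> V \<Longrightarrow> q f \<le> p' f" for q
    using that fun_subspaceD[OF V] by (auto simp: Q_def sublinear_on_def)
  have low: "- p' (\<lambda>x. - f x) \<le> q f" if "q \<in> Q" "f \<in> V" for q f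
  proof -
    have q: "sublinear_on V q" "q (\<lambda>x. - f x) \<le> p' (\<lambda>x. - f x)"
      using that fun_subspaceD(4)[OF V] by (auto simp: Q_def)
    have "q (\<lambda>x. f x + - f x) \<le> q f + q (\<lambda>x. - f x)"
      by (rule sublinear_onD(1)[OF q(1) that(2) fun_subspaceD(4)[OF V that(2)]])
    then show ?thesis using q sublinear_onD(3)[OF q(1) that(2)] by simp
  qed
  have "\<exists>m\<in>Q. \<forall>a\<in>Q. P m a \<longrightarrow> a = m"
  proof (rule predicate_Zorn)
    show "partial_order_on Q (relation_of P Q)"
      by (rule partial_order_on_relation_ofI) (auto simp: P_def intro!: ext antisym intro: order_trans)
    fix C assume C: "C \<in> Chains (relation_of P Q)"
    have CQ: "C \<subseteq> Q" using C by (auto simp: Chains_def relation_of_def)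
    show "\<exists>u\<in>Q. \<forall>a\<in>C. P a u"
    proof (cases "C = {}")
      case True then show ?thesis using restr[OF p'(1)] by auto
    next
      case False
      let ?u = "\<lambda>f. INF q\<in>C. q f"
      have bdd: "bdd_below ((\<lambda>q. q f) ` C)" if "f \<in> V" for f
        using low[OF _ that] CQ by (intro bdd_belowI2[of _ "- p' (\<lambda>x. - f x)"]) blast
      have "sublinear_on V ?u"
      proof (rule sublinear_on_INF[OF V False bdd])
        fix f g q1 q2 assume f: "f \<in> V" and g: "g \<in> V" and q: "q1 \<in> C" "q2 \<in> C"
        have "P q1 q2 \<or> P q2 q1" using C q by (auto simp: Chains_def relation_of_def)
        then show "\<exists>k\<in>C. k (\<lambda>x. f x + g x) \<le> q1 f + q2 g"
        proof
          assume "P q1 q2"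
          then have "q2 f \<le> q1 f" by (simp add: P_def)
          moreover have "q2 (\<lambda>x. f x + g x) \<le> q2 f + q2 g"
            using sublinear_onD(1)[of V q2 f g] f g q CQ by (auto simp: Q_def)
          ultimately show ?thesis using q by (intro bexI[of _ q2]) auto
        next
          assume "P q2 q1"
          then have "q1 g \<le> q2 g" by (simp add: P_def)
          moreover have "q1 (\<lambda>x. f x + g x) \<le> q1 f + q1 g"
            using sublinear_onD(1)[of V q1 f g] f g q CQ by (auto simp: Q_def)
          ultimately show ?thesis using q by (intro bexI[of _ q1]) auto
        qed
      next
        fix f q and c :: real assume "f \<in> V" "q \<in> C" "0 < c"
        then show "\<exists>k\<in>C. k (\<lambda>x. c * f x) \<le> c * q f"
          using sublinear_onD(2)[of V q c f] CQ by (intro bexI[of _ q]) (auto simp: Q_def)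
      qed
      moreover have "?u f \<le> p' f" if f: "f \<in> V" for f
      proof -
        obtain q where q: "q \<in> C" using False by blast
        have "q f \<le> p' f" using q CQ f by (auto simp: Q_def)
        then show ?thesis using cINF_lower2[OF bdd[OF f] q] by blast
      qed
      ultimately have "(\<lambda>f. if f \<in> V then ?u f else 0) \<in> Q" by (rule restr)
      moreover have "P a (\<lambda>f. if f \<in> V then ?u f else 0)" if a: "a \<in> C" for a
        using cINF_lower[OF bdd a] a CQ by (auto simp: P_def Q_def)
      ultimately show ?thesis by blast
    qed
  qed
  then obtain m where m: "m \<in> Q" "\<And>a. a \<in> Q \<Longrightarrow> P m a \<Longrightarrow> a = m" by blast
  have ms: "sublinear_on V m" and mp: "\<And>f. f \<in> V \<Longrightarrow> m f \<le> p' f" using m(1) by (auto simp: Q_def)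
  \<comment> \<open>The slope of \<open>m\<close> in direction \<open>g\<close> is again in
    \<open>Q\<close> and lies below \<open>m\<close>, hence equals it; evaluating at
    \<open>t = 1\<close> gives superadditivity.\<close>
  have super: "m f + m g \<le> m (\<lambda>x. f x + g x)" if f: "f \<in> V" and g: "g \<in> V" for f g
  proof -
    define q where "q f = (INF t\<in>{0..}. m (\<lambda>x. f x + t * g x) - t * m g)" for f
    have q: "sublinear_on V q" "\<And>f t. f \<in> V \<Longrightarrow> 0 \<le> t \<Longrightarrow> q f \<le> m (\<lambda>x. f x + t * g x) - t * m g"
      unfolding q_def using sublinear_slope[OF V ms g] by simp_all
    have qm: "q f \<le> m f" if "f \<in> V" for f using q(2)[OF that, of 0] by simp
    have "(\<lambda>f. if f \<in> V then q f else 0) \<in> Q"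
      by (rule restr[OF q(1) order_trans[OF qm mp]])
    moreover have "P m (\<lambda>f. if f \<in> V then q f else 0)" using qm m(1) by (auto simp: P_def Q_def)
    ultimately have "(\<lambda>f. if f \<in> V then q f else 0) = m" by (rule m(2))
    from fun_cong[OF this, of f] have "m f = q f" using f by simp
    also have "\<dots> \<le> m (\<lambda>x. f x + g x) - m g" using q(2)[OF f, of 1] by simp
    finally show ?thesis by simp
  qed
  have add: "m (\<lambda>x. f x + g x) = m f + m g" if "f \<in> V" "g \<in> V" for f g
    using super[OF that] sublinear_onD(1)[OF ms that] by simp
  have neg: "m (\<lambda>x. - f x) = - m f" if "f \<in> V" for f
    using add[OF that fun_subspaceD(4)[OF V that]] sublinear_onD(3)[OF ms that] by simp
  have "m (\<lambda>x. c * f x) = c * m f" if f: "f \<in> V" for f c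
  proof (cases "c \<ge> 0")
    case True then show ?thesis using sublinear_onD(2)[OF ms _ f] by simp
  next
    case False
    then have "m (\<lambda>x. (- c) * f x) = (- c) * m f" by (intro sublinear_onD(2)[OF ms _ f]) simp
    then show ?thesis using neg[OF fun_subspaceD(3)[OF V f, of "-c"]] by simp
  qed
  then have lin: "linear_on V m" using add by (simp add: linear_on_def)
  have "m (\<lambda>x. - z x) \<le> p' (\<lambda>x. - z x)" by (rule mp[OF fun_subspaceD(4)[OF V z]])
  also have "\<dots> \<le> - p z"
    using p'(2)[OF fun_subspaceD(4)[OF V z], of 1] sublinear_onD(3)[OF p z] by simp
  finally have "p z \<le> m z" using neg[OF z] by simp
  moreover have "m f \<le> p f" if "f \<in> V" for f using mp[OF that] p'p[OF that] by simp
  ultimately show ?thesis using lin z by (intro exI[of _ m]) (auto intro: antisym)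
qed

text \<open>Apply \<open>hahn_banach\<close> to the infimum of \<open>p\<close> over cosets of
  \<open>W\<close>. Nonnegativity of \<open>p\<close> on \<open>W\<close> keeps that infimum finite,
  and it is at most 0 on the subspace \<open>W\<close>, so the functional vanishes there. Used with
  \<open>W\<close> spanned by translation differences and with \<open>W\<close> the
  boundaries.\<close>

lemma hahn_banach_quotient:
  assumes V: "fun_subspace V" and p: "sublinear_on V p" and W: "fun_subspace W" "W \<subseteq> V"
    and pos: "\<And>w. w \<in> W \<Longrightarrow> 0 \<le> p w" and z: "z \<in> V"
  shows "\<exists>m. linear_on V m \<and> (\<forall>f\<in>V. m f \<le> p f) \<and> (\<forall>w\<in>W. m w = 0) \<and>
    m z = (INF w\<in>W. p (\<lambda>x. z x + w x))"
proof -
  define q where "q f = (INF w\<in>W. p (\<lambda>x. f x + w x))" for f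
  have bdd: "bdd_below ((\<lambda>w. p (\<lambda>x. f x + w x)) ` W)" if f: "f \<in> V" for f
  proof (rule bdd_belowI2)
    fix w assume w: "w \<in> W"
    then show "- p (\<lambda>x. - f x) \<le> p (\<lambda>x. f x + w x)"
      using sublinear_lower[OF V p f, of w] pos[OF w] W by auto
  qed
  have le: "q f \<le> p (\<lambda>x. f x + w x)" if "f \<in> V" "w \<in> W" for f w
    unfolding q_def by (rule cINF_lower[OF bdd[OF that(1)] that(2)])
  have "sublinear_on V q" unfolding q_def
  proof (rule sublinear_on_INF[OF V _ bdd])
    show "W \<noteq> {}" using fun_subspaceD(1)[OF W(1)] by blast
    fix f g v w assume f: "f \<in> V" "g \<in> V" and w: "v \<in> W" "w \<in> W"
    have "p (\<lambda>x. (f x + v x) + (g x + w x)) \<le> p (\<lambda>x. f x + v x) + p (\<lambda>x. g x + w x)"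
      using f w W by (intro sublinear_onD(1)[OF p] fun_subspaceD(2)[OF V]) auto
    then show "\<exists>k\<in>W. p (\<lambda>x. f x + g x + k x) \<le> p (\<lambda>x. f x + v x) + p (\<lambda>x. g x + w x)"
      using fun_subspaceD(2)[OF W(1) w] by (intro bexI[of _ "\<lambda>x. v x + w x"]) (simp_all add: algebra_simps)
  next
    fix f w and c :: real assume f: "f \<in> V" and w: "w \<in> W" and c: "0 < c"
    have "p (\<lambda>x. c * (f x + w x)) = c * p (\<lambda>x. f x + w x)"
      using f w W c by (intro sublinear_onD(2)[OF p] fun_subspaceD(2)[OF V]) auto
    then show "\<exists>k\<in>W. p (\<lambda>x. c * f x + k x) \<le> c * p (\<lambda>x. f x + w x)"
      using fun_subspaceD(3)[OF W(1) w, of c] by (intro bexI[of _ "\<lambda>x. c * w x"]) (simp_all add: algebra_simps)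
  qed auto
  from hahn_banach[OF V this z] obtain m where
    m: "linear_on V m" "\<And>f. f \<in> V \<Longrightarrow> m f \<le> q f" "m z = q z" by blast
  have mp: "m f \<le> p f" if "f \<in> V" for f
    using m(2)[OF that] le[OF that fun_subspaceD(1)[OF W(1)]] by simp
  have m0: "m w \<le> 0" if w: "w \<in> W" for w
    using m(2)[of w] le[of w "\<lambda>x. - w x"] fun_subspaceD(4)[OF W(1) w] W(2) w sublinear_onD(3)[OF p z] by fastforce
  have "m w = 0" if w: "w \<in> W" for w
    using m0[OF w] m0[OF fun_subspaceD(4)[OF W(1) w]] linear_onD(3)[OF m(1), of w] W(2) w by fastforce
  then show ?thesis using m mp unfolding q_def by blast
qed

section \<open>Invariant means on nilpotent quotients\<close>

text \<open>Bounded functions on G/N without the quotient type. Values off the carrier are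
  unrestricted, hence the need for \<open>mean_cong\<close>.\<close>

definition bounded_cls :: "('a, 'b) monoid_scheme \<Rightarrow> 'a set \<Rightarrow> ('a \<Rightarrow> real) set" where
  "bounded_cls G N = {f. (\<exists>B. \<forall>x\<in>carrier G. \<bar>f x\<bar> \<le> B) \<and>
     (\<forall>x\<in>carrier G. \<forall>y\<in>N. f (x \<otimes>\<^bsub>G\<^esub> y) = f x)}"

text \<open>The upper bound encodes normalization as well as positivity: apply it to the constants c
  and -c, and to -f.\<close>

definition inv_mean :: "('a, 'b) monoid_scheme \<Rightarrow> 'a set \<Rightarrow> (('a \<Rightarrow> real) \<Rightarrow> real) \<Rightarrow> bool" where
  "inv_mean G N M \<longleftrightarrow> linear_on (bounded_cls G N) M \<and>
     (\<forall>f\<in>bounded_cls G N. \<forall>B. (\<forall>x\<in>carrier G. f x \<le> B) \<longrightarrow> M f \<le> B) \<and>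
     (\<forall>g\<in>carrier G. \<forall>f\<in>bounded_cls G N. M (\<lambda>x. f (g \<otimes>\<^bsub>G\<^esub> x)) = M f)"

lemma bounded_cls_subspace: "fun_subspace (bounded_cls G N)"
  unfolding fun_subspace_def
proof (intro conjI ballI allI)
  show "(\<lambda>_. 0) \<in> bounded_cls G N" by (auto simp: bounded_cls_def)
next
  fix f g assume f: "f \<in> bounded_cls G N" and g: "g \<in> bounded_cls G N"
  obtain B C where "\<forall>x\<in>carrier G. \<bar>f x\<bar> \<le> B" "\<forall>x\<in>carrier G. \<bar>g x\<bar> \<le> C"
    using f g by (auto simp: bounded_cls_def)
  then have "\<forall>x\<in>carrier G. \<bar>f x + g x\<bar> \<le> B + C" by (meson abs_triangle_ineq add_mono order_trans)
  then show "(\<lambda>x. f x + g x) \<in> bounded_cls G N" using f g by (auto simp: bounded_cls_def simp del: abs_le_iff)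
next
  fix c f assume f: "f \<in> bounded_cls G N"
  obtain B where "\<forall>x\<in>carrier G. \<bar>f x\<bar> \<le> B" using f by (auto simp: bounded_cls_def)
  then have "\<forall>x\<in>carrier G. \<bar>c * f x\<bar> \<le> \<bar>c\<bar> * B" by (simp add: abs_mult mult_left_mono)
  then show "(\<lambda>x. c * f x) \<in> bounded_cls G N" using f by (auto simp: bounded_cls_def)
qed

lemma bounded_cls_const: "(\<lambda>_. c) \<in> bounded_cls G N"
  by (auto simp: bounded_cls_def)

lemma mean_cong:
  assumes m: "linear_on (bounded_cls G N) m"
    and le: "\<And>f B. f \<in> bounded_cls G N \<Longrightarrow> \<forall>x\<in>carrier G. f x \<le> B \<Longrightarrow> m f \<le> B"
    and f: "f \<in> bounded_cls G N" and g: "g \<in> bounded_cls G N" and eq: "\<And>x. x \<in> carrier G \<Longrightarrow> f x = g x"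
  shows "m f = m g"
proof -
  note S = bounded_cls_subspace[of G N]
  have "m (\<lambda>x. f x - g x) \<le> 0" "m (\<lambda>x. g x - f x) \<le> 0"
    using eq by (auto intro!: le fun_subspaceD(5)[OF S] f g)
  then show ?thesis using linear_on_diff[OF S m f g] linear_on_diff[OF S m g f] by simp
qed

lemma mean_const:
  assumes m: "linear_on (bounded_cls G N) m"
    and le: "\<And>f B. f \<in> bounded_cls G N \<Longrightarrow> \<forall>x\<in>carrier G. f x \<le> B \<Longrightarrow> m f \<le> B"
  shows "m (\<lambda>_. c) = c"
proof -
  have "m (\<lambda>_. c) \<le> c" "m (\<lambda>_. - c) \<le> - c" by (auto intro!: le bounded_cls_const)
  then show ?thesis using linear_onD(3)[OF m bounded_cls_const, of c] by simp
qed

lemma (in group) bounded_cls_translate: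
  assumes f: "f \<in> bounded_cls G N" and N: "N \<subseteq> carrier G" and g: "g \<in> carrier G"
  shows "(\<lambda>x. f (g \<otimes> x)) \<in> bounded_cls G N"
proof -
  obtain B where "\<forall>x\<in>carrier G. \<bar>f x\<bar> \<le> B" using f by (auto simp: bounded_cls_def)
  then have "\<forall>x\<in>carrier G. \<bar>f (g \<otimes> x)\<bar> \<le> B" using g by blast
  moreover have "f (g \<otimes> (x \<otimes> y)) = f (g \<otimes> x)" if "x \<in> carrier G" "y \<in> N" for x y
  proof -
    have "g \<otimes> (x \<otimes> y) = (g \<otimes> x) \<otimes> y" using that g N by (simp add: m_assoc subset_iff)
    then show ?thesis using f g that by (simp add: bounded_cls_def)
  qed
  ultimately show ?thesis by (auto simp: bounded_cls_def)
qed

context group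
begin

text \<open>The element \<open>a\<close> is central modulo \<open>lcs_aux G (Suc k)\<close>, and
  \<open>f\<close> does not see that subgroup.\<close>

lemma lcs_translations_commute:
  assumes f: "f \<in> bounded_cls G (lcs_aux G (Suc k))"
    and a: "a \<in> lcs_aux G k" and b: "b \<in> carrier G" and x: "x \<in> carrier G"
  shows "f (a \<otimes> (b \<otimes> x)) = f (b \<otimes> (a \<otimes> x))"
proof -
  have ac: "a \<in> carrier G" using a lcs_carrier by blast
  let ?c = "cmt (inv a) (inv b)"
  have "inv a \<in> lcs_aux G k" using a by (rule subgroup.m_inv_closed[OF lcs_subgroup])
  then have "?c \<in> lcs_aux G (Suc k)" using b by (intro cmt_lcs_Suc') auto
  then have c: "inv x \<otimes> ?c \<otimes> x \<in> lcs_aux G (Suc k)" using x by (intro conj_mem'[OF lcs_normal])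
  have "a \<otimes> (b \<otimes> x) = (b \<otimes> (a \<otimes> x)) \<otimes> (inv x \<otimes> ?c \<otimes> x)"
    using ac b x by (simp add: cmt_def group_word_simps)
  then show ?thesis using f c ac b x by (simp add: bounded_cls_def)
qed

text \<open>The combinations on which an invariant functional must vanish.\<close>

definition diff_sum :: "(('a \<Rightarrow> real) \<times> 'a) list \<Rightarrow> 'a \<Rightarrow> real" where
  "diff_sum ps x = (\<Sum>(f, l)\<leftarrow>ps. f x - f (l \<otimes> x))"

lemma diff_sum_simps:
  "diff_sum [] x = 0" "diff_sum ((f, l) # ps) x = f x - f (l \<otimes> x) + diff_sum ps x"
  "diff_sum (ps @ qs) x = diff_sum ps x + diff_sum qs x"
  by (simp_all add: diff_sum_def)

lemma bounded_cls_average: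
  assumes f: "f \<in> bounded_cls G N" and N: "N \<subseteq> carrier G" and l: "l \<in> carrier G"
  shows "(\<lambda>x. c * (\<Sum>i<(n::nat). f (l [^] i \<otimes> x))) \<in> bounded_cls G N"
proof -
  note S = bounded_cls_subspace[of G N]
  have "(\<lambda>x. \<Sum>i<(n::nat). f (l [^] i \<otimes> x)) \<in> bounded_cls G N"
  proof (induction n)
    case 0 then show ?case using bounded_cls_const[of 0] by simp
  next
    case (Suc n)
    then show ?case
      using fun_subspaceD(2)[OF S Suc bounded_cls_translate[OF f N nat_pow_closed[OF l]]] by simp
  qed
  then show ?thesis by (rule fun_subspaceD(3)[OF S])
qed

text \<open>Averaging over long powers of the translation \<open>l\<close> of one summand makes that summand
  negligible and commutes with the others.\<close>
lemma diff_sum_not_negative: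
  assumes "\<forall>(f, l)\<in>set ps. f \<in> bounded_cls G (lcs_aux G (Suc k)) \<and> l \<in> lcs_aux G k" "0 < \<epsilon>"
  shows "\<exists>x\<in>carrier G. - \<epsilon> < diff_sum ps x"
  using assms
proof (induction "length ps" arbitrary: ps \<epsilon>)
  case 0 then show ?case by (auto simp: diff_sum_simps intro!: bexI[of _ \<one>])
next
  case (Suc d)
  let ?N = "lcs_aux G (Suc k)"
  have N: "?N \<subseteq> carrier G" using lcs_carrier by blast
  obtain f l ps' where p: "ps = (f, l) # ps'" using Suc.hyps(2) by (cases ps) auto
  then have f: "f \<in> bounded_cls G ?N" and l: "l \<in> lcs_aux G k" using Suc.prems by auto
  have lc: "l \<in> carrier G" using l lcs_carrier by blast
  obtain B where B: "\<And>x. x \<in> carrier G \<Longrightarrow> \<bar>f x\<bar> \<le> B" using f by (auto simp: bounded_cls_def)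
  \<comment> \<open>The average of the \<open>l\<close>-summand telescopes to one difference divided
    by \<open>n\<close>, of size at most 2B/n. Half of \<epsilon> pays for it, the other half is
    left for the remaining summands.\<close>
  obtain n :: nat where n: "max 0 (4 * B / \<epsilon>) < real n"
    using reals_Archimedean2 by blast
  then have n0: "0 < n" and nB: "2 * B / real n < \<epsilon> / 2" using Suc.prems(2) by (auto simp: field_simps)
  define av where "av g x = (1 / real n) * (\<Sum>i<n. g (l [^] i \<otimes> x))" for g :: "'a \<Rightarrow> real" and x
  have avc: "av g \<in> bounded_cls G ?N" if "g \<in> bounded_cls G ?N" for g
    unfolding av_def by (rule bounded_cls_average[OF that N lc])
  have av_diff: "diff_sum (map (\<lambda>(g, m). (av g, m)) qs) x = (1 / real n) * (\<Sum>i<n. diff_sum qs (l [^] i \<otimes> x))"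
    if "\<forall>(g, m)\<in>set qs. g \<in> bounded_cls G ?N \<and> m \<in> lcs_aux G k" and x: "x \<in> carrier G" for qs x
    using that(1)
  proof (induction qs)
    case (Cons q qs)
    obtain g m where q: "q = (g, m)" by (cases q)
    then have g: "g \<in> bounded_cls G ?N" and m: "m \<in> lcs_aux G k" using Cons.prems by auto
    have "g (l [^] i \<otimes> (m \<otimes> x)) = g (m \<otimes> (l [^] i \<otimes> x))" for i :: nat
      using lcs_translations_commute[OF g m nat_pow_closed[OF lc] x] by simp
    then show ?case using Cons
      by (simp add: q diff_sum_simps av_def sum.distrib sum_subtractf algebra_simps)
  qed (simp add: diff_sum_simps)
  have "\<exists>x\<in>carrier G. - (\<epsilon> / 2) < diff_sum (map (\<lambda>(g, m). (av g, m)) ps') x"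
    using Suc.prems Suc.hyps(2) avc by (intro Suc.hyps(1)) (auto simp: p)
  then obtain x where x: "x \<in> carrier G" "- (\<epsilon> / 2) < (1 / real n) * (\<Sum>i<n. diff_sum ps' (l [^] i \<otimes> x))"
    using av_diff[of ps'] Suc.prems(1) by (auto simp: p)
  have "(\<Sum>i<n. f (l [^] i \<otimes> x) - f (l \<otimes> (l [^] i \<otimes> x))) = f x - f (l [^] n \<otimes> x)"
  proof (induction n)
    case (Suc n)
    have "l \<otimes> (l [^] n \<otimes> x) = l [^] Suc n \<otimes> x"
      using lc x by (simp add: m_assoc[symmetric] nat_pow_Suc2[symmetric] del: nat_pow_Suc)
    then show ?case using Suc by simp
  qed (use x in simp)
  moreover have "- (2 * B) \<le> f x - f (l [^] n \<otimes> x)"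
    using B[OF x(1)] B[OF m_closed[OF nat_pow_closed[OF lc, of n] x(1)]] by linarith
  ultimately have "- (2 * B / real n) \<le> (1 / real n) * (\<Sum>i<n. f (l [^] i \<otimes> x) - f (l \<otimes> (l [^] i \<otimes> x)))"
    using n0 by (simp add: field_simps)
  moreover have "(\<Sum>i<n. diff_sum ps (l [^] i \<otimes> x)) =
      (\<Sum>i<n. f (l [^] i \<otimes> x) - f (l \<otimes> (l [^] i \<otimes> x))) + (\<Sum>i<n. diff_sum ps' (l [^] i \<otimes> x))"
    unfolding p diff_sum_simps by (rule sum.distrib)
  ultimately have sum: "- \<epsilon> < (1 / real n) * (\<Sum>i<n. diff_sum ps (l [^] i \<otimes> x))"
    using x(2) nB by (simp add: distrib_left)
  \<comment> \<open>An average above -\<epsilon> forces one of the averaged values above it.\<close>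
  show ?case
  proof (rule ccontr)
    assume "\<not> (\<exists>x\<in>carrier G. - \<epsilon> < diff_sum ps x)"
    then have "diff_sum ps (l [^] i \<otimes> x) \<le> - \<epsilon>" for i :: nat
      using x(1) lc by (meson m_closed nat_pow_closed not_less)
    then have "(\<Sum>i<n. diff_sum ps (l [^] i \<otimes> x)) \<le> (\<Sum>i<n. - \<epsilon>)" by (intro sum_mono)
    then show False using sum n0 by (simp add: field_simps)
  qed
qed

text \<open>Dixmier's criterion: by \<open>diff_sum_not_negative\<close> the supremum is nonnegative
  on translation differences, so Hahn-Banach yields a functional below the supremum that kills them.
  Invariance is obtained only under the central layer.\<close>

lemma layer_mean:
  obtains m where "linear_on (bounded_cls G (lcs_aux G (Suc k))) m"
    "\<And>f B. f \<in> bounded_cls G (lcs_aux G (Suc k)) \<Longrightarrow> \<forall>x\<in>carrier G. f x \<le> B \<Longrightarrow> m f \<le> B"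
    "\<And>f l. f \<in> bounded_cls G (lcs_aux G (Suc k)) \<Longrightarrow> l \<in> lcs_aux G k \<Longrightarrow> m (\<lambda>x. f (l \<otimes> x)) = m f"
proof -
  let ?V = "bounded_cls G (lcs_aux G (Suc k))"
  note V = bounded_cls_subspace[of G "lcs_aux G (Suc k)"]
  have N: "lcs_aux G (Suc k) \<subseteq> carrier G" using lcs_carrier by blast
  define p where "p f = (SUP x\<in>carrier G. f x)" for f :: "'a \<Rightarrow> real"
  have ne: "carrier G \<noteq> {}" using one_closed by blast
  have bdd: "bdd_above (f ` carrier G)" if "f \<in> ?V" for f
    using that by (fastforce simp: bounded_cls_def bdd_above_def abs_le_iff)
  have ple: "p f \<le> B" if "\<forall>x\<in>carrier G. f x \<le> B" for f B
    unfolding p_def using that by (intro cSUP_least[OF ne]) auto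
  have leP: "f x \<le> p f" if "f \<in> ?V" "x \<in> carrier G" for f x
    unfolding p_def by (rule cSUP_upper[OF that(2) bdd[OF that(1)]])
  have p: "sublinear_on ?V p" unfolding sublinear_on_def
  proof safe
    fix f g assume "f \<in> ?V" "g \<in> ?V"
    then show "p (\<lambda>x. f x + g x) \<le> p f + p g" using leP by (intro ple ballI add_mono) auto
  next
    fix c :: real and f assume c: "0 \<le> c" and f: "f \<in> ?V"
    show "p (\<lambda>x. c * f x) = c * p f"
    proof (cases "c = 0")
      case True then show ?thesis using ne by (simp add: p_def)
    next
      case False
      then have c: "0 < c" using c by simp
      have "p f \<le> (1 / c) * p (\<lambda>x. c * f x)"
        using leP[OF fun_subspaceD(3)[OF V f]] c by (intro ple ballI) (simp add: field_simps)
      then have "c * p f \<le> p (\<lambda>x. c * f x)" using c by (simp add: field_simps)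
      moreover have "p (\<lambda>x. c * f x) \<le> c * p f" using leP[OF f] c by (intro ple) simp
      ultimately show ?thesis by simp
    qed
  qed
  define W where "W = {diff_sum ps | ps. \<forall>(f, l)\<in>set ps. f \<in> ?V \<and> l \<in> lcs_aux G k}"
  have tr: "(\<lambda>x. f x - f (l \<otimes> x)) \<in> ?V" if "f \<in> ?V" "l \<in> lcs_aux G k" for f l
    by (rule fun_subspaceD(5)[OF V that(1) bounded_cls_translate[OF that(1) N lcs_carrier[OF that(2)]]])
  have W: "fun_subspace W" unfolding fun_subspace_def
  proof (intro conjI ballI allI)
    show "(\<lambda>_. 0) \<in> W" unfolding W_def by (rule CollectI, rule exI[of _ "[]"]) (auto simp: diff_sum_simps)
  next
    fix v w assume "v \<in> W" "w \<in> W"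
    then obtain ps qs where "v = diff_sum ps" "w = diff_sum qs"
      "\<forall>(f, l)\<in>set ps. f \<in> ?V \<and> l \<in> lcs_aux G k" "\<forall>(f, l)\<in>set qs. f \<in> ?V \<and> l \<in> lcs_aux G k"
      unfolding W_def by blast
    then show "(\<lambda>x. v x + w x) \<in> W" unfolding W_def
      by (intro CollectI exI[of _ "ps @ qs"]) (auto simp: diff_sum_simps)
  next
    fix c w assume "w \<in> W"
    then obtain ps where ps: "w = diff_sum ps" "\<forall>(f, l)\<in>set ps. f \<in> ?V \<and> l \<in> lcs_aux G k"
      unfolding W_def by blast
    have "c * diff_sum qs x = diff_sum (map (\<lambda>(f, l). (\<lambda>x. c * f x, l)) qs) x" for qs x
      by (induction qs) (auto simp: diff_sum_simps algebra_simps)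
    moreover have "\<forall>(f, l)\<in>set (map (\<lambda>(f, l). (\<lambda>x. c * f x, l)) ps). f \<in> ?V \<and> l \<in> lcs_aux G k"
      using ps(2) fun_subspaceD(3)[OF V] by fastforce
    ultimately show "(\<lambda>x. c * w x) \<in> W" unfolding W_def ps(1) by blast
  qed
  have WV: "W \<subseteq> ?V"
  proof
    fix w assume "w \<in> W"
    then obtain ps where ps: "w = diff_sum ps" "\<forall>(f, l)\<in>set ps. f \<in> ?V \<and> l \<in> lcs_aux G k"
      unfolding W_def by blast
    have "diff_sum ps \<in> ?V" using ps(2)
    proof (induction ps)
      case Nil then show ?case using bounded_cls_const[of 0] by (simp add: diff_sum_def)
    next
      case (Cons q qs)
      obtain f l where q: "q = (f, l)" by (cases q)
      then have "diff_sum (q # qs) = (\<lambda>x. (f x - f (l \<otimes> x)) + diff_sum qs x)" by (auto simp: diff_sum_simps)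
      then show ?case using fun_subspaceD(2)[OF V tr[of f l] Cons.IH] Cons.prems q by auto
    qed
    then show "w \<in> ?V" by (simp add: ps)
  qed
  have pos: "0 \<le> p w" if wW: "w \<in> W" for w
  proof (rule ccontr)
    assume neg: "\<not> 0 \<le> p w"
    obtain ps where ps: "w = diff_sum ps" "\<forall>(f, l)\<in>set ps. f \<in> ?V \<and> l \<in> lcs_aux G k"
      using wW unfolding W_def by blast
    obtain x where "x \<in> carrier G" "- (- p w) < w x"
      using diff_sum_not_negative[OF ps(2), of "- p w"] neg ps(1) by auto
    then show False using leP[of w x] WV wW by auto
  qed
  obtain m where m: "linear_on ?V m" "\<forall>f\<in>?V. m f \<le> p f" "\<forall>w\<in>W. m w = 0"
    using hahn_banach_quotient[OF V p W WV pos fun_subspaceD(1)[OF V]] by blast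
  show ?thesis
  proof (rule that[OF m(1)])
    show "m f \<le> B" if "f \<in> ?V" "\<forall>x\<in>carrier G. f x \<le> B" for f B
      using m(2) that ple order_trans by blast
    show "m (\<lambda>x. f (l \<otimes> x)) = m f" if "f \<in> ?V" "l \<in> lcs_aux G k" for f l
    proof -
      have "(\<lambda>x. f x - f (l \<otimes> x)) \<in> W" unfolding W_def
        by (rule CollectI, rule exI[of _ "[(f, l)]"]) (use that in \<open>auto simp: diff_sum_def\<close>)
      then show ?thesis
        using m(3) linear_on_diff[OF V m(1) that(1) bounded_cls_translate[OF that(1) N lcs_carrier[OF that(2)]]]
        by fastforce
    qed
  qed
qed

text \<open>Amenability passes to extensions: average over the central layer with \<open>m\<close>,
  then over the smaller quotient with \<open>M\<close>. At level 0 the quotient is trivial and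
  evaluation at the identity is a mean.\<close>

theorem nilpotent_quotient_mean: "\<exists>M. inv_mean G (lcs_aux G k) M"
proof (induction k)
  case 0
  have const: "f x = f \<one>" if "f \<in> bounded_cls G (carrier G)" "x \<in> carrier G" for f x
  proof -
    have "f (\<one> \<otimes> x) = f \<one>" using that one_closed unfolding bounded_cls_def by blast
    then show ?thesis using that by simp
  qed
  have "inv_mean G (lcs_aux G 0) (\<lambda>f. f \<one>)"
    unfolding inv_mean_def linear_on_def using const by auto
  then show ?case by blast
next
  case (Suc k)
  then obtain M where M: "inv_mean G (lcs_aux G k) M" by blast
  let ?V = "bounded_cls G (lcs_aux G (Suc k))" and ?U = "bounded_cls G (lcs_aux G k)"
  have Ml: "linear_on ?U M" and Mle: "\<And>f B. f \<in> ?U \<Longrightarrow> \<forall>x\<in>carrier G. f x \<le> B \<Longrightarrow> M f \<le> B"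
    and Mt: "\<And>f g. g \<in> carrier G \<Longrightarrow> f \<in> ?U \<Longrightarrow> M (\<lambda>x. f (g \<otimes> x)) = M f"
    using M unfolding inv_mean_def by blast+
  obtain m where m: "linear_on ?V m" and mle: "\<And>f B. f \<in> ?V \<Longrightarrow> \<forall>x\<in>carrier G. f x \<le> B \<Longrightarrow> m f \<le> B"
    and mt: "\<And>f l. f \<in> ?V \<Longrightarrow> l \<in> lcs_aux G k \<Longrightarrow> m (\<lambda>x. f (l \<otimes> x)) = m f"
    by (rule layer_mean[of k]) blast
  have N: "lcs_aux G (Suc k) \<subseteq> carrier G" using lcs_carrier by blast
  \<comment> \<open>Multiplying \<open>x\<close> on the right by a layer element is a left
    translation inside \<open>m\<close>, so \<open>h f\<close> lives on the smaller quotient; left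
    translations of \<open>f\<close> become left translations of \<open>h f\<close>.\<close>
  define h where "h f x = m (\<lambda>y. f (x \<otimes> y))" for f x
  note V = bounded_cls_subspace[of G "lcs_aux G (Suc k)"] and U = bounded_cls_subspace[of G "lcs_aux G k"]
  have tr: "(\<lambda>y. f (x \<otimes> y)) \<in> ?V" if "f \<in> ?V" "x \<in> carrier G" for f x
    by (rule bounded_cls_translate[OF that(1) N that(2)])
  have mc: "m f = m g" if "f \<in> ?V" "g \<in> ?V" "\<And>x. x \<in> carrier G \<Longrightarrow> f x = g x" for f g
    by (rule mean_cong[OF m mle that])
  have Mc: "M f = M g" if "f \<in> ?U" "g \<in> ?U" "\<And>x. x \<in> carrier G \<Longrightarrow> f x = g x" for f g
    by (rule mean_cong[OF Ml Mle that])
  have hle: "h f x \<le> B" if "f \<in> ?V" "x \<in> carrier G" "\<forall>y\<in>carrier G. f y \<le> B" for f x B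
    unfolding h_def using that by (intro mle tr) auto
  have assoc: "m (\<lambda>z. f (x \<otimes> (y \<otimes> z))) = h f (x \<otimes> y)" if "f \<in> ?V" "x \<in> carrier G" "y \<in> carrier G" for f x y
    unfolding h_def by (rule mc[OF tr[OF tr[OF that(1,2)] that(3)] tr[OF that(1) m_closed[OF that(2,3)]]])
      (use that in \<open>simp add: m_assoc\<close>)
  have hU: "h f \<in> ?U" if f: "f \<in> ?V" for f
  proof -
    obtain B where B: "\<forall>x\<in>carrier G. \<bar>f x\<bar> \<le> B" using f by (auto simp: bounded_cls_def)
    have "\<bar>h f x\<bar> \<le> B" if x: "x \<in> carrier G" for x
    proof -
      have "h f x \<le> B" using B by (intro hle f x) (auto simp: abs_le_iff)
      moreover have "h (\<lambda>x. - f x) x \<le> B"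
        using B by (intro hle fun_subspaceD(4)[OF V f] x) (auto simp: abs_le_iff)
      moreover have "h (\<lambda>x. - f x) x = - h f x" unfolding h_def by (rule linear_onD(3)[OF m tr[OF f x]])
      ultimately show ?thesis by simp
    qed
    moreover have "h f (x \<otimes> l) = h f x" if x: "x \<in> carrier G" and l: "l \<in> lcs_aux G k" for x l
      using assoc[OF f x lcs_carrier[OF l]] mt[OF tr[OF f x] l] by (simp add: h_def)
    ultimately show ?thesis by (auto simp: bounded_cls_def)
  qed
  have "inv_mean G (lcs_aux G (Suc k)) (\<lambda>f. M (h f))"
    unfolding inv_mean_def
  proof (intro conjI ballI allI impI)
    show "linear_on ?V (\<lambda>f. M (h f))" unfolding linear_on_def
    proof (intro conjI ballI allI)
      fix f g assume f: "f \<in> ?V" and g: "g \<in> ?V"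
      have "M (h (\<lambda>x. f x + g x)) = M (\<lambda>x. h f x + h g x)"
        by (rule Mc[OF hU[OF fun_subspaceD(2)[OF V f g]] fun_subspaceD(2)[OF U hU[OF f] hU[OF g]]])
          (simp add: h_def linear_onD(1)[OF m tr[OF f] tr[OF g]])
      then show "M (h (\<lambda>x. f x + g x)) = M (h f) + M (h g)"
        using linear_onD(1)[OF Ml hU[OF f] hU[OF g]] by simp
    next
      fix c f assume f: "f \<in> ?V"
      have "M (h (\<lambda>x. c * f x)) = M (\<lambda>x. c * h f x)"
        by (rule Mc[OF hU[OF fun_subspaceD(3)[OF V f]] fun_subspaceD(3)[OF U hU[OF f]]])
          (simp add: h_def linear_onD(2)[OF m tr[OF f]])
      then show "M (h (\<lambda>x. c * f x)) = c * M (h f)"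
        using linear_onD(2)[OF Ml hU[OF f]] by simp
    qed
    show "M (h f) \<le> B" if "f \<in> ?V" "\<forall>x\<in>carrier G. f x \<le> B" for f B
      using hle that by (intro Mle hU) auto
    show "M (h (\<lambda>x. f (g \<otimes> x))) = M (h f)" if g: "g \<in> carrier G" and f: "f \<in> ?V" for g f
    proof -
      have "M (h (\<lambda>x. f (g \<otimes> x))) = M (\<lambda>x. h f (g \<otimes> x))"
        by (rule Mc[OF hU[OF tr[OF f g]] bounded_cls_translate[OF hU[OF f] _ g]])
          (use lcs_carrier assoc[OF f g] in \<open>auto simp: h_def\<close>)
      then show ?thesis using Mt[OF g hU[OF f]] by simp
    qed
  qed
  then show ?case by blast
qed

end

section \<open>Homogeneous quasimorphisms\<close>

text \<open>Stands in for limits along powers: to prove an identity for homogeneous quasimorphisms,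
  bound its defect and find an operation on the arguments that doubles it.\<close>

lemma doubling_zero:
  fixes g :: "'b \<Rightarrow> real"
  assumes dbl: "\<And>s. s \<in> S \<Longrightarrow> \<exists>t\<in>S. g t = 2 * g s" and bdd: "\<And>s. s \<in> S \<Longrightarrow> \<bar>g s\<bar> \<le> K" and s: "s \<in> S"
  shows "g s = 0"
proof -
  have le: "2 ^ k * \<bar>g s\<bar> \<le> K" if "s \<in> S" for k s
    using that
  proof (induction k arbitrary: s)
    case (Suc k)
    obtain t where "t \<in> S" "g t = 2 * g s" using dbl[OF Suc.prems] by blast
    then show ?case using Suc.IH[of t] by (simp add: abs_mult algebra_simps)
  qed (use bdd in simp)
  have "\<bar>g s\<bar> \<le> 0"
  proof (rule ccontr)
    assume "\<not> \<bar>g s\<bar> \<le> 0"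
    then have pos: "0 < \<bar>g s\<bar>" by simp
    obtain k :: nat where "K / \<bar>g s\<bar> < 2 ^ k"
      using real_arch_pow[of 2 "K / \<bar>g s\<bar>"] by auto
    then have "K < 2 ^ k * \<bar>g s\<bar>" using pos by (simp add: field_simps)
    then show False using le[OF s, of k] by simp
  qed
  then show ?thesis by simp
qed

definition quasi_add :: "('a, 'b) monoid_scheme \<Rightarrow> 'a set \<Rightarrow> ('a \<Rightarrow> real) \<Rightarrow> real \<Rightarrow> bool" where
  "quasi_add G N f D \<longleftrightarrow> (\<forall>x\<in>N. \<forall>y\<in>N. \<bar>f (x \<otimes>\<^bsub>G\<^esub> y) - f x - f y\<bar> \<le> D)"

lemma quasi_addD: "quasi_add G N f D \<Longrightarrow> x \<in> N \<Longrightarrow> y \<in> N \<Longrightarrow> \<bar>f (x \<otimes>\<^bsub>G\<^esub> y) - f x - f y\<bar> \<le> D"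
  by (simp add: quasi_add_def)

lemma hom_qm_quasi_add:
  assumes "hom_qm G N \<phi>" obtains D where "quasi_add G N \<phi> D"
  using assms that by (auto simp: hom_qm_def quasi_add_def)

lemma hom_qm_int_pow: "hom_qm G N \<phi> \<Longrightarrow> x \<in> N \<Longrightarrow> \<phi> (x [^]\<^bsub>G\<^esub> (n::int)) = of_int n * \<phi> x"
  by (simp add: hom_qm_def)

lemma hom_qm_outside: "hom_qm G N \<phi> \<Longrightarrow> x \<notin> N \<Longrightarrow> \<phi> x = 0"
  by (simp add: hom_qm_def)

context group
begin

lemma hom_qm_square: "hom_qm G N \<phi> \<Longrightarrow> x \<in> N \<Longrightarrow> N \<subseteq> carrier G \<Longrightarrow> \<phi> (x \<otimes> x) = 2 * \<phi> x"
  using hom_qm_int_pow[of G N \<phi> x 2] int_pow_mult[of x 1 1] by (auto simp: subset_iff)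

lemma hom_qm_one: "hom_qm G N \<phi> \<Longrightarrow> x \<in> N \<Longrightarrow> \<phi> \<one> = 0"
  using hom_qm_int_pow[of G N \<phi> x 0] by simp

lemma hom_qm_inv: "hom_qm G N \<phi> \<Longrightarrow> x \<in> N \<Longrightarrow> N \<subseteq> carrier G \<Longrightarrow> \<phi> (inv x) = - \<phi> x"
  using hom_qm_int_pow[of G N \<phi> x "-1"] int_pow_neg[of x 1] by (auto simp: subset_iff)

text \<open>Homogeneity for squares is enough: for fixed \<open>n\<close> the defect of the n-th
  power rule is bounded and doubles when \<open>x\<close> is squared.\<close>

lemma hom_qmI:
  assumes N: "subgroup N G" and out: "\<And>x. x \<notin> N \<Longrightarrow> \<psi> x = 0" and q: "quasi_add G N \<psi> D"
    and sq: "\<And>x. x \<in> N \<Longrightarrow> \<psi> (x \<otimes> x) = 2 * \<psi> x"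
  shows "hom_qm G N \<psi>"
proof -
  have Nc: "x \<in> carrier G" if "x \<in> N" for x using subgroup.mem_carrier[OF N that] .
  have N1: "\<one> \<in> N" using subgroup.one_closed[OF N] .
  have p1: "\<psi> \<one> = 0" using sq[OF N1] by simp
  have Nm: "x \<otimes> y \<in> N" if "x \<in> N" "y \<in> N" for x y using subgroup.m_closed[OF N that] .
  have Npow: "x [^] n \<in> N" if "x \<in> N" for x and n :: int using subgroup_int_pow_closed[OF N that] .
  have D0: "0 \<le> D" using quasi_addD[OF q N1 N1] by simp
  have nat_bound: "\<bar>\<psi> (x [^] (int m)) - real m * \<psi> x\<bar> \<le> real m * D" if x: "x \<in> N" for x m
  proof (induction m)
    case (Suc m)
    have "x [^] (int (Suc m)) = x [^] (int m) \<otimes> x"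
      using int_pow_mult[OF Nc[OF x], of "int m" 1] Nc[OF x] by (simp add: add.commute)
    then show ?case using Suc quasi_addD[OF q Npow[OF x] x, of "int m"] by (simp add: algebra_simps)
  qed (use p1 in simp)
  have bound: "\<exists>K. \<forall>x\<in>N. \<bar>\<psi> (x [^] n) - of_int n * \<psi> x\<bar> \<le> K" for n :: int
  proof (cases n rule: int_cases2)
    case (nonneg m) then show ?thesis using nat_bound by auto
  next
    case (nonpos m)
    have "\<bar>\<psi> (x [^] n) - of_int n * \<psi> x\<bar> \<le> real m * D + D" if x: "x \<in> N" for x
    proof -
      have "x [^] int m \<otimes> x [^] n = \<one>"
        using int_pow_mult[OF Nc[OF x], of "int m" n] nonpos by simp
      then show ?thesis
        using quasi_addD[OF q Npow[OF x] Npow[OF x], of "int m" n] nat_bound[OF x, of m] p1 nonpos by simp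
    qed
    then show ?thesis by blast
  qed
  have "\<psi> (x [^] n) = of_int n * \<psi> x" if x: "x \<in> N" for x and n :: int
  proof -
    obtain K where K: "\<And>x. x \<in> N \<Longrightarrow> \<bar>\<psi> (x [^] n) - of_int n * \<psi> x\<bar> \<le> K" using bound[of n] by blast
    have "\<psi> (x [^] n) - of_int n * \<psi> x = 0"
    proof (rule doubling_zero[OF _ K x])
      fix y assume y: "y \<in> N"
      have "(y \<otimes> y) [^] n = y [^] n \<otimes> y [^] n" using Nc[OF y] by (intro int_pow_mult_distrib) auto
      then show "\<exists>t\<in>N. \<psi> (t [^] n) - of_int n * \<psi> t = 2 * (\<psi> (y [^] n) - of_int n * \<psi> y)"
        using sq[OF y] sq[OF Npow[OF y]] Nm[OF y y] by (intro bexI[of _ "y \<otimes> y"]) (simp_all add: algebra_simps)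
    qed
    then show ?thesis by simp
  qed
  then show ?thesis unfolding hom_qm_def using out q unfolding quasi_add_def by blast
qed

lemma homogenization:
  assumes q: "quasi_add G (carrier G) f D"
  obtains \<psi> where "hom_qm G (carrier G) \<psi>" "\<And>x. x \<in> carrier G \<Longrightarrow> \<bar>\<psi> x - f x\<bar> \<le> D"
proof -
  \<comment> \<open>Only powers of exponent \<open>2 ^ k\<close> are used: consecutive terms differ
    by at most \<open>D / 2 ^ Suc k\<close>, these bounds sum to exactly \<open>D\<close>, and
    squaring merely shifts the sequence.\<close>
  define a where "a x k = f (x [^] (2 ^ k :: nat)) / 2 ^ k" for x and k :: nat
  have sqp: "x [^] (2 ^ Suc k :: nat) = x [^] (2 ^ k :: nat) \<otimes> x [^] (2 ^ k :: nat)" if "x \<in> carrier G" for x k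
    using nat_pow_mult[OF that, of "2 ^ k" "2 ^ k"] by (simp add: mult_2)
  have a0: "a x 0 = f x" if "x \<in> carrier G" for x using that by (simp add: a_def)
  have step: "\<bar>a x (Suc k) - a x k\<bar> \<le> D * (1 / 2) ^ Suc k" if x: "x \<in> carrier G" for x k
  proof -
    let ?y = "x [^] (2 ^ k :: nat)"
    have eq: "a x (Suc k) - a x k = (f (?y \<otimes> ?y) - f ?y - f ?y) / 2 ^ Suc k"
      unfolding a_def sqp[OF x] by (simp add: field_simps)
    have "\<bar>f (?y \<otimes> ?y) - f ?y - f ?y\<bar> \<le> D"
      using x by (intro quasi_addD[OF q]) auto
    then have "\<bar>f (?y \<otimes> ?y) - f ?y - f ?y\<bar> / 2 ^ Suc k \<le> D / 2 ^ Suc k"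
      by (rule divide_right_mono) simp
    then show ?thesis unfolding eq by (simp only: abs_divide power_abs abs_numeral power_one_over mult_1_right times_divide_eq_right)
  qed
  have geo: "(\<lambda>k. D * (1 / 2) ^ Suc k) sums D"
    using sums_mult[OF power_half_series, of D] by simp
  have sm: "summable (\<lambda>k. a x (Suc k) - a x k)" if x: "x \<in> carrier G" for x
    by (rule summable_comparison_test'[OF sums_summable[OF geo], of 0]) (use step[OF x] in simp)
  define \<psi> where "\<psi> x = (if x \<in> carrier G then lim (a x) else 0)" for x
  have lim: "(a x \<longlonglongrightarrow> \<psi> x)" "\<bar>\<psi> x - f x\<bar> \<le> D" if x: "x \<in> carrier G" for x
  proof -
    let ?b = "\<lambda>k. a x (Suc k) - a x k"
    have "(\<lambda>n. \<Sum>k<n. ?b k) \<longlonglongrightarrow> suminf ?b" using summable_LIMSEQ[OF sm[OF x]] .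
    then have "(\<lambda>n. a x n - f x) \<longlonglongrightarrow> suminf ?b" by (simp add: sum_lessThan_telescope a0[OF x])
    from tendsto_add[OF this tendsto_const[of "f x"]]
    have l: "a x \<longlonglongrightarrow> suminf ?b + f x" by simp
    then have "\<psi> x = suminf ?b + f x" using x by (simp add: \<psi>_def limI)
    then show "a x \<longlonglongrightarrow> \<psi> x" using l by simp
    have sa: "summable (\<lambda>k. \<bar>?b k\<bar>)"
      by (rule summable_comparison_test'[OF sums_summable[OF geo], of 0]) (use step[OF x] in simp)
    have "\<bar>suminf ?b\<bar> \<le> suminf (\<lambda>k. \<bar>?b k\<bar>)" by (rule summable_rabs[OF sa])
    also have "\<dots> \<le> suminf (\<lambda>k. D * (1 / 2) ^ Suc k)" by (rule suminf_le[OF step[OF x] sa sums_summable[OF geo]])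
    also have "\<dots> = D" using sums_unique[OF geo] by simp
    finally show "\<bar>\<psi> x - f x\<bar> \<le> D" using \<open>\<psi> x = suminf ?b + f x\<close> by simp
  qed
  have "\<psi> (x \<otimes> x) = 2 * \<psi> x" if x: "x \<in> carrier G" for x
  proof -
    have "(x \<otimes> x) [^] (2 ^ k :: nat) = x [^] (2 ^ Suc k :: nat)" for k
      using pow_mult_distrib[of x x "2 ^ k"] x sqp[OF x, of k] by simp
    then have "a (x \<otimes> x) = (\<lambda>k. 2 * a x (Suc k))" by (intro ext) (simp add: a_def field_simps)
    moreover have "(\<lambda>k. 2 * a x (Suc k)) \<longlonglongrightarrow> 2 * \<psi> x"
      by (intro tendsto_intros LIMSEQ_Suc lim x)
    ultimately have "a (x \<otimes> x) \<longlonglongrightarrow> 2 * \<psi> x" by (simp only:)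
    then show ?thesis using lim(1)[of "x \<otimes> x"] x LIMSEQ_unique by blast
  qed
  \<comment> \<open>One \<open>D\<close> for the defect of \<open>f\<close> and one for each of the
    three values replaced.\<close>
  moreover have "quasi_add G (carrier G) \<psi> (4 * D)"
    unfolding quasi_add_def
  proof safe
    fix x y assume x: "x \<in> carrier G" and y: "y \<in> carrier G"
    show "\<bar>\<psi> (x \<otimes> y) - \<psi> x - \<psi> y\<bar> \<le> 4 * D"
      using lim(2)[OF x] lim(2)[OF y] lim(2)[OF m_closed[OF x y]] quasi_addD[OF q x y] by linarith
  qed
  ultimately have "hom_qm G (carrier G) \<psi>"
    using subgroup_self by (intro hom_qmI) (auto simp: \<psi>_def)
  then show ?thesis using lim(2) by (rule that)
qed

lemma hom_qm_conj:
  assumes "hom_qm G (carrier G) \<phi>" and g: "g \<in> carrier G" and x: "x \<in> carrier G"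
  shows "\<phi> (g \<otimes> x \<otimes> inv g) = \<phi> x"
proof -
  obtain D where q: "quasi_add G (carrier G) \<phi> D" using hom_qm_quasi_add[OF assms(1)] .
  have "\<phi> (g \<otimes> x \<otimes> inv g) - \<phi> x = 0"
  proof (rule doubling_zero[where S="carrier G" and g="\<lambda>x. \<phi> (g \<otimes> x \<otimes> inv g) - \<phi> x" and K="2 * D"])
    fix x assume x: "x \<in> carrier G"
    have "\<bar>\<phi> (g \<otimes> x \<otimes> inv g) - \<phi> (g \<otimes> x) - \<phi> (inv g)\<bar> \<le> D" "\<bar>\<phi> (g \<otimes> x) - \<phi> g - \<phi> x\<bar> \<le> D"
      using x g by (auto intro!: quasi_addD[OF q])
    then show "\<bar>\<phi> (g \<otimes> x \<otimes> inv g) - \<phi> x\<bar> \<le> 2 * D"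
      using hom_qm_inv[OF assms(1) g order_refl] by simp
    have "g \<otimes> (x \<otimes> x) \<otimes> inv g = (g \<otimes> x \<otimes> inv g) \<otimes> (g \<otimes> x \<otimes> inv g)"
      using g x by (simp add: group_word_simps)
    then have "\<phi> (g \<otimes> (x \<otimes> x) \<otimes> inv g) = 2 * \<phi> (g \<otimes> x \<otimes> inv g)"
      using hom_qm_square[OF assms(1) _ order_refl, of "g \<otimes> x \<otimes> inv g"] g x by simp
    then show "\<exists>t\<in>carrier G. \<phi> (g \<otimes> t \<otimes> inv g) - \<phi> t = 2 * (\<phi> (g \<otimes> x \<otimes> inv g) - \<phi> x)"
      using hom_qm_square[OF assms(1) x order_refl] x by (intro bexI[of _ "x \<otimes> x"]) auto
  qed (rule x)
  then show ?thesis by simp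
qed

text \<open>The square of \<open>x \<otimes> y\<close> is the square of \<open>x\<close> times a
  conjugate of \<open>y\<close> times \<open>y\<close>, again an element of \<open>M\<close> times
  one of \<open>N\<close>; so the bounded difference doubles. This is what lets quasimorphisms
  descend to a quotient.\<close>

lemma hom_qm_mod:
  assumes \<phi>: "hom_qm G M \<phi>" and M: "subgroup M G" and N: "N \<lhd> G" "N \<subseteq> M"
    and z: "\<And>y. y \<in> N \<Longrightarrow> \<phi> y = 0" and x: "x \<in> M" and y: "y \<in> N"
  shows "\<phi> (x \<otimes> y) = \<phi> x"
proof -
  obtain D where q: "quasi_add G M \<phi> D" using hom_qm_quasi_add[OF \<phi>] .
  have Mc: "M \<subseteq> carrier G" using subgroup.subset[OF M] .
  define g where "g p = \<phi> (fst p \<otimes> snd p) - \<phi> (fst p)" for p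
  have "g (x, y) = 0"
  proof (rule doubling_zero[where S="M \<times> N" and K=D])
    fix p assume "p \<in> M \<times> N"
    then obtain x y where p: "p = (x, y)" "x \<in> M" "y \<in> N" by auto
    have xc: "x \<in> carrier G" and yc: "y \<in> carrier G" and yM: "y \<in> M" using p N Mc by auto
    show "\<bar>g p\<bar> \<le> D" using quasi_addD[OF q p(2) yM] z[OF p(3)] by (simp add: g_def p)
    let ?t = "(x \<otimes> x, (inv x \<otimes> y \<otimes> x) \<otimes> y)"
    have "(x \<otimes> x) \<otimes> ((inv x \<otimes> y \<otimes> x) \<otimes> y) = (x \<otimes> y) \<otimes> (x \<otimes> y)"
      using xc yc by (simp add: group_word_simps)
    then have "g ?t = 2 * g p"
      using hom_qm_square[OF \<phi> _ Mc] p subgroup.m_closed[OF M p(2) yM] by (simp add: g_def p)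
    moreover have "?t \<in> M \<times> N"
      using p conj_mem'[OF N(1) xc p(3)] normal_mult_mem[OF N(1) _ p(3)] subgroup.m_closed[OF M] by simp
    ultimately show "\<exists>t\<in>M \<times> N. g t = 2 * g p" by blast
  qed (use x y in simp)
  then show ?thesis by (simp add: g_def)
qed

text \<open>Additivity climbs one level at a time. On \<open>lcs_aux G (Suc k)\<close> it forces
  \<phi> to vanish, because it vanishes on the generating commutators. Then \<phi> ignores that
  subgroup, modulo which \<open>lcs_aux G k\<close> is abelian, and the additivity defect on
  \<open>lcs_aux G k\<close> doubles under squaring both arguments.\<close>

lemma hom_qm_additive_of_lcs:
  assumes \<phi>: "hom_qm G (carrier G) \<phi>"
    and add: "\<And>x y. x \<in> lcs_aux G k \<Longrightarrow> y \<in> lcs_aux G k \<Longrightarrow> \<phi> (x \<otimes> y) = \<phi> x + \<phi> y"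
    and x: "x \<in> carrier G" and y: "y \<in> carrier G"
  shows "\<phi> (x \<otimes> y) = \<phi> x + \<phi> y"
  using add x y
proof (induction k arbitrary: x y)
  case 0 then show ?case by simp
next
  case (Suc k)
  note sq = hom_qm_square[OF \<phi> _ order_refl]
  obtain D where q: "quasi_add G (carrier G) \<phi> D" using hom_qm_quasi_add[OF \<phi>] .
  \<comment> \<open>The commutator is \<open>g\<close> times a conjugate of its inverse, hence the
    bound \<open>D\<close>. Squaring \<open>g\<close> turns it into a conjugate of itself times
    itself, and additivity on \<open>lcs_aux G (Suc k)\<close> doubles the value.\<close>
  have gen0: "\<phi> (cmt g z) = 0" if g: "g \<in> carrier G" and z: "z \<in> lcs_aux G k" for g z
  proof -
    have zc: "z \<in> carrier G" using z lcs_carrier by blast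
    show ?thesis
    proof (rule doubling_zero[where S="carrier G" and K=D and g="\<lambda>g. \<phi> (cmt g z)"])
      fix g assume g: "g \<in> carrier G"
      have "cmt g z = g \<otimes> (z \<otimes> inv g \<otimes> inv z)" using g zc by (simp add: cmt_def m_assoc)
      then show "\<bar>\<phi> (cmt g z)\<bar> \<le> D"
        using quasi_addD[OF q g, of "z \<otimes> inv g \<otimes> inv z"] g zc hom_qm_conj[OF \<phi> zc, of "inv g"]
          hom_qm_inv[OF \<phi> g order_refl] by simp
      have c: "cmt g z \<in> lcs_aux G (Suc k)" using cmt_lcs_Suc[OF g z] .
      have "\<phi> (cmt (g \<otimes> g) z) = \<phi> (g \<otimes> cmt g z \<otimes> inv g) + \<phi> (cmt g z)"
        unfolding cmt_mult_left[OF g g zc] by (rule Suc.prems(1)[OF conj_mem[OF lcs_normal g c] c])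
      then show "\<exists>t\<in>carrier G. \<phi> (cmt t z) = 2 * \<phi> (cmt g z)"
        using hom_qm_conj[OF \<phi> g, of "cmt g z"] g zc by (intro bexI[of _ "g \<otimes> g"]) auto
    qed (rule g)
  qed
  have z: "\<phi> z = 0" if "z \<in> lcs_aux G (Suc k)" for z
    using that unfolding lcs_Suc
  proof (induction rule: generate.induct)
    case one show ?case by (rule hom_qm_one[OF \<phi> one_closed])
  next
    case (incl h) then show ?case using gen0 by auto
  next
    case (inv h)
    then obtain g z where h: "g \<in> carrier G" "z \<in> lcs_aux G k" "h = cmt g z" by auto
    then have "\<phi> h = 0" "h \<in> carrier G" using gen0 lcs_carrier by auto
    then show ?case using hom_qm_inv[OF \<phi> _ order_refl, of h] by simp
  next
    case (eng a b)
    then show ?case using Suc.prems(1)[of a b] unfolding lcs_Suc by simp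
  qed
  have "\<phi> (x \<otimes> y) = \<phi> x + \<phi> y" if xy: "x \<in> lcs_aux G k" "y \<in> lcs_aux G k" for x y
  proof -
    define g where "g p = \<phi> (fst p \<otimes> snd p) - \<phi> (fst p) - \<phi> (snd p)" for p
    have "g (x, y) = 0"
    proof (rule doubling_zero[where S="lcs_aux G k \<times> lcs_aux G k" and K=D])
      fix p assume "p \<in> lcs_aux G k \<times> lcs_aux G k"
      then obtain x y where p: "p = (x, y)" "x \<in> lcs_aux G k" "y \<in> lcs_aux G k" by auto
      have xc: "x \<in> carrier G" and yc: "y \<in> carrier G" using p lcs_carrier by auto
      show "\<bar>g p\<bar> \<le> D" using quasi_addD[OF q xc yc] by (simp add: g_def p)
      \<comment> \<open>The correction between
        \<open>x \<otimes> x \<otimes> (y \<otimes> y)\<close> and the square of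
        \<open>x \<otimes> y\<close>; it lies where \<phi> already vanishes.\<close>
      let ?c = "inv y \<otimes> cmt (inv x) (inv y) \<otimes> y"
      have "cmt (inv x) (inv y) \<in> lcs_aux G (Suc k)"
        using xc subgroup.m_inv_closed[OF lcs_subgroup p(3)] by (intro cmt_lcs_Suc) auto
      then have c: "?c \<in> lcs_aux G (Suc k)" by (rule conj_mem'[OF lcs_normal yc])
      have "(x \<otimes> x) \<otimes> (y \<otimes> y) = ((x \<otimes> y) \<otimes> (x \<otimes> y)) \<otimes> ?c"
        using xc yc by (simp add: cmt_def group_word_simps)
      then have "\<phi> ((x \<otimes> x) \<otimes> (y \<otimes> y)) = 2 * \<phi> (x \<otimes> y)"
        using hom_qm_mod[OF \<phi> subgroup_self lcs_normal _ z _ c, of "(x \<otimes> y) \<otimes> (x \<otimes> y)"] xc yc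
          lcs_carrier[of _ "Suc k"] sq[of "x \<otimes> y"] by auto
      then have "g (x \<otimes> x, y \<otimes> y) = 2 * g p" using sq xc yc by (simp add: g_def p)
      moreover have "(x \<otimes> x, y \<otimes> y) \<in> lcs_aux G k \<times> lcs_aux G k"
        using p subgroup.m_closed[OF lcs_subgroup] by simp
      ultimately show "\<exists>t\<in>lcs_aux G k \<times> lcs_aux G k. g t = 2 * g p" by blast
    qed (use xy in simp)
    then show ?thesis by (simp add: g_def)
  qed
  then show ?case using Suc.IH Suc.prems by blast
qed

end

section \<open>Extension of invariant quasimorphisms\<close>

definition (in group) coset_repr :: "'a set \<Rightarrow> 'a \<Rightarrow> 'a" where
  "coset_repr N x = (SOME y. y \<in> N #> x)"

context group
begin

lemma coset_repr:
  assumes N: "N \<lhd> G" and x: "x \<in> carrier G"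
  shows "coset_repr N x \<in> carrier G" "x \<otimes> inv (coset_repr N x) \<in> N"
proof -
  interpret N: normal N G by (rule N)
  have "x \<in> N #> x" by (rule rcos_self[OF x N.is_subgroup])
  then have m: "coset_repr N x \<in> N #> x" unfolding coset_repr_def by (rule someI)
  then obtain n where n: "n \<in> N" "coset_repr N x = n \<otimes> x" by (auto simp: r_coset_def)
  have nc: "n \<in> carrier G" using n by simp
  then show "coset_repr N x \<in> carrier G" using n x by simp
  have "x \<otimes> inv (coset_repr N x) = inv n" using n nc x by (simp add: group_word_simps)
  then show "x \<otimes> inv (coset_repr N x) \<in> N" using n by simp
qed

lemma coset_repr_mult:
  assumes N: "N \<lhd> G" and x: "x \<in> carrier G" and n: "n \<in> N"
  shows "coset_repr N (n \<otimes> x) = coset_repr N x" "coset_repr N (x \<otimes> n) = coset_repr N x"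
proof -
  interpret N: normal N G by (rule N)
  have 1: "N #> (m \<otimes> x) = N #> x" if m: "m \<in> N" for m
    using repr_independence[of "m \<otimes> x" N x] N.is_subgroup x m N.rcos_const[OF is_group]
      coset_mult_assoc[of N m x] N.subset by (metis N.mem_carrier N.rcos_const is_group)
  then show "coset_repr N (n \<otimes> x) = coset_repr N x" using n by (simp add: coset_repr_def)
  have "x \<otimes> n = (x \<otimes> n \<otimes> inv x) \<otimes> x" using x n N.mem_carrier by (simp add: group_word_simps)
  then show "coset_repr N (x \<otimes> n) = coset_repr N x"
    using 1[OF conj_mem[OF N x n]] by (simp add: coset_repr_def)
qed

text \<open>\<open>\<kappa>\<close> is the failure of \<open>x \<mapsto> \<phi> (x s(x)\<^sup>-\<^sup>1)\<close> to be additive, up to bounded error; it is pulled back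
  from the amenable group \<open>G / \<gamma>\<^sub>k G\<close>, so its bounded coboundary is the coboundary of a bounded
  function and \<open>\<kappa>\<close> is at bounded distance from a cocycle.\<close>
lemma extend_invariant_qm:
  assumes split: "\<And>\<omega> :: 'a \<Rightarrow> 'a \<Rightarrow> real. (\<And>x y z. x \<in> carrier G \<Longrightarrow> y \<in> carrier G \<Longrightarrow> z \<in> carrier G \<Longrightarrow>
      \<omega> y z - \<omega> (x \<otimes> y) z + \<omega> x (y \<otimes> z) - \<omega> x y = 0) \<Longrightarrow>
      \<exists>f. \<forall>x\<in>carrier G. \<forall>y\<in>carrier G. f x + f y - f (x \<otimes> y) = \<omega> x y"
    and \<phi>: "\<phi> \<in> Q_inv G (lcs_aux G k)"
  shows "\<exists>a\<in>H1_inv G (lcs_aux G k). \<exists>\<psi>. hom_qm G (carrier G) \<psi> \<and> (\<forall>x\<in>lcs_aux G k. \<phi> x = a x + \<psi> x)"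
proof -
  let ?N = "lcs_aux G k"
  have N: "?N \<lhd> G" by (rule lcs_normal)
  interpret N: normal ?N G by (rule N)
  have qm: "hom_qm G ?N \<phi>" and conj: "\<And>g x. g \<in> carrier G \<Longrightarrow> x \<in> ?N \<Longrightarrow> \<phi> (g \<otimes> x \<otimes> inv g) = \<phi> x"
    using \<phi> by (auto simp: Q_inv_def)
  obtain D where q: "quasi_add G ?N \<phi> D" using hom_qm_quasi_add[OF qm] .
  have D0: "0 \<le> D" using quasi_addD[OF q N.one_closed N.one_closed] by simp
  define s where "s = coset_repr ?N"
  define \<nu> where "\<nu> x = x \<otimes> inv (s x)" for x
  have sc [simp]: "s x \<in> carrier G" if "x \<in> carrier G" for x
    unfolding s_def by (rule coset_repr(1)[OF N that])
  have \<nu>N: "\<nu> x \<in> ?N" if "x \<in> carrier G" for x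
    unfolding s_def \<nu>_def by (rule coset_repr(2)[OF N that])
  have \<nu>c [simp]: "\<nu> x \<in> carrier G" if "x \<in> carrier G" for x using \<nu>N[OF that] by simp
  have sl: "s (n \<otimes> x) = s x" and sr: "s (x \<otimes> n) = s x" if "x \<in> carrier G" "n \<in> ?N" for n x
    unfolding s_def by (rule coset_repr_mult[OF N that])+
  \<comment> \<open>The factor set of the extension by \<open>?N\<close> for the section
    \<open>s\<close>; \<open>\<kappa>\<close> is \<phi> applied to it and depends only on
    cosets.\<close>
  define e where "e x y = s x \<otimes> s y \<otimes> inv (s (x \<otimes> y))" for x y
  define \<phi>' where "\<phi>' x = \<phi> (\<nu> x)" for x
  define \<kappa> where "\<kappa> x y = \<phi> (e x y)" for x y
  have ec [simp]: "e x y \<in> carrier G" if "x \<in> carrier G" "y \<in> carrier G" for x y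
    using that by (simp add: e_def)
  have \<nu>_mult: "\<nu> (x \<otimes> y) = \<nu> x \<otimes> (s x \<otimes> \<nu> y \<otimes> inv (s x)) \<otimes> e x y"
    if "x \<in> carrier G" "y \<in> carrier G" for x y
    using that sc[OF that(1)] sc[OF that(2)] sc[of "x \<otimes> y"] by (simp add: \<nu>_def e_def group_word_simps)
  have cj: "s x \<otimes> \<nu> y \<otimes> inv (s x) \<in> ?N" if "x \<in> carrier G" "y \<in> carrier G" for x y
    by (rule conj_mem[OF N sc[OF that(1)] \<nu>N[OF that(2)]])
  have eN: "e x y \<in> ?N" if xy: "x \<in> carrier G" "y \<in> carrier G" for x y
  proof -
    let ?m = "\<nu> x \<otimes> (s x \<otimes> \<nu> y \<otimes> inv (s x))"
    have m: "?m \<in> ?N" by (rule normal_mult_mem[OF N \<nu>N[OF xy(1)] cj[OF xy]])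
    have "e x y = inv ?m \<otimes> \<nu> (x \<otimes> y)"
      unfolding \<nu>_mult[OF xy] using inv_mult_cancel_left(1)[OF N.mem_carrier[OF m] ec[OF xy]] by simp
    then show ?thesis
      using normal_mult_mem[OF N normal_inv_mem[OF N m] \<nu>N[OF m_closed[OF xy]]] by simp
  qed
  define E where "E x y = \<phi>' (x \<otimes> y) - \<phi>' x - \<phi>' y - \<kappa> x y" for x y
  have E: "\<bar>E x y\<bar> \<le> 2 * D" if xy: "x \<in> carrier G" "y \<in> carrier G" for x y
  proof -
    let ?c = "s x \<otimes> \<nu> y \<otimes> inv (s x)"
    have "\<bar>\<phi> (\<nu> x \<otimes> ?c \<otimes> e x y) - \<phi> (\<nu> x \<otimes> ?c) - \<phi> (e x y)\<bar> \<le> D"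
      by (rule quasi_addD[OF q normal_mult_mem[OF N \<nu>N[OF xy(1)] cj[OF xy]] eN[OF xy]])
    moreover have "\<bar>\<phi> (\<nu> x \<otimes> ?c) - \<phi> (\<nu> x) - \<phi> ?c\<bar> \<le> D"
      by (rule quasi_addD[OF q \<nu>N[OF xy(1)] cj[OF xy]])
    moreover have "\<phi> ?c = \<phi> (\<nu> y)" by (rule conj[OF sc[OF xy(1)] \<nu>N[OF xy(2)]])
    ultimately show ?thesis unfolding E_def \<phi>'_def \<kappa>_def \<nu>_mult[OF xy] by linarith
  qed
  \<comment> \<open>The coboundary of \<kappa>. Up to sign it is that of \<open>E\<close>, since a
    coboundary has no coboundary; four terms of size 2D explain the bound 8D.\<close>
  define d where "d x y z = \<kappa> y z - \<kappa> (x \<otimes> y) z + \<kappa> x (y \<otimes> z) - \<kappa> x y" for x y z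
  have d: "\<bar>d x y z\<bar> \<le> 8 * D" if xyz: "x \<in> carrier G" "y \<in> carrier G" "z \<in> carrier G" for x y z
  proof -
    have "d x y z = - (E y z - E (x \<otimes> y) z + E x (y \<otimes> z) - E x y)"
      using xyz by (simp add: d_def E_def m_assoc)
    then show ?thesis using E[OF xyz(2,3)] E[OF m_closed[OF xyz(1,2)] xyz(3)]
        E[OF xyz(1) m_closed[OF xyz(2,3)]] E[OF xyz(1,2)] by linarith
  qed
  have \<kappa>l: "\<kappa> (n \<otimes> x) y = \<kappa> x y" and \<kappa>r: "\<kappa> x (y \<otimes> n) = \<kappa> x y"
    if "x \<in> carrier G" "y \<in> carrier G" "n \<in> ?N" for x y n
  proof -
    have "n \<otimes> x \<otimes> y = n \<otimes> (x \<otimes> y)" "x \<otimes> (y \<otimes> n) = x \<otimes> y \<otimes> n"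
      using that N.mem_carrier by (simp_all add: m_assoc)
    then show "\<kappa> (n \<otimes> x) y = \<kappa> x y" "\<kappa> x (y \<otimes> n) = \<kappa> x y"
      using that by (simp_all add: \<kappa>_def e_def sl sr)
  qed
  let ?U = "bounded_cls G ?N"
  note U = bounded_cls_subspace[of G ?N]
  have dU: "d x y \<in> ?U" if xy: "x \<in> carrier G" "y \<in> carrier G" for x y
  proof -
    have "d x y (z \<otimes> n) = d x y z" if zn: "z \<in> carrier G" "n \<in> ?N" for z n
    proof -
      have "y \<otimes> (z \<otimes> n) = y \<otimes> z \<otimes> n" using xy zn N.mem_carrier by (simp add: m_assoc)
      then show ?thesis using xy zn by (simp add: d_def \<kappa>r)
    qed
    then show ?thesis using d[OF xy] by (auto simp: bounded_cls_def)
  qed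
  obtain M where M: "inv_mean G ?N M" using nilpotent_quotient_mean by blast
  have Ml: "linear_on ?U M" and Mle: "\<And>f B. f \<in> ?U \<Longrightarrow> \<forall>x\<in>carrier G. f x \<le> B \<Longrightarrow> M f \<le> B"
    and Mt: "\<And>f g. g \<in> carrier G \<Longrightarrow> f \<in> ?U \<Longrightarrow> M (\<lambda>x. f (g \<otimes> x)) = M f"
    using M unfolding inv_mean_def by blast+
  \<comment> \<open>The standard primitive of a bounded cocycle on an amenable group: average over
    the last variable.\<close>
  define \<beta> where "\<beta> x y = M (d x y)" for x y
  have \<beta>: "\<bar>\<beta> x y\<bar> \<le> 8 * D" if xy: "x \<in> carrier G" "y \<in> carrier G" for x y
  proof -
    have "M (d x y) \<le> 8 * D" using d[OF xy] by (intro Mle dU xy) (auto simp: abs_le_iff)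
    moreover have "M (\<lambda>z. - d x y z) \<le> 8 * D"
      using d[OF xy] by (intro Mle fun_subspaceD(4)[OF U] dU xy) (auto simp: abs_le_iff)
    ultimately show ?thesis using linear_onD(3)[OF Ml dU[OF xy]] by (simp add: \<beta>_def)
  qed
  \<comment> \<open>The cocycle identity for \<open>d\<close>, averaged over its fourth variable
    \<open>w\<close>: left invariance turns the mean of \<open>d x y (z \<otimes> w)\<close> into
    \<beta>, and the term free of \<open>w\<close> averages to itself.\<close>
  have \<beta>_coc: "\<beta> y z - \<beta> (x \<otimes> y) z + \<beta> x (y \<otimes> z) - \<beta> x y = - d x y z"
    if xyz: "x \<in> carrier G" "y \<in> carrier G" "z \<in> carrier G" for x y z
  proof -
    have m: "x \<otimes> y \<in> carrier G" "y \<otimes> z \<in> carrier G" using xyz by auto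
    let ?f = "\<lambda>w. (d y z w - d (x \<otimes> y) z w) + d x (y \<otimes> z) w"
    let ?g = "\<lambda>w. d x y (z \<otimes> w) - d x y z"
    have t: "(\<lambda>w. d x y (z \<otimes> w)) \<in> ?U"
      by (rule bounded_cls_translate[OF dU[OF xyz(1,2)] N.subset xyz(3)])
    note f1 = fun_subspaceD(5)[OF U dU[OF xyz(2,3)] dU[OF m(1) xyz(3)]]
    have "M ?f = M ?g"
    proof (rule mean_cong[OF Ml Mle])
      show "?f \<in> ?U" by (rule fun_subspaceD(2)[OF U f1 dU[OF xyz(1) m(2)]])
      show "?g \<in> ?U" by (rule fun_subspaceD(5)[OF U t bounded_cls_const])
      show "?f w = ?g w" if "w \<in> carrier G" for w using xyz that by (simp add: d_def m_assoc)
    qed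
    moreover have "M ?f = (\<beta> y z - \<beta> (x \<otimes> y) z) + \<beta> x (y \<otimes> z)"
      unfolding \<beta>_def linear_onD(1)[OF Ml f1 dU[OF xyz(1) m(2)]]
        linear_on_diff[OF U Ml dU[OF xyz(2,3)] dU[OF m(1) xyz(3)]] ..
    moreover have "M ?g = \<beta> x y - d x y z"
      using linear_on_diff[OF U Ml t bounded_cls_const] Mt[OF xyz(3) dU[OF xyz(1,2)]]
        mean_const[OF Ml Mle, of "d x y z"] by (simp add: \<beta>_def)
    ultimately show ?thesis by simp
  qed
  define \<omega> where "\<omega> x y = \<kappa> x y + \<beta> x y" for x y
  have "\<omega> y z - \<omega> (x \<otimes> y) z + \<omega> x (y \<otimes> z) - \<omega> x y = 0"
    if xyz: "x \<in> carrier G" "y \<in> carrier G" "z \<in> carrier G" for x y z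
    using \<beta>_coc[OF xyz] by (simp add: \<omega>_def d_def)
  from split[of \<omega>, OF this] obtain f where
    f: "\<And>x y. x \<in> carrier G \<Longrightarrow> y \<in> carrier G \<Longrightarrow> f x + f y - f (x \<otimes> y) = \<omega> x y" by blast
  \<comment> \<open>Like \<kappa>, also \<open>d\<close> and hence \<beta> and \<omega> depend only
    on cosets. So \<omega> is constantly \<open>f \<one>\<close> once an argument lies in
    \<open>?N\<close>, and \<open>f\<close> is additive there up to this constant.\<close>
  have dl: "d (n \<otimes> x) y z = d x y z" and dr: "d x (y \<otimes> n) z = d x y z"
    if xyz: "x \<in> carrier G" "y \<in> carrier G" "z \<in> carrier G" and n: "n \<in> ?N" for x y z n
  proof -
    have "n \<otimes> x \<otimes> y = n \<otimes> (x \<otimes> y)" using xyz n N.mem_carrier by (simp add: m_assoc)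
    then show "d (n \<otimes> x) y z = d x y z" using xyz n by (simp add: d_def \<kappa>l)
    let ?m = "inv z \<otimes> n \<otimes> z" and ?l = "y \<otimes> n \<otimes> inv y" and ?k = "x \<otimes> y \<otimes> n \<otimes> inv (x \<otimes> y)"
    have nc: "n \<in> carrier G" using n by simp
    have e: "y \<otimes> n = ?l \<otimes> y" "x \<otimes> (y \<otimes> n) = ?k \<otimes> (x \<otimes> y)" "y \<otimes> n \<otimes> z = (y \<otimes> z) \<otimes> ?m"
      using xyz nc by (simp_all add: group_word_simps)
    have mem: "?m \<in> ?N" "?l \<in> ?N" "?k \<in> ?N"
      by (rule conj_mem'[OF N xyz(3) n], rule conj_mem[OF N xyz(2) n],
          rule conj_mem[OF N m_closed[OF xyz(1,2)] n])
    have "\<kappa> (y \<otimes> n) z = \<kappa> y z" "\<kappa> (x \<otimes> (y \<otimes> n)) z = \<kappa> (x \<otimes> y) z"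
      "\<kappa> x (y \<otimes> n \<otimes> z) = \<kappa> x (y \<otimes> z)"
      unfolding e(2,3) by (subst e(1))
        (rule \<kappa>l[OF xyz(2,3) mem(2)] \<kappa>l[OF m_closed[OF xyz(1,2)] xyz(3) mem(3)] \<kappa>r[OF xyz(1) m_closed[OF xyz(2,3)] mem(1)])+
    then show "d x (y \<otimes> n) z = d x y z" using xyz n by (simp add: d_def \<kappa>r)
  qed
  have \<beta>l: "\<beta> (n \<otimes> x) y = \<beta> x y" and \<beta>r: "\<beta> x (y \<otimes> n) = \<beta> x y"
    if xy: "x \<in> carrier G" "y \<in> carrier G" and n: "n \<in> ?N" for x y n
  proof -
    have c: "n \<otimes> x \<in> carrier G" "y \<otimes> n \<in> carrier G" using xy n by auto
    show "\<beta> (n \<otimes> x) y = \<beta> x y" unfolding \<beta>_def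
      by (rule mean_cong[OF Ml Mle dU[OF c(1) xy(2)] dU[OF xy]]) (assumption | rule dl[OF xy _ n])+
    show "\<beta> x (y \<otimes> n) = \<beta> x y" unfolding \<beta>_def
      by (rule mean_cong[OF Ml Mle dU[OF xy(1) c(2)] dU[OF xy]]) (assumption | rule dr[OF xy _ n])+
  qed
  have \<omega>1: "\<omega> \<one> x = f \<one>" "\<omega> x \<one> = f \<one>" if x: "x \<in> carrier G" for x
    using f[OF one_closed x] f[OF x one_closed] x by simp_all
  have fl: "f (n \<otimes> x) = f n + f x - f \<one>" and fr: "f (x \<otimes> n) = f x + f n - f \<one>"
    if x: "x \<in> carrier G" and n: "n \<in> ?N" for x n
  proof -
    have nc: "n \<in> carrier G" using n by simp
    have "\<omega> n x = \<omega> \<one> x" "\<omega> x n = \<omega> x \<one>"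
      using \<kappa>l[OF one_closed x n] \<kappa>r[OF x one_closed n] \<beta>l[OF one_closed x n] \<beta>r[OF x one_closed n] nc
      by (simp_all add: \<omega>_def)
    then show "f (n \<otimes> x) = f n + f x - f \<one>" "f (x \<otimes> n) = f x + f n - f \<one>"
      using f[OF nc x] f[OF x nc] \<omega>1[OF x] by simp_all
  qed
  \<comment> \<open>The shift by \<open>f \<one>\<close> makes it a homomorphism; the sign is chosen
    so that \<phi> + f, which will be close to \<psi>, equals \<phi> - a up to a constant on
    \<open>?N\<close>.\<close>
  define a where "a x = (if x \<in> ?N then f \<one> - f x else 0)" for x
  have a: "a \<in> H1_inv G ?N"
    unfolding H1_inv_def
  proof (intro CollectI conjI allI ballI impI)
    show "a x = 0" if "x \<notin> ?N" for x using that by (simp add: a_def)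
    show "a (x \<otimes> y) = a x + a y" if "x \<in> ?N" "y \<in> ?N" for x y
      using that fl[of y x] normal_mult_mem[OF N that] by (simp add: a_def)
    show "a (g \<otimes> x \<otimes> inv g) = a x" if g: "g \<in> carrier G" and x: "x \<in> ?N" for g x
    proof -
      have m: "g \<otimes> x \<otimes> inv g \<in> ?N" by (rule conj_mem[OF N g x])
      have "(g \<otimes> x \<otimes> inv g) \<otimes> g = g \<otimes> x" using g x by (simp add: group_word_simps)
      then have "f (g \<otimes> x \<otimes> inv g) = f x" using fl[OF g m] fr[OF g x] by simp
      then show ?thesis using m x by (simp add: a_def)
    qed
  qed
  \<comment> \<open>2D from \<open>E\<close> and 8D from \<beta>; the unbounded \<kappa> has
    cancelled against the coboundary of \<open>f\<close>.\<close>
  have "quasi_add G (carrier G) (\<lambda>x. \<phi>' x + f x) (10 * D)"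
    unfolding quasi_add_def
  proof safe
    fix x y assume xy: "x \<in> carrier G" "y \<in> carrier G"
    have "\<phi>' (x \<otimes> y) + f (x \<otimes> y) - (\<phi>' x + f x) - (\<phi>' y + f y) = E x y - \<beta> x y"
      using f[OF xy] by (simp add: E_def \<omega>_def)
    then show "\<bar>\<phi>' (x \<otimes> y) + f (x \<otimes> y) - (\<phi>' x + f x) - (\<phi>' y + f y)\<bar> \<le> 10 * D"
      using E[OF xy] \<beta>[OF xy] by linarith
  qed
  then obtain \<psi> where \<psi>: "hom_qm G (carrier G) \<psi>"
    "\<And>x. x \<in> carrier G \<Longrightarrow> \<bar>\<psi> x - (\<phi>' x + f x)\<bar> \<le> 10 * D"
    using homogenization by blast
  \<comment> \<open>Both sides are homogeneous on \<open>?N\<close>, so bounded distance suffices: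
    10D from homogenization, and D with two constants for removing the representative of the trivial
    coset and \<open>f \<one>\<close>.\<close>
  have "\<psi> x - (\<phi> x - a x) = 0" if x: "x \<in> ?N" for x
  proof (rule doubling_zero[where S="?N" and g="\<lambda>x. \<psi> x - (\<phi> x - a x)"])
    fix x assume x: "x \<in> ?N"
    have xc: "x \<in> carrier G" using x by simp
    have s1: "s x = s \<one>" using sl[OF one_closed x] xc by simp
    have "inv (s \<one>) \<in> ?N" using \<nu>N[OF one_closed] sc[OF one_closed] by (simp add: \<nu>_def)
    then have "\<bar>\<phi>' x - \<phi> x - \<phi> (inv (s \<one>))\<bar> \<le> D"
      using quasi_addD[OF q x] by (simp add: \<phi>'_def \<nu>_def s1)
    moreover have "a x = f \<one> - f x" using x by (simp add: a_def)
    ultimately show "\<bar>\<psi> x - (\<phi> x - a x)\<bar> \<le> 11 * D + \<bar>\<phi> (inv (s \<one>))\<bar> + \<bar>f \<one>\<bar>"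
      using \<psi>(2)[OF xc] by linarith
    have "a (x \<otimes> x) = 2 * a x" using a x unfolding H1_inv_def by auto
    then show "\<exists>t\<in>?N. \<psi> t - (\<phi> t - a t) = 2 * (\<psi> x - (\<phi> x - a x))"
      using hom_qm_square[OF \<psi>(1) xc order_refl] hom_qm_square[OF qm x N.subset] normal_mult_mem[OF N x x]
      by (intro bexI[of _ "x \<otimes> x"]) auto
  qed (rule x)
  then show ?thesis using a \<psi>(1) by (intro bexI[of _ a] exI[of _ \<psi>]) auto
qed

end

section \<open>Bar chains\<close>

definition single :: "'i \<Rightarrow> 'i \<Rightarrow> 'c::comm_ring_1" where
  "single p q = (if p = q then 1 else 0)"

lemma sum_supp_superset:
  fixes c :: "'i \<Rightarrow> 'c::comm_ring_1"
  assumes "finite S" "{p. c p \<noteq> 0} \<subseteq> S" "\<And>p. c p = 0 \<Longrightarrow> F p = 0"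
  shows "(\<Sum>p\<in>{p. c p \<noteq> 0}. F p) = (\<Sum>p\<in>S. F p :: 'd::comm_monoid_add)"
  using assms by (intro sum.mono_neutral_left) auto

lemma sum_single:
  fixes v :: "'i \<Rightarrow> 'c::comm_ring_1"
  assumes "finite H" "a \<in> H"
  shows "(\<Sum>h\<in>H. (if a = h then k else 0) * v h) = k * v a"
proof -
  have "(\<Sum>h\<in>H. (if a = h then k else 0) * v h) = (\<Sum>h\<in>H. if a = h then k * v h else 0)"
    by (intro sum.cong) auto
  then show ?thesis using assms by simp
qed

context group
begin

lemma chain2_closed:
  fixes c d :: "'a \<times> 'a \<Rightarrow> 'c::comm_ring_1"
  assumes "chain2 G c" "chain2 G d"
  shows "chain2 G (\<lambda>p. k * c p + l * d p)"
proof -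
  have "{p. k * c p + l * d p \<noteq> 0} \<subseteq> {p. c p \<noteq> 0} \<union> {p. d p \<noteq> 0}" by auto
  then show ?thesis using assms unfolding chain2_def by (auto intro: finite_subset)
qed

lemma chain3_closed:
  fixes b b' :: "'a \<times> 'a \<times> 'a \<Rightarrow> 'c::comm_ring_1"
  assumes "chain3 G b" "chain3 G b'"
  shows "chain3 G (\<lambda>p. k * b p + l * b' p)"
proof -
  have "{p. k * b p + l * b' p \<noteq> 0} \<subseteq> {p. b p \<noteq> 0} \<union> {p. b' p \<noteq> 0}" by auto
  then have "finite {p. k * b p + l * b' p \<noteq> 0}"
    using assms unfolding chain3_def by (meson finite_UnI finite_subset)
  moreover have "a1 \<in> carrier G \<and> a2 \<in> carrier G \<and> a3 \<in> carrier G"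
    if "k * b (a1, a2, a3) + l * b' (a1, a2, a3) \<noteq> 0" for a1 a2 a3
  proof -
    have "b (a1, a2, a3) \<noteq> 0 \<or> b' (a1, a2, a3) \<noteq> 0" using that by auto
    then show ?thesis using assms unfolding chain3_def by blast
  qed
  ultimately show ?thesis unfolding chain3_def by blast
qed

lemma bar_d2_superset:
  fixes c :: "'a \<times> 'a \<Rightarrow> 'c::comm_ring_1"
  assumes "finite S" "{p. c p \<noteq> 0} \<subseteq> S"
  shows "bar_d2 G c h = (\<Sum>p\<in>S. c p * (single (snd p) h - single (fst p \<otimes> snd p) h + single (fst p) h))"
  unfolding bar_d2_def
  by (subst sum_supp_superset[OF assms]) (auto simp: single_def intro!: sum.cong)

lemma bar_d2_linear:
  fixes c d :: "'a \<times> 'a \<Rightarrow> 'c::comm_ring_1"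
  assumes "chain2 G c" "chain2 G d"
  shows "bar_d2 G (\<lambda>p. k * c p + l * d p) h = k * bar_d2 G c h + l * bar_d2 G d h"
proof -
  let ?S = "{p. c p \<noteq> 0} \<union> {p. d p \<noteq> 0}"
  have S: "finite ?S" using assms by (simp add: chain2_def)
  show ?thesis
    by (subst (1 2 3) bar_d2_superset[OF S]) (auto simp: sum_distrib_left sum.distrib[symmetric] algebra_simps intro!: sum.cong)
qed

lemma cycle2_linear:
  fixes c d :: "'a \<times> 'a \<Rightarrow> 'c::comm_ring_1"
  assumes "cycle2 G c" "cycle2 G d"
  shows "cycle2 G (\<lambda>p. k * c p + l * d p)"
  using assms chain2_closed[of c d k l] bar_d2_linear[of c d k l] by (simp add: cycle2_def)

text \<open>Summation by parts: pairing with the coboundary of \<open>u\<close> equals pairing the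
  boundary, here 0, with \<open>u\<close>.\<close>

lemma cycle2_pairing:
  fixes c :: "'a \<times> 'a \<Rightarrow> 'c::comm_ring_1"
  assumes "cycle2 G c"
  shows "(\<Sum>p\<in>{p. c p \<noteq> 0}. c p * (u (fst p) + u (snd p) - u (fst p \<otimes> snd p))) = 0"
proof -
  let ?S = "{p. c p \<noteq> 0}"
  have S: "finite ?S" using assms by (simp add: cycle2_def chain2_def)
  let ?H = "fst ` ?S \<union> snd ` ?S \<union> (\<lambda>p. fst p \<otimes> snd p) ` ?S"
  have H: "finite ?H" using S by simp
  have pt: "(\<Sum>h\<in>?H. single a h * u h) = u a" if "a \<in> ?H" for a
    unfolding single_def using sum_single[OF H that, of 1 u] by simp
  have "0 = (\<Sum>h\<in>?H. bar_d2 G c h * u h)" using assms by (simp add: cycle2_def)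
  also have "\<dots> = (\<Sum>h\<in>?H. \<Sum>p\<in>?S. c p * ((single (snd p) h - single (fst p \<otimes> snd p) h + single (fst p) h) * u h))"
    by (simp add: bar_d2_superset[OF S order_refl] sum_distrib_right mult.assoc)
  also have "\<dots> = (\<Sum>p\<in>?S. c p * (\<Sum>h\<in>?H. (single (snd p) h - single (fst p \<otimes> snd p) h + single (fst p) h) * u h))"
    by (subst sum.swap) (simp add: sum_distrib_left)
  also have "\<dots> = (\<Sum>p\<in>?S. c p * (u (fst p) + u (snd p) - u (fst p \<otimes> snd p)))"
  proof (rule sum.cong[OF refl])
    fix p assume p: "p \<in> ?S"
    then have "fst p \<in> ?H" "snd p \<in> ?H" "fst p \<otimes> snd p \<in> ?H" by auto
    then have eq: "(\<Sum>h\<in>?H. (single (snd p) h - single (fst p \<otimes> snd p) h + single (fst p) h) * u h) =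
        u (snd p) - u (fst p \<otimes> snd p) + u (fst p)"
      using pt by (simp add: distrib_right left_diff_distrib sum.distrib sum_subtractf)
    show "c p * (\<Sum>h\<in>?H. (single (snd p) h - single (fst p \<otimes> snd p) h + single (fst p) h) * u h) =
        c p * (u (fst p) + u (snd p) - u (fst p \<otimes> snd p))" unfolding eq by (simp add: algebra_simps)
  qed
  finally show ?thesis by simp
qed

lemma bar_d3_superset:
  fixes b :: "'a \<times> 'a \<times> 'a \<Rightarrow> 'c::comm_ring_1"
  assumes "finite S" "{t. b t \<noteq> 0} \<subseteq> S"
  shows "bar_d3 G b g = (\<Sum>(x, y, z)\<in>S. b (x, y, z) *
    (single (y, z) g - single (x \<otimes> y, z) g + single (x, y \<otimes> z) g - single (x, y) g))"
  unfolding bar_d3_def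
  by (subst sum_supp_superset[OF assms]) (auto simp: single_def intro!: sum.cong split: prod.split)

lemma bar_d3_linear:
  fixes b b' :: "'a \<times> 'a \<times> 'a \<Rightarrow> 'c::comm_ring_1"
  assumes "chain3 G b" "chain3 G b'"
  shows "bar_d3 G (\<lambda>p. k * b p + l * b' p) g = k * bar_d3 G b g + l * bar_d3 G b' g"
proof -
  let ?S = "{p. b p \<noteq> 0} \<union> {p. b' p \<noteq> 0}"
  have S: "finite ?S" using assms by (simp add: chain3_def)
  show ?thesis
    by (subst (1 2 3) bar_d3_superset[OF S])
      (auto simp: sum_distrib_left sum.distrib[symmetric] algebra_simps intro!: sum.cong split: prod.split)
qed

lemma boundary2_linear:
  fixes c d :: "'a \<times> 'a \<Rightarrow> 'c::comm_ring_1"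
  assumes "boundary2 G c" "boundary2 G d"
  shows "boundary2 G (\<lambda>p. k * c p + l * d p)"
proof -
  obtain b b' where b: "chain3 G b" "c = bar_d3 G b" "chain3 G b'" "d = bar_d3 G b'"
    using assms by (auto simp: boundary2_def)
  have "(\<lambda>p. k * c p + l * d p) = bar_d3 G (\<lambda>t. k * b t + l * b' t)"
    using bar_d3_linear[OF b(1,3), of k l] b by auto
  then show ?thesis using chain3_closed[OF b(1,3), of k l] unfolding boundary2_def by blast
qed

lemma boundary2_single:
  assumes "x \<in> carrier G" "y \<in> carrier G" "z \<in> carrier G"
  shows "boundary2 G (\<lambda>g. single (y, z) g - single (x \<otimes> y, z) g + single (x, y \<otimes> z) g - single (x, y) g :: 'c::comm_ring_1)"
proof -
  let ?b = "single (x, y, z) :: 'a \<times> 'a \<times> 'a \<Rightarrow> 'c"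
  have supp: "{t. ?b t \<noteq> 0} \<subseteq> {(x, y, z)}" by (auto simp: single_def)
  have "chain3 G ?b" using assms finite_subset[OF supp] by (auto simp: chain3_def single_def split: if_splits)
  moreover have "(\<lambda>g. single (y, z) g - single (x \<otimes> y, z) g + single (x, y \<otimes> z) g - single (x, y) g) = bar_d3 G ?b"
    by (rule ext) (simp add: bar_d3_superset[OF _ supp] single_def)
  ultimately show ?thesis unfolding boundary2_def by blast
qed

lemma boundary2_zero: "boundary2 G (\<lambda>_. 0 :: 'c::comm_ring_1)"
proof -
  have "boundary2 G (\<lambda>g. single (\<one>, \<one>) g - single (\<one> \<otimes> \<one>, \<one>) g + single (\<one>, \<one> \<otimes> \<one>) g - single (\<one>, \<one>) g :: 'c)"
    by (rule boundary2_single) auto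
  then show ?thesis by simp
qed

lemma boundary2_cycle2:
  fixes c :: "'a \<times> 'a \<Rightarrow> 'c::comm_ring_1"
  assumes "boundary2 G c" shows "cycle2 G c"
proof -
  obtain b where b: "chain3 G b" "c = bar_d3 G b" using assms by (auto simp: boundary2_def)
  let ?S = "{t. b t \<noteq> 0}"
  have S: "finite ?S" using b by (simp add: chain3_def)
  have Sc: "x \<in> carrier G" "y \<in> carrier G" "z \<in> carrier G" if "(x, y, z) \<in> ?S" for x y z
    using b that by (auto simp: chain3_def)
  let ?P = "(\<lambda>(x, y, z). (y, z)) ` ?S \<union> (\<lambda>(x, y, z). (x \<otimes> y, z)) ` ?S \<union> (\<lambda>(x, y, z). (x, y \<otimes> z)) ` ?S
    \<union> (\<lambda>(x, y, z). (x, y)) ` ?S"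
  have P: "finite ?P" using S by simp
  have supp: "{p. c p \<noteq> 0} \<subseteq> ?P"
  proof
    fix p assume "p \<in> {p. c p \<noteq> 0}"
    then have "\<exists>t\<in>?S. (case t of (x, y, z) \<Rightarrow> b (x, y, z) *
        (single (y, z) p - single (x \<otimes> y, z) p + single (x, y \<otimes> z) p - single (x, y) p)) \<noteq> 0"
      unfolding b(2) bar_d3_superset[OF S order_refl] using sum.not_neutral_contains_not_neutral by blast
    then obtain x y z where t: "(x, y, z) \<in> ?S" "b (x, y, z) *
        (single (y, z) p - single (x \<otimes> y, z) p + single (x, y \<otimes> z) p - single (x, y) p) \<noteq> 0" by auto
    have "p = (y, z) \<or> p = (x \<otimes> y, z) \<or> p = (x, y \<otimes> z) \<or> p = (x, y)"
    proof (rule ccontr)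
      assume "\<not> ?thesis"
      then show False using t(2) by (auto simp: single_def)
    qed
    then show "p \<in> ?P" using t(1) by force
  qed
  have ch: "chain2 G c"
    unfolding chain2_def
  proof (intro conjI allI impI)
    show "finite {p. c p \<noteq> 0}" by (rule finite_subset[OF supp P])
    fix p assume "c p \<noteq> 0"
    then have "p \<in> ?P" using supp by blast
    then show "fst p \<in> carrier G" "snd p \<in> carrier G" using Sc by auto
  qed
  have "bar_d2 G c h = 0" for h
  proof -
    let ?v = "\<lambda>p. single (snd p) h - single (fst p \<otimes> snd p) h + single (fst p) h :: 'c"
    have pt: "(\<Sum>p\<in>?P. single a p * ?v p) = ?v a" if "a \<in> ?P" for a
      unfolding single_def[of a] using sum_single[OF P that, of 1 ?v] by simp
    let ?d = "\<lambda>t p. (case t of (x, y, z) \<Rightarrow> single (y, z) p - single (x \<otimes> y, z) p + single (x, y \<otimes> z) p - single (x, y) p) :: 'c"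
    have cp: "c p = (\<Sum>t\<in>?S. b t * ?d t p)" for p
      unfolding b(2) bar_d3_superset[OF S order_refl] by (intro sum.cong) auto
    have "bar_d2 G c h = (\<Sum>p\<in>?P. c p * ?v p)" by (rule bar_d2_superset[OF P supp])
    also have "\<dots> = (\<Sum>p\<in>?P. \<Sum>t\<in>?S. b t * (?d t p * ?v p))"
      by (simp add: cp sum_distrib_right mult.assoc)
    also have "\<dots> = (\<Sum>t\<in>?S. b t * (\<Sum>p\<in>?P. ?d t p * ?v p))"
      by (subst sum.swap) (simp add: sum_distrib_left)
    also have "\<dots> = 0"
    proof (rule sum.neutral, rule ballI)
      fix t assume t: "t \<in> ?S"
      obtain x y z where xyz: "t = (x, y, z)" by (cases t)
      have m: "(y, z) \<in> ?P" "(x \<otimes> y, z) \<in> ?P" "(x, y \<otimes> z) \<in> ?P" "(x, y) \<in> ?P"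
        using t unfolding xyz by force+
      have "(\<Sum>p\<in>?P. ?d t p * ?v p) = ?v (y, z) - ?v (x \<otimes> y, z) + ?v (x, y \<otimes> z) - ?v (x, y)"
        unfolding xyz prod.case left_diff_distrib[of _ _ "?v _"] distrib_right[of _ _ "?v _"] sum_subtractf sum.distrib
          pt[OF m(1)] pt[OF m(2)] pt[OF m(3)] pt[OF m(4)] ..
      also have "\<dots> = 0" using Sc t unfolding xyz by (simp add: m_assoc)
      finally show "b t * (\<Sum>p\<in>?P. ?d t p * ?v p) = 0" by simp
    qed
    finally show ?thesis .
  qed
  then show ?thesis using ch by (simp add: cycle2_def)
qed

lemma cycle2_of_int:
  assumes "cycle2 G z" shows "cycle2 G (\<lambda>p. real_of_int (z p))"
proof -
  have S: "finite {p. z p \<noteq> 0}" using assms by (simp add: cycle2_def chain2_def)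
  have "bar_d2 G (\<lambda>p. real_of_int (z p)) h = real_of_int (bar_d2 G z h)" for h
    unfolding bar_d2_superset[OF S order_refl]
    by (subst bar_d2_superset[OF S]) (auto simp: single_def intro!: sum.cong)
  then show ?thesis using assms by (simp add: cycle2_def chain2_def)
qed

lemma l1_norm_superset: "finite S \<Longrightarrow> {p. c p \<noteq> 0} \<subseteq> S \<Longrightarrow> l1_norm c = (\<Sum>p\<in>S. \<bar>c p\<bar>)"
  unfolding l1_norm_def by (rule sum_supp_superset) auto

text \<open>Chains are finite combinations of basis elements, so an abstract Hahn-Banach functional
  is integration against a cochain.\<close>

lemma chain2_pairing:
  assumes m: "linear_on {c. chain2 G c} m" and c: "chain2 G c"
  shows "m c = (\<Sum>p\<in>{p. c p \<noteq> 0}. c p * m (single p))"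
proof -
  have V0: "chain2 G (\<lambda>_. 0::real)" by (simp add: chain2_def)
  have ch: "chain2 G (single p :: _ \<Rightarrow> real)" if "c p \<noteq> 0" for p
  proof -
    have "{q. single p q \<noteq> (0::real)} = {p}" by (auto simp: single_def)
    then show ?thesis using c that by (auto simp: chain2_def single_def split: if_splits)
  qed
  have main: "finite S \<Longrightarrow> S \<subseteq> {p. c p \<noteq> 0} \<Longrightarrow> chain2 G (\<lambda>q. \<Sum>p\<in>S. c p * single p q) \<and>
      m (\<lambda>q. \<Sum>p\<in>S. c p * single p q) = (\<Sum>p\<in>S. c p * m (single p))" for S
  proof (induction S rule: finite_induct)
    case empty
    have "m (\<lambda>q. 0 * 0) = 0 * m (\<lambda>_. 0)" by (rule linear_onD(2)[OF m]) (simp add: V0)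
    then show ?case using V0 by simp
  next
    case (insert p S)
    then have p: "chain2 G (single p :: _ \<Rightarrow> real)" and IH: "chain2 G (\<lambda>q. \<Sum>p\<in>S. c p * single p q)"
      "m (\<lambda>q. \<Sum>p\<in>S. c p * single p q) = (\<Sum>p\<in>S. c p * m (single p))" using ch by auto
    have cp: "chain2 G (\<lambda>q. c p * single p q)" using chain2_closed[OF p V0, of "c p" 0] by simp
    have eq: "(\<lambda>q. \<Sum>p\<in>insert p S. c p * single p q) = (\<lambda>q. c p * single p q + (\<Sum>p\<in>S. c p * single p q))"
      using insert.hyps by auto
    have "m (\<lambda>q. c p * single p q + (\<Sum>p\<in>S. c p * single p q)) = m (\<lambda>q. c p * single p q) + m (\<lambda>q. \<Sum>p\<in>S. c p * single p q)"
      by (rule linear_onD(1)[OF m]) (use cp IH in auto)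
    moreover have "m (\<lambda>q. c p * single p q) = c p * m (single p)"
      using linear_onD(2)[OF m, of "single p" "c p"] p by simp
    ultimately show ?case unfolding eq
      using chain2_closed[OF cp IH(1), of 1 1] IH(2) insert.hyps by simp
  qed
  have eq: "(\<lambda>q. \<Sum>p\<in>{p. c p \<noteq> 0}. c p * single p q) = c"
  proof
    fix q
    have "(\<Sum>p\<in>{p. c p \<noteq> 0}. c p * single p q) = (\<Sum>p\<in>{p. c p \<noteq> 0}. if p = q then c p else 0)"
      by (intro sum.cong) (auto simp: single_def)
    then show "(\<Sum>p\<in>{p. c p \<noteq> 0}. c p * single p q) = c q" using c by (simp add: chain2_def)
  qed
  have "finite {p. c p \<noteq> 0}" using c by (simp add: chain2_def)
  from main[OF this order_refl] show ?thesis unfolding eq by (rule conjunct2)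
qed

text \<open>The infimum over \<open>z\<close> plus boundaries is the seminorm itself, so Hahn-Banach
  gives a functional below the norm, zero on boundaries, with this nonzero value at
  \<open>z\<close>. Evaluated on basis elements it is bounded by 1 because their norm is 1, and a
  cocycle because it kills boundaries.\<close>

lemma bounded_cocycle_of_seminorm:
  assumes z: "cycle2 G z" and nz: "l1_seminorm_H2 G z \<noteq> 0"
  obtains \<omega> :: "'a \<Rightarrow> 'a \<Rightarrow> real" where
    "\<And>x y. x \<in> carrier G \<Longrightarrow> y \<in> carrier G \<Longrightarrow> \<bar>\<omega> x y\<bar> \<le> 1"
    "\<And>x y z. x \<in> carrier G \<Longrightarrow> y \<in> carrier G \<Longrightarrow> z \<in> carrier G \<Longrightarrow>
      \<omega> y z - \<omega> (x \<otimes> y) z + \<omega> x (y \<otimes> z) - \<omega> x y = 0"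
    "(\<Sum>p\<in>{p. z p \<noteq> 0}. real_of_int (z p) * \<omega> (fst p) (snd p)) \<noteq> 0"
proof -
  let ?V = "{c :: 'a \<times> 'a \<Rightarrow> real. chain2 G c}" and ?W = "{c :: 'a \<times> 'a \<Rightarrow> real. boundary2 G c}"
  let ?z = "\<lambda>p. real_of_int (z p)"
  have V0: "chain2 G (\<lambda>_. 0::real)" by (simp add: chain2_def)
  have Vadd: "chain2 G (\<lambda>x. f x + g x)" if "chain2 G f" "chain2 G g" for f g :: "'a \<times> 'a \<Rightarrow> real"
    using chain2_closed[OF that, of 1 1] by simp
  have Vs: "chain2 G (\<lambda>x. c * f x)" if "chain2 G f" for f :: "'a \<times> 'a \<Rightarrow> real" and c
    using chain2_closed[OF that V0, of c 0] by simp
  have V: "fun_subspace ?V" unfolding fun_subspace_def using V0 Vadd Vs by auto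
  have Wadd: "boundary2 G (\<lambda>x. f x + g x)" if "boundary2 G f" "boundary2 G g" for f g :: "'a \<times> 'a \<Rightarrow> real"
    using boundary2_linear[OF that, of 1 1] by simp
  have Ws: "boundary2 G (\<lambda>x. c * f x)" if "boundary2 G f" for f :: "'a \<times> 'a \<Rightarrow> real" and c
    using boundary2_linear[OF that boundary2_zero, of c 0] by simp
  have W: "fun_subspace ?W" unfolding fun_subspace_def using boundary2_zero Wadd Ws by auto
  have WV: "?W \<subseteq> ?V" using boundary2_cycle2 by (auto simp: cycle2_def)
  have fin: "finite {p. f p \<noteq> 0}" if "chain2 G f" for f :: "'a \<times> 'a \<Rightarrow> real" using that by (simp add: chain2_def)
  have p: "sublinear_on ?V l1_norm" unfolding sublinear_on_def
  proof safe
    fix f g :: "'a \<times> 'a \<Rightarrow> real" assume "chain2 G f" "chain2 G g"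
    then have S: "finite ({p. f p \<noteq> 0} \<union> {p. g p \<noteq> 0})" using fin by simp
    have "l1_norm (\<lambda>x. f x + g x) = (\<Sum>p\<in>{p. f p \<noteq> 0} \<union> {p. g p \<noteq> 0}. \<bar>f p + g p\<bar>)"
      by (rule l1_norm_superset[OF S]) auto
    also have "\<dots> \<le> (\<Sum>p\<in>{p. f p \<noteq> 0} \<union> {p. g p \<noteq> 0}. \<bar>f p\<bar> + \<bar>g p\<bar>)" by (intro sum_mono) simp
    also have "\<dots> = l1_norm f + l1_norm g"
      unfolding sum.distrib by (subst (1 2) l1_norm_superset[OF S]) auto
    finally show "l1_norm (\<lambda>x. f x + g x) \<le> l1_norm f + l1_norm g" .
  next
    fix c :: real and f :: "'a \<times> 'a \<Rightarrow> real" assume c: "0 \<le> c" and f: "chain2 G f"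
    have "l1_norm (\<lambda>x. c * f x) = (\<Sum>p\<in>{p. f p \<noteq> 0}. \<bar>c * f p\<bar>)"
      by (rule l1_norm_superset[OF fin[OF f]]) auto
    then show "l1_norm (\<lambda>x. c * f x) = c * l1_norm f"
      using c by (simp add: l1_norm_def sum_distrib_left abs_mult)
  qed
  have pos: "0 \<le> l1_norm c" for c :: "'a \<times> 'a \<Rightarrow> real" by (simp add: l1_norm_def sum_nonneg)
  have zc: "cycle2 G ?z" by (rule cycle2_of_int[OF z])
  obtain m where m: "linear_on ?V m" "\<And>f. f \<in> ?V \<Longrightarrow> m f \<le> l1_norm f" "\<And>w. w \<in> ?W \<Longrightarrow> m w = 0"
    "m ?z = (INF w\<in>?W. l1_norm (\<lambda>x. ?z x + w x))"
    using hahn_banach_quotient[OF V p W WV pos, of ?z] zc by (auto simp: cycle2_def)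
  have "{l1_norm c | c. cycle2 G c \<and> boundary2 G (\<lambda>p. c p - ?z p)} = (\<lambda>w. l1_norm (\<lambda>x. ?z x + w x)) ` ?W"
  proof (intro equalityI subsetI)
    fix t assume "t \<in> {l1_norm c | c. cycle2 G c \<and> boundary2 G (\<lambda>p. c p - ?z p)}"
    then obtain c where c: "t = l1_norm c" "boundary2 G (\<lambda>p. c p - ?z p)" by blast
    then show "t \<in> (\<lambda>w. l1_norm (\<lambda>x. ?z x + w x)) ` ?W"
      by (intro image_eqI[of _ _ "\<lambda>p. c p - ?z p"]) simp_all
  next
    fix t assume "t \<in> (\<lambda>w. l1_norm (\<lambda>x. ?z x + w x)) ` ?W"
    then obtain w where w: "t = l1_norm (\<lambda>x. ?z x + w x)" "boundary2 G w" by blast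
    have "cycle2 G (\<lambda>x. ?z x + w x)" using cycle2_linear[OF zc boundary2_cycle2[OF w(2)], of 1 1] by simp
    then show "t \<in> {l1_norm c | c. cycle2 G c \<and> boundary2 G (\<lambda>p. c p - ?z p)}" using w by auto
  qed
  then have mz: "m ?z \<noteq> 0" using nz m(4) by (simp add: l1_seminorm_H2_def)
  have single_norm: "chain2 G (single (x, y) :: _ \<Rightarrow> real)" "l1_norm (single (x, y)) = 1"
    if "x \<in> carrier G" "y \<in> carrier G" for x y
  proof -
    have "{q. single (x, y) q \<noteq> (0::real)} = {(x, y)}" by (auto simp: single_def)
    then show "chain2 G (single (x, y) :: _ \<Rightarrow> real)" "l1_norm (single (x, y)) = 1"
      using that by (auto simp: chain2_def l1_norm_def single_def split: if_splits)
  qed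
  show ?thesis
  proof (rule that[of "\<lambda>x y. m (single (x, y))"])
    fix x y assume xy: "x \<in> carrier G" "y \<in> carrier G"
    note s = single_norm[OF xy]
    have "l1_norm (\<lambda>q. - single (x, y) q) = 1" using s(2) by (simp add: l1_norm_def)
    then have "m (\<lambda>q. - single (x, y) q) \<le> 1" using m(2)[OF fun_subspaceD(4)[OF V, of "single (x, y)"]] s by simp
    then show "\<bar>m (single (x, y))\<bar> \<le> 1"
      using m(2)[of "single (x, y)"] s linear_onD(3)[OF m(1), of "single (x, y)"] by auto
  next
    fix x y z assume xyz: "x \<in> carrier G" "y \<in> carrier G" "z \<in> carrier G"
    have c: "single (y, z) \<in> ?V" "single (x \<otimes> y, z) \<in> ?V" "single (x, y \<otimes> z) \<in> ?V" "single (x, y) \<in> ?V"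
      using single_norm(1) xyz by auto
    note d = fun_subspaceD(5)[OF V c(1,2)]
    note e = fun_subspaceD(2)[OF V d c(3)]
    have "m (\<lambda>g. single (y, z) g - single (x \<otimes> y, z) g + single (x, y \<otimes> z) g - single (x, y) g) = 0"
      by (rule m(3)) (use boundary2_single[OF xyz] in simp)
    then show "m (single (y, z)) - m (single (x \<otimes> y, z)) + m (single (x, y \<otimes> z)) - m (single (x, y)) = 0"
      unfolding linear_on_diff[OF V m(1) e c(4)] linear_onD(1)[OF m(1) d c(3)] linear_on_diff[OF V m(1) c(1,2)] .
  next
    have "m ?z = (\<Sum>p\<in>{p. ?z p \<noteq> 0}. ?z p * m (single p))"
      by (rule chain2_pairing[OF m(1)]) (use zc in \<open>simp add: cycle2_def\<close>)
    then show "(\<Sum>p\<in>{p. z p \<noteq> 0}. real_of_int (z p) * m (single (fst p, snd p))) \<noteq> 0" using mz by simp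
  qed
qed

end

section \<open>One-relator groups\<close>

lemma int_subgroup_principal:
  fixes I :: "int set"
  assumes 0: "0 \<in> I" and diff: "\<And>a b. a \<in> I \<Longrightarrow> b \<in> I \<Longrightarrow> a - b \<in> I"
  obtains d where "d \<in> I" "\<And>k. k \<in> I \<Longrightarrow> d dvd k"
proof (cases "I = {0}")
  case True then show ?thesis using that by auto
next
  case False
  have neg: "- a \<in> I" if "a \<in> I" for a using diff[OF 0 that] by simp
  have add: "a + b \<in> I" if "a \<in> I" "b \<in> I" for a b using diff[OF that(1) neg[OF that(2)]] by simp
  obtain a where "a \<in> I" "a \<noteq> 0" using False 0 by blast
  then have "\<exists>m::nat. 0 < m \<and> int m \<in> I" using neg[of a] by (intro exI[of _ "nat \<bar>a\<bar>"]) (auto simp: abs_if)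
  then obtain m :: nat where m: "0 < m" "int m \<in> I" "\<And>j. 0 < j \<Longrightarrow> int j \<in> I \<Longrightarrow> m \<le> j"
    using exists_least_iff[of "\<lambda>m. 0 < m \<and> int m \<in> I"] by (metis not_le)
  have nmul: "int j * int m \<in> I" for j :: nat
    by (induction j) (use 0 add m(2) in \<open>auto simp: algebra_simps\<close>)
  have mul: "j * int m \<in> I" for j :: int
    using nmul[of "nat j"] neg[OF nmul[of "nat (- j)"]] by (cases "0 \<le> j") auto
  have "int m dvd k" if k: "k \<in> I" for k
  proof -
    have "k mod int m = k - (k div int m) * int m" by (simp add: minus_div_mult_eq_mod)
    then have "k mod int m \<in> I" using diff[OF k mul[of "k div int m"]] by simp
    moreover have "0 \<le> k mod int m" "k mod int m < int m" using m(1) by auto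
    ultimately have "k mod int m = 0"
      using m(3)[of "nat (k mod int m)"] by (cases "k mod int m = 0") auto
    then show ?thesis by auto
  qed
  then show ?thesis using that m(2) by blast
qed

locale one_relator =
  fixes n :: nat and r :: "(nat \<times> bool) list"
  assumes r: "r \<in> carrier (free_grp n)"
begin

abbreviation "F \<equiv> free_grp n"
abbreviation "R \<equiv> normal_closure F {r}"
abbreviation "G \<equiv> F Mod R"
abbreviation "\<pi> \<equiv> \<lambda>x. R #>\<^bsub>F\<^esub> x"

sublocale F: group F by (rule free_grp_group)

lemma R_normal: "R \<lhd> F"
  unfolding normal_closure_def
proof (rule F.normal_generateI)
  show "(\<Union>g\<in>carrier F. (\<lambda>s. g \<otimes>\<^bsub>F\<^esub> s \<otimes>\<^bsub>F\<^esub> inv\<^bsub>F\<^esub> g) ` {r}) \<subseteq> carrier F" using r by auto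
  fix h g assume "h \<in> (\<Union>g\<in>carrier F. (\<lambda>s. g \<otimes>\<^bsub>F\<^esub> s \<otimes>\<^bsub>F\<^esub> inv\<^bsub>F\<^esub> g) ` {r})" and g: "g \<in> carrier F"
  then obtain k where k: "k \<in> carrier F" "h = k \<otimes>\<^bsub>F\<^esub> r \<otimes>\<^bsub>F\<^esub> inv\<^bsub>F\<^esub> k" by auto
  have "g \<otimes>\<^bsub>F\<^esub> h \<otimes>\<^bsub>F\<^esub> inv\<^bsub>F\<^esub> g = (g \<otimes>\<^bsub>F\<^esub> k) \<otimes>\<^bsub>F\<^esub> r \<otimes>\<^bsub>F\<^esub> inv\<^bsub>F\<^esub> (g \<otimes>\<^bsub>F\<^esub> k)"
    using g k r by (simp add: F.group_word_simps)
  then show "g \<otimes>\<^bsub>F\<^esub> h \<otimes>\<^bsub>F\<^esub> inv\<^bsub>F\<^esub> g \<in> (\<Union>g\<in>carrier F. (\<lambda>s. g \<otimes>\<^bsub>F\<^esub> s \<otimes>\<^bsub>F\<^esub> inv\<^bsub>F\<^esub> g) ` {r})"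
    using F.m_closed[OF g k(1)] by (intro UN_I[of "g \<otimes>\<^bsub>F\<^esub> k"]) auto
qed

sublocale R: normal R F by (rule R_normal)
sublocale G: group G by (rule R.factorgroup_is_group)
sublocale \<pi>: group_hom F G \<pi>
  by (intro group_hom.intro group_hom_axioms.intro F.group_axioms G.group_axioms R.r_coset_hom_Mod)

lemma r_in_R: "r \<in> R"
proof -
  have "\<one>\<^bsub>F\<^esub> \<otimes>\<^bsub>F\<^esub> r \<otimes>\<^bsub>F\<^esub> inv\<^bsub>F\<^esub> \<one>\<^bsub>F\<^esub> \<in> R"
    unfolding normal_closure_def by (rule generate.incl) (use F.one_closed in blast)
  then show ?thesis using r by simp
qed

lemma R_minimal:
  assumes "N \<lhd> F" "r \<in> N" shows "R \<subseteq> N"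
  unfolding normal_closure_def
proof (rule F.generate_subgroup_incl[OF _ normal_imp_subgroup[OF assms(1)]], safe)
  fix g assume "g \<in> carrier F"
  then show "g \<otimes>\<^bsub>F\<^esub> r \<otimes>\<^bsub>F\<^esub> inv\<^bsub>F\<^esub> g \<in> N" by (rule F.conj_mem[OF assms(1) _ assms(2)])
qed

lemma carrier_G: "carrier G = \<pi> ` carrier F"
  by (rule carrier_FactGroup)

lemma \<pi>_R: "\<rho> \<in> R \<Longrightarrow> \<pi> \<rho> = \<one>\<^bsub>G\<^esub>"
  using R.rcos_const[OF F.group_axioms] by simp

lemma \<pi>_eq_imp:
  assumes "x \<in> carrier F" "y \<in> carrier F" "\<pi> x = \<pi> y"
  obtains \<rho> where "\<rho> \<in> R" "x = \<rho> \<otimes>\<^bsub>F\<^esub> y"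
proof -
  have "x \<in> \<pi> y" using F.rcos_self[OF assms(1) R.is_subgroup] assms(3) by simp
  then show ?thesis using that by (auto simp: r_coset_def)
qed

definition \<sigma> :: "(nat \<times> bool) list set \<Rightarrow> (nat \<times> bool) list" where
  "\<sigma> g = (SOME x. x \<in> carrier F \<and> \<pi> x = g)"

lemma \<sigma>: "g \<in> carrier G \<Longrightarrow> \<sigma> g \<in> carrier F \<and> \<pi> (\<sigma> g) = g"
  unfolding \<sigma>_def by (rule someI_ex) (auto simp: carrier_G)

text \<open>On \<open>R\<close> the pulled-back cocycle is constant modulo \<open>B\<close>, so
  \<open>f\<close> minus that constant is additive there, and also conjugation invariant. As
  conjugates of \<open>r\<close> generate \<open>R\<close>, its values lie in any subgroup
  \<open>S\<close> above \<open>B\<close> that contains the value at \<open>r\<close>. Applied with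
  integral chains modulo boundaries and with real values modulo 0.\<close>

lemma lift_cocycle:
  fixes \<omega> :: "(nat \<times> bool) list set \<Rightarrow> (nat \<times> bool) list set \<Rightarrow> 'p::ab_group_add" and B :: "'p set"
  assumes B0: "0 \<in> B" and Bd: "\<And>a b. a \<in> B \<Longrightarrow> b \<in> B \<Longrightarrow> a - b \<in> B"
    and coc: "\<And>x y z. x \<in> carrier G \<Longrightarrow> y \<in> carrier G \<Longrightarrow> z \<in> carrier G \<Longrightarrow>
      \<omega> y z - \<omega> (x \<otimes>\<^bsub>G\<^esub> y) z + \<omega> x (y \<otimes>\<^bsub>G\<^esub> z) - \<omega> x y \<in> B"
  obtains f where
    "\<And>x y. x \<in> carrier F \<Longrightarrow> y \<in> carrier F \<Longrightarrow> f x + f y - f (x \<otimes>\<^bsub>F\<^esub> y) - \<omega> (\<pi> x) (\<pi> y) \<in> B"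
    "\<And>\<rho> x. \<rho> \<in> R \<Longrightarrow> x \<in> carrier F \<Longrightarrow> f \<rho> + f x - \<omega> \<one>\<^bsub>G\<^esub> \<one>\<^bsub>G\<^esub> - f (\<rho> \<otimes>\<^bsub>F\<^esub> x) \<in> B"
    "\<And>S \<rho>. B \<subseteq> S \<Longrightarrow> (\<And>a b. a \<in> S \<Longrightarrow> b \<in> S \<Longrightarrow> a - b \<in> S) \<Longrightarrow> f r - \<omega> \<one>\<^bsub>G\<^esub> \<one>\<^bsub>G\<^esub> \<in> S \<Longrightarrow>
      \<rho> \<in> R \<Longrightarrow> f \<rho> - \<omega> \<one>\<^bsub>G\<^esub> \<one>\<^bsub>G\<^esub> \<in> S"
proof -
  let ?w = "\<omega> \<one>\<^bsub>G\<^esub> \<one>\<^bsub>G\<^esub>"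
  have Bm: "- a \<in> B" if "a \<in> B" for a using Bd[OF B0 that] by simp
  have Ba: "a + b \<in> B" if "a \<in> B" "b \<in> B" for a b using Bd[OF that(1) Bm[OF that(2)]] by simp
  have "\<exists>f. \<forall>x\<in>carrier F. \<forall>y\<in>carrier F. f x + f y - f (x \<otimes>\<^bsub>F\<^esub> y) - \<omega> (\<pi> x) (\<pi> y) \<in> B"
  proof (rule free_grp_cocycle[OF B0 Bd])
    fix x y z assume "x \<in> carrier F" "y \<in> carrier F" "z \<in> carrier F"
    then show "\<omega> (\<pi> y) (\<pi> z) - \<omega> (\<pi> (x \<otimes>\<^bsub>F\<^esub> y)) (\<pi> z) + \<omega> (\<pi> x) (\<pi> (y \<otimes>\<^bsub>F\<^esub> z)) - \<omega> (\<pi> x) (\<pi> y) \<in> B"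
      using coc[of "\<pi> x" "\<pi> y" "\<pi> z"] by (simp only: \<pi>.hom_mult \<pi>.hom_closed)
  qed
  then obtain f where f: "\<And>x y. x \<in> carrier F \<Longrightarrow> y \<in> carrier F \<Longrightarrow>
      f x + f y - f (x \<otimes>\<^bsub>F\<^esub> y) - \<omega> (\<pi> x) (\<pi> y) \<in> B" by blast
  have L: "\<omega> \<one>\<^bsub>G\<^esub> g - ?w \<in> B" if "g \<in> carrier G" for g
    using coc[OF G.one_closed G.one_closed that] that by (simp only: G.l_one G.one_closed) simp
  have Rr: "?w - \<omega> g \<one>\<^bsub>G\<^esub> \<in> B" if "g \<in> carrier G" for g
    using coc[OF that G.one_closed G.one_closed] that by (simp only: G.l_one G.r_one G.one_closed) simp
  have fl: "f \<rho> + f x - ?w - f (\<rho> \<otimes>\<^bsub>F\<^esub> x) \<in> B" if \<rho>: "\<rho> \<in> R" and x: "x \<in> carrier F" for \<rho> x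
  proof -
    have "f \<rho> + f x - f (\<rho> \<otimes>\<^bsub>F\<^esub> x) - \<omega> \<one>\<^bsub>G\<^esub> (\<pi> x) \<in> B"
      using f[OF R.mem_carrier[OF \<rho>] x] unfolding \<pi>_R[OF \<rho>] .
    from Ba[OF this L[OF \<pi>.hom_closed[OF x]]] show ?thesis by (simp add: algebra_simps)
  qed
  have fr: "f x + f \<rho> - ?w - f (x \<otimes>\<^bsub>F\<^esub> \<rho>) \<in> B" if \<rho>: "\<rho> \<in> R" and x: "x \<in> carrier F" for \<rho> x
  proof -
    have "f x + f \<rho> - f (x \<otimes>\<^bsub>F\<^esub> \<rho>) - \<omega> (\<pi> x) \<one>\<^bsub>G\<^esub> \<in> B"
      using f[OF x R.mem_carrier[OF \<rho>]] unfolding \<pi>_R[OF \<rho>] .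
    from Bd[OF this Rr[OF \<pi>.hom_closed[OF x]]] show ?thesis by (simp add: algebra_simps)
  qed
  have f1: "f \<one>\<^bsub>F\<^esub> - ?w \<in> B" using fl[OF R.one_closed F.one_closed] by simp
  \<comment> \<open>Expands \<open>f\<close> at \<open>g \<otimes> \<rho>\<close>, which is also the
    conjugate of \<rho> times \<open>g\<close>, in both ways.\<close>
  have conj: "f (g \<otimes>\<^bsub>F\<^esub> \<rho> \<otimes>\<^bsub>F\<^esub> inv\<^bsub>F\<^esub> g) - f \<rho> \<in> B" if \<rho>: "\<rho> \<in> R" and g: "g \<in> carrier F" for \<rho> g
  proof -
    have "(g \<otimes>\<^bsub>F\<^esub> \<rho> \<otimes>\<^bsub>F\<^esub> inv\<^bsub>F\<^esub> g) \<otimes>\<^bsub>F\<^esub> g = g \<otimes>\<^bsub>F\<^esub> \<rho>"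
      using g R.mem_carrier[OF \<rho>] by (simp add: F.group_word_simps)
    then have "f (g \<otimes>\<^bsub>F\<^esub> \<rho> \<otimes>\<^bsub>F\<^esub> inv\<^bsub>F\<^esub> g) + f g - ?w - f (g \<otimes>\<^bsub>F\<^esub> \<rho>) \<in> B"
      using fl[OF F.conj_mem[OF R_normal g \<rho>] g] by simp
    from Bd[OF this fr[OF \<rho> g]] show ?thesis by (simp add: algebra_simps)
  qed
  have S: "f \<rho> - ?w \<in> S" if BS: "B \<subseteq> S" and Sd: "\<And>a b. a \<in> S \<Longrightarrow> b \<in> S \<Longrightarrow> a - b \<in> S"
    and fS: "f r - ?w \<in> S" and \<rho>: "\<rho> \<in> R" for S \<rho>
  proof -
    have S0: "0 \<in> S" using B0 BS by blast
    have Sm: "- a \<in> S" if "a \<in> S" for a using Sd[OF S0 that] by simp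
    have Sa: "a + b \<in> S" if "a \<in> S" "b \<in> S" for a b using Sd[OF that(1) Sm[OF that(2)]] by simp
    have base: "h \<in> R \<and> f h - ?w \<in> S" if "h \<in> (\<Union>g\<in>carrier F. (\<lambda>s. g \<otimes>\<^bsub>F\<^esub> s \<otimes>\<^bsub>F\<^esub> inv\<^bsub>F\<^esub> g) ` {r})" for h
    proof -
      obtain g where g: "g \<in> carrier F" "h = g \<otimes>\<^bsub>F\<^esub> r \<otimes>\<^bsub>F\<^esub> inv\<^bsub>F\<^esub> g" using \<open>h \<in> _\<close> by auto
      have "f h - f r \<in> S" unfolding g(2) by (rule subsetD[OF BS conj[OF r_in_R g(1)]])
      from Sa[OF this fS] show ?thesis unfolding g(2) using F.conj_mem[OF R_normal g(1) r_in_R] by simp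
    qed
    have "\<rho> \<in> generate F (\<Union>g\<in>carrier F. (\<lambda>s. g \<otimes>\<^bsub>F\<^esub> s \<otimes>\<^bsub>F\<^esub> inv\<^bsub>F\<^esub> g) ` {r})"
      using \<rho> unfolding normal_closure_def .
    then have "\<rho> \<in> R \<and> f \<rho> - ?w \<in> S"
    proof (induction rule: generate.induct)
      case one show ?case by (rule conjI[OF R.one_closed subsetD[OF BS f1]])
    next
      case (incl h) then show ?case by (rule base)
    next
      case (inv h)
      note h = conjunct1[OF base[OF inv]] conjunct2[OF base[OF inv]]
      have i: "inv\<^bsub>F\<^esub> h \<in> R" using R.m_inv_closed[OF h(1)] .
      have "f (inv\<^bsub>F\<^esub> h) + f h - ?w - f \<one>\<^bsub>F\<^esub> \<in> B"
        using fl[OF i R.mem_carrier[OF h(1)]] R.mem_carrier[OF h(1)] by simp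
      then have "f (inv\<^bsub>F\<^esub> h) + f h - ?w - f \<one>\<^bsub>F\<^esub> \<in> S" by (rule subsetD[OF BS])
      from Sd[OF Sa[OF this subsetD[OF BS f1]] h(2)] show ?case using i by (simp add: algebra_simps)
    next
      case (eng a b)
      have "f a + f b - ?w - f (a \<otimes>\<^bsub>F\<^esub> b) \<in> S"
        by (rule subsetD[OF BS fl[OF conjunct1[OF eng.IH(1)] R.mem_carrier[OF conjunct1[OF eng.IH(2)]]]])
      from Sd[OF Sa[OF conjunct2[OF eng.IH(1)] conjunct2[OF eng.IH(2)]] this] show ?case
        using eng R.m_closed by (simp add: algebra_simps)
    qed
    then show ?thesis by (rule conjunct2)
  qed
  show ?thesis by (rule that[OF f fl S])
qed

lemma \<sigma>_mult:
  assumes "g \<in> carrier G" "h \<in> carrier G"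
  obtains \<rho> where "\<rho> \<in> R" "\<sigma> g \<otimes>\<^bsub>F\<^esub> \<sigma> h = \<rho> \<otimes>\<^bsub>F\<^esub> \<sigma> (g \<otimes>\<^bsub>G\<^esub> h)"
proof (rule \<pi>_eq_imp)
  note s = \<sigma>[OF assms(1)] \<sigma>[OF assms(2)] \<sigma>[OF G.m_closed[OF assms]]
  show "\<sigma> g \<otimes>\<^bsub>F\<^esub> \<sigma> h \<in> carrier F" "\<sigma> (g \<otimes>\<^bsub>G\<^esub> h) \<in> carrier F" using s by auto
  have "\<pi> (\<sigma> g \<otimes>\<^bsub>F\<^esub> \<sigma> h) = \<pi> (\<sigma> g) \<otimes>\<^bsub>G\<^esub> \<pi> (\<sigma> h)" using s by (intro \<pi>.hom_mult) auto
  then show "\<pi> (\<sigma> g \<otimes>\<^bsub>F\<^esub> \<sigma> h) = \<pi> (\<sigma> (g \<otimes>\<^bsub>G\<^esub> h))" using s by (simp only:)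
qed (rule that)

text \<open>The tautological cocycle \<open>(g, h) \<mapsto> [g, h]\<close> with values in 2-chains modulo boundaries becomes a
  coboundary on \<open>F\<close>, so every 2-cycle is homologous to a multiple of one and the same chain.\<close>
lemma H2_generator_exists: "\<exists>z. H2_generator G z"
proof -
  let ?B = "{c :: (nat \<times> bool) list set \<times> (nat \<times> bool) list set \<Rightarrow> int. boundary2 G c}"
  define \<omega> where "\<omega> g h = (single (g, h) :: (nat \<times> bool) list set \<times> (nat \<times> bool) list set \<Rightarrow> int)" for g h
  have B0: "0 \<in> ?B" using G.boundary2_zero[where 'c=int] by (simp add: zero_fun_def)
  have Bd: "a - b \<in> ?B" if "a \<in> ?B" "b \<in> ?B" for a b
    using G.boundary2_linear[of a b 1 "-1"] that by (simp add: fun_diff_def)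
  have coc: "\<omega> y z - \<omega> (x \<otimes>\<^bsub>G\<^esub> y) z + \<omega> x (y \<otimes>\<^bsub>G\<^esub> z) - \<omega> x y \<in> ?B"
    if "x \<in> carrier G" "y \<in> carrier G" "z \<in> carrier G" for x y z
    using G.boundary2_single[OF that, where 'c=int] unfolding \<omega>_def fun_diff_def plus_fun_def mem_Collect_eq .
  obtain f where f: "\<And>x y. x \<in> carrier F \<Longrightarrow> y \<in> carrier F \<Longrightarrow> f x + f y - f (x \<otimes>\<^bsub>F\<^esub> y) - \<omega> (\<pi> x) (\<pi> y) \<in> ?B"
    "\<And>\<rho> x. \<rho> \<in> R \<Longrightarrow> x \<in> carrier F \<Longrightarrow> f \<rho> + f x - \<omega> \<one>\<^bsub>G\<^esub> \<one>\<^bsub>G\<^esub> - f (\<rho> \<otimes>\<^bsub>F\<^esub> x) \<in> ?B"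
    "\<And>S \<rho>. ?B \<subseteq> S \<Longrightarrow> (\<And>a b. a \<in> S \<Longrightarrow> b \<in> S \<Longrightarrow> a - b \<in> S) \<Longrightarrow> f r - \<omega> \<one>\<^bsub>G\<^esub> \<one>\<^bsub>G\<^esub> \<in> S \<Longrightarrow>
      \<rho> \<in> R \<Longrightarrow> f \<rho> - \<omega> \<one>\<^bsub>G\<^esub> \<one>\<^bsub>G\<^esub> \<in> S"
    using lift_cocycle[of ?B \<omega>, OF B0 Bd coc] by blast
  define e where "e = f r - \<omega> \<one>\<^bsub>G\<^esub> \<one>\<^bsub>G\<^esub>"
  \<comment> \<open>The subgroup of chains that are integral multiples of \<open>e\<close> modulo
    boundaries; the third clause of \<open>lift_cocycle\<close> puts all values of \<open>f\<close>
    on \<open>R\<close>, suitably shifted, into it.\<close>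
  define S where "S = {c. \<exists>k::int. boundary2 G (\<lambda>p. c p - k * e p)}"
  have S_lin: "(\<lambda>p. j * a p + l * b p) \<in> S" if ab: "a \<in> S" "b \<in> S" for a b j l
  proof -
    obtain k k' where "boundary2 G (\<lambda>p. a p - k * e p)" "boundary2 G (\<lambda>p. b p - k' * e p)"
      using ab by (auto simp: S_def)
    from G.boundary2_linear[OF this, of j l]
    have "boundary2 G (\<lambda>p. (j * a p + l * b p) - (j * k + l * k') * e p)" by (simp add: algebra_simps)
    then show ?thesis unfolding S_def by blast
  qed
  have BS: "?B \<subseteq> S" unfolding S_def by (auto intro!: exI[of _ 0])
  have Sd: "a - b \<in> S" if "a \<in> S" "b \<in> S" for a b
    using S_lin[OF that, of 1 "-1"] by (simp add: fun_diff_def)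
  have Sa: "a + b \<in> S" if "a \<in> S" "b \<in> S" for a b
    using S_lin[OF that, of 1 1] by (simp add: plus_fun_def)
  have S0: "(\<lambda>_. 0) \<in> S" using BS G.boundary2_zero by blast
  have eS: "f r - \<omega> \<one>\<^bsub>G\<^esub> \<one>\<^bsub>G\<^esub> \<in> S"
    unfolding e_def[symmetric] S_def using G.boundary2_zero by (auto intro!: exI[of _ 1])
  define u where "u g = f (\<sigma> g)" for g
  \<comment> \<open>The section \<sigma> fails to be multiplicative by an element of
    \<open>R\<close>, whose value under \<open>f\<close> is controlled by \<open>S\<close>.\<close>
  have pairS: "single (g, h) - (u g + u h - u (g \<otimes>\<^bsub>G\<^esub> h)) \<in> S" if gh: "g \<in> carrier G" "h \<in> carrier G" for g h
  proof -
    obtain \<rho> where \<rho>: "\<rho> \<in> R" "\<sigma> g \<otimes>\<^bsub>F\<^esub> \<sigma> h = \<rho> \<otimes>\<^bsub>F\<^esub> \<sigma> (g \<otimes>\<^bsub>G\<^esub> h)" using \<sigma>_mult[OF gh] .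
    note s = \<sigma>[OF gh(1)] \<sigma>[OF gh(2)] \<sigma>[OF G.m_closed[OF gh]]
    have 1: "u g + u h - f (\<rho> \<otimes>\<^bsub>F\<^esub> \<sigma> (g \<otimes>\<^bsub>G\<^esub> h)) - single (g, h) \<in> S"
      using f(1)[of "\<sigma> g" "\<sigma> h"] s BS \<rho> unfolding u_def \<omega>_def by auto
    have 2: "f \<rho> + u (g \<otimes>\<^bsub>G\<^esub> h) - \<omega> \<one>\<^bsub>G\<^esub> \<one>\<^bsub>G\<^esub> - f (\<rho> \<otimes>\<^bsub>F\<^esub> \<sigma> (g \<otimes>\<^bsub>G\<^esub> h)) \<in> S"
      using f(2)[OF \<rho>(1), of "\<sigma> (g \<otimes>\<^bsub>G\<^esub> h)"] s BS unfolding u_def by blast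
    have 3: "f \<rho> - \<omega> \<one>\<^bsub>G\<^esub> \<one>\<^bsub>G\<^esub> \<in> S" by (rule f(3)[OF BS Sd eS \<rho>(1)])
    from Sd[OF Sd[OF 2 3] 1] show ?thesis by (simp add: algebra_simps)
  qed
  have cycleS: "c \<in> S" if c: "cycle2 G c" for c
  proof -
    let ?C = "{p. c p \<noteq> 0}"
    have fin: "finite ?C" and carr: "\<And>p. p \<in> ?C \<Longrightarrow> fst p \<in> carrier G \<and> snd p \<in> carrier G"
      using c by (auto simp: cycle2_def chain2_def)
    \<comment> \<open>Each basis element corrected by a coboundary. By \<open>cycle2_pairing\<close>
      the corrections sum to 0 over a cycle, so a cycle is a combination of elements of
      \<open>S\<close>.\<close>
    define Y where "Y p = single p - (u (fst p) + u (snd p) - u (fst p \<otimes>\<^bsub>G\<^esub> snd p))" for p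
    have "finite A \<Longrightarrow> A \<subseteq> ?C \<Longrightarrow> (\<lambda>q. \<Sum>p\<in>A. c p * Y p q) \<in> S" for A
    proof (induction A rule: finite_induct)
      case (insert p A)
      have "Y p \<in> S" unfolding Y_def using pairS[of "fst p" "snd p"] carr[of p] insert.prems by simp
      from S_lin[OF this, of "\<lambda>q. \<Sum>p\<in>A. c p * Y p q" "c p" 1]
      show ?case using insert by simp
    qed (use S0 in simp)
    from this[OF fin order_refl] have "(\<lambda>q. \<Sum>p\<in>?C. c p * Y p q) \<in> S" .
    moreover have "(\<lambda>q. \<Sum>p\<in>?C. c p * Y p q) = c"
    proof
      fix q
      have "(\<Sum>p\<in>?C. c p * Y p q) = (\<Sum>p\<in>?C. c p * single p q) -
          (\<Sum>p\<in>?C. c p * (u (fst p) q + u (snd p) q - u (fst p \<otimes>\<^bsub>G\<^esub> snd p) q))"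
        by (simp add: Y_def sum_subtractf[symmetric] right_diff_distrib)
      also have "(\<Sum>p\<in>?C. c p * (u (fst p) q + u (snd p) q - u (fst p \<otimes>\<^bsub>G\<^esub> snd p) q)) = 0"
        by (rule G.cycle2_pairing[OF c, of "\<lambda>g. u g q"])
      also have "(\<Sum>p\<in>?C. c p * single p q) = (\<Sum>p\<in>?C. if p = q then c p else 0)"
        by (intro sum.cong) (auto simp: single_def)
      also have "\<dots> = c q" using fin by simp
      finally show "(\<Sum>p\<in>?C. c p * Y p q) = c q" by simp
    qed
    ultimately show ?thesis by simp
  qed
  \<comment> \<open>The chain \<open>e\<close> itself need not be a cycle. The admissible multiples
    form a subgroup of the integers, and its generator yields \<open>z\<close>.\<close>
  define I where "I = {k::int. \<exists>c. cycle2 G c \<and> boundary2 G (\<lambda>p. c p - k * e p)}"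
  have I0: "0 \<in> I" unfolding I_def
    using G.boundary2_zero[where 'c=int] G.boundary2_cycle2[OF G.boundary2_zero[where 'c=int]] by auto
  have Id: "a - b \<in> I" if ab: "a \<in> I" "b \<in> I" for a b
  proof -
    obtain c d where c: "cycle2 G c" "boundary2 G (\<lambda>p. c p - a * e p)"
      and d: "cycle2 G d" "boundary2 G (\<lambda>p. d p - b * e p)" using ab by (auto simp: I_def)
    have "boundary2 G (\<lambda>p. (1 * c p + (-1) * d p) - (a - b) * e p)"
      using G.boundary2_linear[OF c(2) d(2), of 1 "-1"] by (simp add: algebra_simps)
    then show ?thesis unfolding I_def using G.cycle2_linear[OF c(1) d(1), of 1 "-1"] by blast
  qed
  obtain d where d: "d \<in> I" "\<And>k. k \<in> I \<Longrightarrow> d dvd k" using int_subgroup_principal[OF I0 Id] by blast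
  then obtain z where z: "cycle2 G z" "boundary2 G (\<lambda>p. z p - d * e p)" by (auto simp: I_def)
  have "\<exists>k. boundary2 G (\<lambda>p. c p - k * z p)" if c: "cycle2 G c" for c
  proof -
    obtain k where k: "boundary2 G (\<lambda>p. c p - k * e p)" using cycleS[OF c] by (auto simp: S_def)
    then have "k \<in> I" using c by (auto simp: I_def)
    then obtain j where j: "k = d * j" using d(2) by (auto simp: dvd_def)
    have "boundary2 G (\<lambda>p. 1 * (c p - k * e p) + (- j) * (z p - d * e p))"
      by (rule G.boundary2_linear[OF k z(2)])
    then have "boundary2 G (\<lambda>p. c p - j * z p)" by (simp add: j algebra_simps)
    then show ?thesis by blast
  qed
  then show ?thesis using z(1) unfolding H2_generator_def by blast
qed

lemma quasimorphism_of_simplicial_volume: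
  assumes "simplicial_volume G \<noteq> 0"
  obtains \<mu> where "hom_qm F (carrier F) \<mu>"
    "\<And>x y. x \<in> R \<Longrightarrow> y \<in> R \<Longrightarrow> \<mu> (x \<otimes>\<^bsub>F\<^esub> y) = \<mu> x + \<mu> y" "\<mu> r \<noteq> 0"
proof -
  define z where "z = (SOME z. H2_generator G z)"
  \<comment> \<open>Existence is what ties the choice made by \<open>SOME\<close> to an actual
    generator.\<close>
  have "H2_generator G z" unfolding z_def by (rule someI_ex[OF H2_generator_exists])
  then have z: "cycle2 G z" by (simp add: H2_generator_def)
  have "l1_seminorm_H2 G z \<noteq> 0" using assms by (simp add: simplicial_volume_def z_def)
  then obtain \<omega> where \<omega>: "\<And>x y. x \<in> carrier G \<Longrightarrow> y \<in> carrier G \<Longrightarrow> \<bar>\<omega> x y\<bar> \<le> (1::real)"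
    "\<And>x y z. x \<in> carrier G \<Longrightarrow> y \<in> carrier G \<Longrightarrow> z \<in> carrier G \<Longrightarrow>
      \<omega> y z - \<omega> (x \<otimes>\<^bsub>G\<^esub> y) z + \<omega> x (y \<otimes>\<^bsub>G\<^esub> z) - \<omega> x y = 0"
    "(\<Sum>p\<in>{p. z p \<noteq> 0}. real_of_int (z p) * \<omega> (fst p) (snd p)) \<noteq> 0"
    using G.bounded_cocycle_of_seminorm[OF z] by blast
  let ?w = "\<omega> \<one>\<^bsub>G\<^esub> \<one>\<^bsub>G\<^esub>"
  have coc: "\<omega> y z - \<omega> (x \<otimes>\<^bsub>G\<^esub> y) z + \<omega> x (y \<otimes>\<^bsub>G\<^esub> z) - \<omega> x y \<in> {0}"
    if "x \<in> carrier G" "y \<in> carrier G" "z \<in> carrier G" for x y z using \<omega>(2)[OF that] by simp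
  have B: "0 \<in> {0::real}" "\<And>a b. a \<in> {0::real} \<Longrightarrow> b \<in> {0} \<Longrightarrow> a - b \<in> {0}" by auto
  obtain f where f: "\<And>x y. x \<in> carrier F \<Longrightarrow> y \<in> carrier F \<Longrightarrow> f x + f y - f (x \<otimes>\<^bsub>F\<^esub> y) - \<omega> (\<pi> x) (\<pi> y) \<in> {0}"
    "\<And>\<rho> x. \<rho> \<in> R \<Longrightarrow> x \<in> carrier F \<Longrightarrow> f \<rho> + f x - ?w - f (\<rho> \<otimes>\<^bsub>F\<^esub> x) \<in> {0}"
    "\<And>S \<rho>. {0} \<subseteq> S \<Longrightarrow> (\<And>a b. a \<in> S \<Longrightarrow> b \<in> S \<Longrightarrow> a - b \<in> S) \<Longrightarrow> f r - ?w \<in> S \<Longrightarrow> \<rho> \<in> R \<Longrightarrow> f \<rho> - ?w \<in> S"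
    using lift_cocycle[of "{0}" \<omega>, OF B coc] by blast
  \<comment> \<open>The shift makes the function additive on \<open>R\<close>; the defect is at most
    2, namely 1 for \<omega> and 1 for the constant.\<close>
  define f' where "f' x = f x - ?w" for x
  have "quasi_add F (carrier F) f' 2" unfolding quasi_add_def
  proof safe
    fix x y assume xy: "x \<in> carrier F" "y \<in> carrier F"
    have "\<bar>\<omega> (\<pi> x) (\<pi> y)\<bar> \<le> 1" "\<bar>?w\<bar> \<le> 1"
      by (rule \<omega>(1)[OF \<pi>.hom_closed[OF xy(1)] \<pi>.hom_closed[OF xy(2)]], rule \<omega>(1)[OF G.one_closed G.one_closed])
    then show "\<bar>f' (x \<otimes>\<^bsub>F\<^esub> y) - f' x - f' y\<bar> \<le> 2" using f(1)[OF xy] unfolding f'_def by simp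
  qed
  then obtain \<mu> where \<mu>: "hom_qm F (carrier F) \<mu>" "\<And>x. x \<in> carrier F \<Longrightarrow> \<bar>\<mu> x - f' x\<bar> \<le> 2"
    using F.homogenization by blast
  have add: "f' (x \<otimes>\<^bsub>F\<^esub> y) = f' x + f' y" if "x \<in> R" "y \<in> carrier F" for x y
    using f(2)[OF that] by (simp add: f'_def)
  \<comment> \<open>As \<open>f'\<close> is already additive on \<open>R\<close>, homogenization
    leaves its values there unchanged.\<close>
  have eq: "\<mu> x = f' x" if x: "x \<in> R" for x
  proof -
    have "\<mu> x - f' x = 0"
    proof (rule doubling_zero[where S=R and K=2 and g="\<lambda>x. \<mu> x - f' x"])
      fix y assume y: "y \<in> R"
      show "\<bar>\<mu> y - f' y\<bar> \<le> 2" using \<mu>(2) R.mem_carrier[OF y] by blast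
      show "\<exists>t\<in>R. \<mu> t - f' t = 2 * (\<mu> y - f' y)"
        using F.hom_qm_square[OF \<mu>(1) R.mem_carrier[OF y] order_refl] add[OF y R.mem_carrier[OF y]] R.m_closed[OF y y]
        by (intro bexI[of _ "y \<otimes>\<^bsub>F\<^esub> y"]) auto
    qed (rule x)
    then show ?thesis by simp
  qed
  \<comment> \<open>Otherwise \<open>f\<close> would be constant on \<open>R\<close> and, composed
    with the section \<sigma>, would exhibit \<omega> as a coboundary on \<open>G\<close>; it would
    then pair to 0 with the cycle \<open>z\<close>.\<close>
  have "\<mu> r \<noteq> 0"
  proof
    assume "\<mu> r = 0"
    then have "f r - ?w \<in> {0}" using eq[OF r_in_R] by (simp add: f'_def)
    from f(3)[OF order_refl _ this] have fR: "f \<rho> = ?w" if "\<rho> \<in> R" for \<rho> using that by simp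
    define u where "u g = f (\<sigma> g)" for g
    have \<omega>u: "\<omega> g h = u g + u h - u (g \<otimes>\<^bsub>G\<^esub> h)" if gh: "g \<in> carrier G" "h \<in> carrier G" for g h
    proof -
      obtain \<rho> where \<rho>: "\<rho> \<in> R" "\<sigma> g \<otimes>\<^bsub>F\<^esub> \<sigma> h = \<rho> \<otimes>\<^bsub>F\<^esub> \<sigma> (g \<otimes>\<^bsub>G\<^esub> h)" using \<sigma>_mult[OF gh] .
      note s = \<sigma>[OF gh(1)] \<sigma>[OF gh(2)] \<sigma>[OF G.m_closed[OF gh]]
      have "f (\<rho> \<otimes>\<^bsub>F\<^esub> \<sigma> (g \<otimes>\<^bsub>G\<^esub> h)) = u (g \<otimes>\<^bsub>G\<^esub> h)"
        using f(2)[OF \<rho>(1), of "\<sigma> (g \<otimes>\<^bsub>G\<^esub> h)"] s fR[OF \<rho>(1)] by (simp only: u_def) auto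
      moreover have "u g + u h - f (\<rho> \<otimes>\<^bsub>F\<^esub> \<sigma> (g \<otimes>\<^bsub>G\<^esub> h)) - \<omega> g h = 0"
        using f(1)[of "\<sigma> g" "\<sigma> h"] s \<rho>(2) unfolding u_def by simp
      ultimately show ?thesis by simp
    qed
    have "(\<Sum>p\<in>{p. z p \<noteq> 0}. real_of_int (z p) * \<omega> (fst p) (snd p)) =
        (\<Sum>p\<in>{p. real_of_int (z p) \<noteq> 0}. real_of_int (z p) * (u (fst p) + u (snd p) - u (fst p \<otimes>\<^bsub>G\<^esub> snd p)))"
      by (intro sum.cong) (use z \<omega>u in \<open>auto simp only: cycle2_def chain2_def of_int_eq_0_iff\<close>)
    also have "\<dots> = 0" by (rule G.cycle2_pairing[OF G.cycle2_of_int[OF z]])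
    finally show False using \<omega>(3) by simp
  qed
  moreover have "\<mu> (x \<otimes>\<^bsub>F\<^esub> y) = \<mu> x + \<mu> y" if "x \<in> R" "y \<in> R" for x y
    using that eq add R.mem_carrier R.m_closed by simp
  ultimately show ?thesis using \<mu>(1) by (intro that)
qed

end

section \<open>Descent to the quotient\<close>

lemma H1_invD:
  assumes "a \<in> H1_inv G N"
  shows "x \<notin> N \<Longrightarrow> a x = 0" "x \<in> N \<Longrightarrow> y \<in> N \<Longrightarrow> a (x \<otimes>\<^bsub>G\<^esub> y) = a x + a y"
    "g \<in> carrier G \<Longrightarrow> x \<in> N \<Longrightarrow> a (g \<otimes>\<^bsub>G\<^esub> x \<otimes>\<^bsub>G\<^esub> inv\<^bsub>G\<^esub> g) = a x"
  using assms by (auto simp: H1_inv_def)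

lemma H1_invI:
  assumes "\<And>x. x \<notin> N \<Longrightarrow> a x = 0" "\<And>x y. x \<in> N \<Longrightarrow> y \<in> N \<Longrightarrow> a (x \<otimes>\<^bsub>G\<^esub> y) = a x + a y"
    "\<And>g x. g \<in> carrier G \<Longrightarrow> x \<in> N \<Longrightarrow> a (g \<otimes>\<^bsub>G\<^esub> x \<otimes>\<^bsub>G\<^esub> inv\<^bsub>G\<^esub> g) = a x"
  shows "a \<in> H1_inv G N"
  using assms by (auto simp: H1_inv_def)

lemma Q_invD:
  assumes "\<phi> \<in> Q_inv G N"
  shows "hom_qm G N \<phi>"
    "g \<in> carrier G \<Longrightarrow> x \<in> N \<Longrightarrow> \<phi> (g \<otimes>\<^bsub>G\<^esub> x \<otimes>\<^bsub>G\<^esub> inv\<^bsub>G\<^esub> g) = \<phi> x"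
  using assms by (auto simp: Q_inv_def)

lemma H1_inv_linear:
  assumes a: "a \<in> H1_inv G N" and b: "b \<in> H1_inv G N"
  shows "(\<lambda>x. s * a x + t * b x) \<in> H1_inv G N"
  using H1_invD[OF a] H1_invD[OF b] by (intro H1_invI) (simp_all add: algebra_simps)

lemma hom_qm_linear:
  assumes a: "hom_qm G N a" and b: "hom_qm G N b"
  shows "hom_qm G N (\<lambda>x. s * a x + t * b x)"
proof -
  obtain D where D: "quasi_add G N a D" using hom_qm_quasi_add[OF a] .
  obtain E where E: "quasi_add G N b E" using hom_qm_quasi_add[OF b] .
  have "\<bar>s * a (x \<otimes>\<^bsub>G\<^esub> y) + t * b (x \<otimes>\<^bsub>G\<^esub> y) - (s * a x + t * b x) - (s * a y + t * b y)\<bar> \<le> \<bar>s\<bar> * D + \<bar>t\<bar> * E"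
    if xy: "x \<in> N" "y \<in> N" for x y
  proof -
    have "s * a (x \<otimes>\<^bsub>G\<^esub> y) + t * b (x \<otimes>\<^bsub>G\<^esub> y) - (s * a x + t * b x) - (s * a y + t * b y) =
        s * (a (x \<otimes>\<^bsub>G\<^esub> y) - a x - a y) + t * (b (x \<otimes>\<^bsub>G\<^esub> y) - b x - b y)" by (simp add: algebra_simps)
    also have "\<bar>\<dots>\<bar> \<le> \<bar>s\<bar> * \<bar>a (x \<otimes>\<^bsub>G\<^esub> y) - a x - a y\<bar> + \<bar>t\<bar> * \<bar>b (x \<otimes>\<^bsub>G\<^esub> y) - b x - b y\<bar>"
      unfolding abs_mult[symmetric] by (rule abs_triangle_ineq)
    also have "\<dots> \<le> \<bar>s\<bar> * D + \<bar>t\<bar> * E"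
      by (intro add_mono mult_left_mono quasi_addD[OF D xy] quasi_addD[OF E xy]) auto
    finally show ?thesis .
  qed
  moreover have "s * a (x [^]\<^bsub>G\<^esub> m) + t * b (x [^]\<^bsub>G\<^esub> m) = of_int m * (s * a x + t * b x)"
    if "x \<in> N" for x and m :: int
    using hom_qm_int_pow[OF a that, of m] hom_qm_int_pow[OF b that, of m] by (simp add: algebra_simps)
  ultimately show ?thesis
    unfolding hom_qm_def using hom_qm_outside[OF a] hom_qm_outside[OF b] by auto
qed

context group
begin

lemma hom_qm_Q_inv: "hom_qm G (carrier G) \<psi> \<Longrightarrow> \<psi> \<in> Q_inv G (carrier G)"
  unfolding Q_inv_def using hom_qm_conj by blast

lemma H1_inv_one:
  assumes a: "a \<in> H1_inv G N" and N: "N \<lhd> G" shows "a \<one> = 0"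
proof -
  have "\<one> \<in> N" by (rule subgroup.one_closed[OF normal_imp_subgroup[OF N]])
  from H1_invD(2)[OF a this this] show ?thesis by simp
qed

lemma H1_inv_inverse:
  assumes a: "a \<in> H1_inv G N" and N: "N \<lhd> G" and x: "x \<in> N" shows "a (inv x) = - a x"
proof -
  have "x \<in> carrier G" by (rule subgroup.mem_carrier[OF normal_imp_subgroup[OF N] x])
  then show ?thesis using H1_invD(2)[OF a x normal_inv_mem[OF N x]] H1_inv_one[OF a N] by simp
qed

text \<open>On a commutator of \<open>g\<close> and \<open>x\<close> the value is that of a
  conjugate of \<open>x\<close> minus that of \<open>x\<close>.\<close>

lemma H1_inv_lcs_Suc:
  assumes a: "a \<in> H1_inv G (lcs_aux G k)" and x: "x \<in> lcs_aux G (Suc k)"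
  shows "a x = 0"
proof -
  note N = lcs_normal[of k]
  have base: "a h = 0" if hm: "h \<in> (\<Union>g\<in>carrier G. \<Union>x\<in>lcs_aux G k. {cmt g x})" for h
  proof -
    obtain g x where h: "g \<in> carrier G" "x \<in> lcs_aux G k" "h = cmt g x" using hm by blast
    have "a h = a (g \<otimes> x \<otimes> inv g) + a (inv x)"
      unfolding h(3) cmt_def by (rule H1_invD(2)[OF a conj_mem[OF N h(1,2)] normal_inv_mem[OF N h(2)]])
    then show ?thesis using H1_invD(3)[OF a h(1,2)] H1_inv_inverse[OF a N h(2)] by simp
  qed
  have sub: "(\<Union>g\<in>carrier G. \<Union>x\<in>lcs_aux G k. {cmt g x}) \<subseteq> lcs_aux G (Suc k)"
    unfolding lcs_Suc by (rule subsetI) (rule generate.incl)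
  have "x \<in> generate G (\<Union>g\<in>carrier G. \<Union>x\<in>lcs_aux G k. {cmt g x})" using x by (simp only: lcs_Suc)
  then show ?thesis
  proof (induction rule: generate.induct)
    case one show ?case by (rule H1_inv_one[OF a N])
  next
    case (incl h) then show ?case by (rule base)
  next
    case (inv h)
    have "h \<in> lcs_aux G k" by (rule subsetD[OF lcs_Suc_subset subsetD[OF sub inv]])
    then show ?case using H1_inv_inverse[OF a N] base[OF inv] by simp
  next
    case (eng h1 h2)
    have "h1 \<in> lcs_aux G (Suc k)" "h2 \<in> lcs_aux G (Suc k)"
      unfolding lcs_Suc by (rule eng.hyps)+
    from this[THEN subsetD[OF lcs_Suc_subset]] have "h1 \<in> lcs_aux G k" "h2 \<in> lcs_aux G k" .
    then show ?case using H1_invD(2)[OF a] eng.IH by simp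
  qed
qed

lemma Q_inv_restrict:
  assumes "\<psi> \<in> Q_inv G M" "N \<lhd> G" "N \<subseteq> M"
  shows "(\<lambda>x. if x \<in> N then \<psi> x else 0) \<in> Q_inv G N"
proof -
  obtain D where "quasi_add G M \<psi> D" using hom_qm_quasi_add[OF Q_invD(1)[OF assms(1)]] .
  then have "\<forall>x\<in>N. \<forall>y\<in>N. \<bar>\<psi> (x \<otimes> y) - \<psi> x - \<psi> y\<bar> \<le> D"
    using assms(3) unfolding quasi_add_def by blast
  moreover have "x \<otimes> y \<in> N" if "x \<in> N" "y \<in> N" for x y using normal_mult_mem[OF assms(2) that] .
  moreover have "x [^] m \<in> N" if "x \<in> N" for x and m :: int
    using subgroup_int_pow_closed[OF normal_imp_subgroup[OF assms(2)] that] .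
  moreover have "\<psi> (x [^] m) = of_int m * \<psi> x" if "x \<in> N" for x and m :: int
    using hom_qm_int_pow[OF Q_invD(1)[OF assms(1)]] assms(3) that by blast
  ultimately show ?thesis
    unfolding Q_inv_def hom_qm_def using conj_mem[OF assms(2)] Q_invD(2)[OF assms(1)] assms(3)
    by (auto intro!: exI[of _ D])
qed

lemma H1_inv_restrict:
  assumes "a \<in> H1_inv G M" "N \<lhd> G" "N \<subseteq> M"
  shows "(\<lambda>x. if x \<in> N then a x else 0) \<in> H1_inv G N"
  using H1_invD[OF assms(1)] subsetD[OF assms(3)] normal_mult_mem[OF assms(2)] conj_mem[OF assms(2)]
  by (intro H1_invI) auto

lemma Q_inv_minus_H1_inv:
  assumes \<phi>: "\<phi> \<in> Q_inv G N" and a: "a \<in> H1_inv G N" and N: "N \<lhd> G"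
  shows "(\<lambda>x. \<phi> x - a x) \<in> Q_inv G N"
proof -
  have sub: "subgroup N G" by (rule normal_imp_subgroup[OF N])
  have "hom_qm G N a"
    by (rule hom_qmI[OF sub H1_invD(1)[OF a], where D=0])
      (use H1_invD(2)[OF a] in \<open>simp_all add: quasi_add_def\<close>)
  then have "hom_qm G N (\<lambda>x. 1 * \<phi> x + (-1) * a x)" by (rule hom_qm_linear[OF Q_invD(1)[OF \<phi>]])
  then show ?thesis unfolding Q_inv_def using Q_invD(2)[OF \<phi>] H1_invD(3)[OF a] by simp
qed

end

section \<open>Transfer between the free group and the one-relator group\<close>

context one_relator
begin

lemma real_split:
  fixes \<omega> :: "(nat \<times> bool) list \<Rightarrow> (nat \<times> bool) list \<Rightarrow> real"
  assumes "\<And>x y z. x \<in> carrier F \<Longrightarrow> y \<in> carrier F \<Longrightarrow> z \<in> carrier F \<Longrightarrow>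
      \<omega> y z - \<omega> (x \<otimes>\<^bsub>F\<^esub> y) z + \<omega> x (y \<otimes>\<^bsub>F\<^esub> z) - \<omega> x y = 0"
  shows "\<exists>f. \<forall>x\<in>carrier F. \<forall>y\<in>carrier F. f x + f y - f (x \<otimes>\<^bsub>F\<^esub> y) = \<omega> x y"
proof -
  have "\<exists>f. \<forall>x\<in>carrier F. \<forall>y\<in>carrier F. f x + f y - f (x \<otimes>\<^bsub>F\<^esub> y) - \<omega> x y \<in> {0}"
    by (rule free_grp_cocycle) (use assms in auto)
  then show ?thesis by simp
qed

lemma lcs_G: "lcs_aux G k = \<pi> ` lcs_aux F k"
  by (rule \<pi>.hom_lcs) (rule carrier_G[symmetric])

text \<open>Uses an arbitrary section; \<open>descend_apply\<close> shows independence of the choice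
  for functions that ignore \<open>R\<close>.\<close>

definition descend :: "(nat \<times> bool) list set \<Rightarrow> ((nat \<times> bool) list \<Rightarrow> real) \<Rightarrow> (nat \<times> bool) list set \<Rightarrow> real" where
  "descend N g C = (if C \<in> \<pi> ` N then g (\<sigma> C) else 0)"

lemma descend_apply:
  assumes N: "N \<lhd> F" "R \<subseteq> N" and inv: "\<And>x \<rho>. x \<in> N \<Longrightarrow> \<rho> \<in> R \<Longrightarrow> g (x \<otimes>\<^bsub>F\<^esub> \<rho>) = g x" and x: "x \<in> N"
  shows "descend N g (\<pi> x) = g x"
proof -
  have xc: "x \<in> carrier F" using subgroup.mem_carrier[OF normal_imp_subgroup[OF N(1)] x] .
  note s = \<sigma>[OF \<pi>.hom_closed[OF xc]]
  obtain \<rho> where \<rho>: "\<rho> \<in> R" "\<sigma> (\<pi> x) = \<rho> \<otimes>\<^bsub>F\<^esub> x" using \<pi>_eq_imp[OF conjunct1[OF s] xc conjunct2[OF s]] .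
  have \<rho>c: "\<rho> \<in> carrier F" using R.mem_carrier[OF \<rho>(1)] .
  have "\<sigma> (\<pi> x) = x \<otimes>\<^bsub>F\<^esub> (inv\<^bsub>F\<^esub> x \<otimes>\<^bsub>F\<^esub> \<rho> \<otimes>\<^bsub>F\<^esub> x)"
    unfolding \<rho>(2) using xc \<rho>c by (simp add: F.group_word_simps)
  then show ?thesis unfolding descend_def using x inv[OF x F.conj_mem'[OF R_normal xc \<rho>(1)]] by simp
qed

lemma descend_Q_inv:
  assumes N: "N \<lhd> F" "R \<subseteq> N" and inv: "\<And>x \<rho>. x \<in> N \<Longrightarrow> \<rho> \<in> R \<Longrightarrow> g (x \<otimes>\<^bsub>F\<^esub> \<rho>) = g x"
    and g: "g \<in> Q_inv F N"
  shows "descend N g \<in> Q_inv G (\<pi> ` N)"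
proof -
  have Nc: "x \<in> carrier F" if "x \<in> N" for x using subgroup.mem_carrier[OF normal_imp_subgroup[OF N(1)] that] .
  have app: "descend N g (\<pi> x) = g x" if "x \<in> N" for x
    by (rule descend_apply[OF N _ that]) (rule inv)
  obtain D where D: "quasi_add F N g D" using hom_qm_quasi_add[OF Q_invD(1)[OF g]] .
  have q: "\<bar>descend N g (u \<otimes>\<^bsub>G\<^esub> v) - descend N g u - descend N g v\<bar> \<le> D" if uv: "u \<in> \<pi> ` N" "v \<in> \<pi> ` N" for u v
  proof -
    obtain x y where xy: "x \<in> N" "y \<in> N" "u = \<pi> x" "v = \<pi> y" using uv by blast
    have "u \<otimes>\<^bsub>G\<^esub> v = \<pi> (x \<otimes>\<^bsub>F\<^esub> y)" unfolding xy(3,4) by (rule \<pi>.hom_mult[OF Nc[OF xy(1)] Nc[OF xy(2)], symmetric])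
    then show ?thesis
      using quasi_addD[OF D xy(1,2)] app[OF xy(1)] app[OF xy(2)] app[OF F.normal_mult_mem[OF N(1) xy(1,2)]]
      by (simp only: xy(3,4))
  qed
  have h: "descend N g (u [^]\<^bsub>G\<^esub> m) = of_int m * descend N g u" if u: "u \<in> \<pi> ` N" for u and m :: int
  proof -
    obtain x where x: "x \<in> N" "u = \<pi> x" using u by blast
    have "u [^]\<^bsub>G\<^esub> m = \<pi> (x [^]\<^bsub>F\<^esub> m)" unfolding x(2) by (rule \<pi>.hom_int_pow[OF Nc[OF x(1)], symmetric])
    then show ?thesis
      using app[OF x(1)] app[OF F.subgroup_int_pow_closed[OF normal_imp_subgroup[OF N(1)] x(1), of m]]
        hom_qm_int_pow[OF Q_invD(1)[OF g] x(1), of m] by (simp only: x(2))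
  qed
  have c: "descend N g (h \<otimes>\<^bsub>G\<^esub> u \<otimes>\<^bsub>G\<^esub> inv\<^bsub>G\<^esub> h) = descend N g u" if hu: "h \<in> carrier G" "u \<in> \<pi> ` N" for h u
  proof -
    obtain x where x: "x \<in> carrier F" "h = \<pi> x" using hu(1) unfolding carrier_G by blast
    obtain y where y: "y \<in> N" "u = \<pi> y" using hu(2) by blast
    note xy = x y
    have "\<pi> (x \<otimes>\<^bsub>F\<^esub> y \<otimes>\<^bsub>F\<^esub> inv\<^bsub>F\<^esub> x) = h \<otimes>\<^bsub>G\<^esub> u \<otimes>\<^bsub>G\<^esub> inv\<^bsub>G\<^esub> h"
      unfolding xy(2,4) using xy(1) Nc[OF xy(3)] by (simp only: \<pi>.hom_mult \<pi>.hom_inv F.m_closed F.inv_closed)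
    then show ?thesis
      using app[OF xy(3)] app[OF F.conj_mem[OF N(1) xy(1,3)]] Q_invD(2)[OF g xy(1,3)] by (simp only: xy(4))
  qed
  have o: "descend N g u = 0" if "u \<notin> \<pi> ` N" for u using that by (simp add: descend_def)
  show ?thesis unfolding Q_inv_def hom_qm_def
    by (intro CollectI conjI exI[of _ D] allI ballI impI) (rule q h c o, assumption+)+
qed

lemma descend_H1_inv:
  assumes N: "N \<lhd> F" "R \<subseteq> N" and a: "a \<in> H1_inv F N" and z: "\<And>\<rho>. \<rho> \<in> R \<Longrightarrow> a \<rho> = 0"
  shows "descend N a \<in> H1_inv G (\<pi> ` N)" "x \<in> N \<Longrightarrow> descend N a (\<pi> x) = a x"
proof -
  have Nc: "x \<in> carrier F" if "x \<in> N" for x using subgroup.mem_carrier[OF normal_imp_subgroup[OF N(1)] that] .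
  have inv: "a (x \<otimes>\<^bsub>F\<^esub> \<rho>) = a x" if "x \<in> N" "\<rho> \<in> R" for x \<rho>
    using H1_invD(2)[OF a that(1) subsetD[OF N(2) that(2)]] z[OF that(2)] by simp
  have app: "descend N a (\<pi> x) = a x" if "x \<in> N" for x
    by (rule descend_apply[OF N _ that]) (rule inv)
  show "x \<in> N \<Longrightarrow> descend N a (\<pi> x) = a x" by (rule app)
  show "descend N a \<in> H1_inv G (\<pi> ` N)"
  proof (rule H1_invI)
    fix u v assume uv: "u \<in> \<pi> ` N" "v \<in> \<pi> ` N"
    obtain x y where xy: "x \<in> N" "y \<in> N" "u = \<pi> x" "v = \<pi> y" using uv by blast
    have "u \<otimes>\<^bsub>G\<^esub> v = \<pi> (x \<otimes>\<^bsub>F\<^esub> y)" unfolding xy(3,4) by (rule \<pi>.hom_mult[OF Nc[OF xy(1)] Nc[OF xy(2)], symmetric])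
    then show "descend N a (u \<otimes>\<^bsub>G\<^esub> v) = descend N a u + descend N a v"
      using H1_invD(2)[OF a xy(1,2)] app[OF xy(1)] app[OF xy(2)] app[OF F.normal_mult_mem[OF N(1) xy(1,2)]]
      by (simp only: xy(3,4))
  next
    fix h u assume hu: "h \<in> carrier G" "u \<in> \<pi> ` N"
    obtain x where x: "x \<in> carrier F" "h = \<pi> x" using hu(1) unfolding carrier_G by blast
    obtain y where y: "y \<in> N" "u = \<pi> y" using hu(2) by blast
    note xy = x y
    have "\<pi> (x \<otimes>\<^bsub>F\<^esub> y \<otimes>\<^bsub>F\<^esub> inv\<^bsub>F\<^esub> x) = h \<otimes>\<^bsub>G\<^esub> u \<otimes>\<^bsub>G\<^esub> inv\<^bsub>G\<^esub> h"
      unfolding xy(2,4) using xy(1) Nc[OF xy(3)] by (simp only: \<pi>.hom_mult \<pi>.hom_inv F.m_closed F.inv_closed)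
    then show "descend N a (h \<otimes>\<^bsub>G\<^esub> u \<otimes>\<^bsub>G\<^esub> inv\<^bsub>G\<^esub> h) = descend N a u"
      using app[OF xy(3)] app[OF F.conj_mem[OF N(1) xy(1,3)]] H1_invD(3)[OF a xy(1,3)] by (simp only: xy(4))
  qed (simp add: descend_def)
qed

lemma pull_Q_inv:
  assumes N: "N \<lhd> F" and \<phi>: "\<phi> \<in> Q_inv G (\<pi> ` N)"
  shows "(\<lambda>x. if x \<in> N then \<phi> (\<pi> x) else 0) \<in> Q_inv F N"
proof -
  have Nc: "x \<in> carrier F" if "x \<in> N" for x using subgroup.mem_carrier[OF normal_imp_subgroup[OF N] that] .
  obtain D where D: "quasi_add G (\<pi> ` N) \<phi> D" using hom_qm_quasi_add[OF Q_invD(1)[OF \<phi>]] .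
  have q: "\<bar>\<phi> (\<pi> (x \<otimes>\<^bsub>F\<^esub> y)) - \<phi> (\<pi> x) - \<phi> (\<pi> y)\<bar> \<le> D" if "x \<in> N" "y \<in> N" for x y
    using quasi_addD[OF D imageI[OF that(1)] imageI[OF that(2)]] \<pi>.hom_mult[OF Nc[OF that(1)] Nc[OF that(2)]]
    by (simp only:)
  have h: "\<phi> (\<pi> (x [^]\<^bsub>F\<^esub> m)) = of_int m * \<phi> (\<pi> x)" if "x \<in> N" for x and m :: int
    using hom_qm_int_pow[OF Q_invD(1)[OF \<phi>] imageI[OF that], of m] \<pi>.hom_int_pow[OF Nc[OF that], of m]
    by (simp only:)
  have c: "\<phi> (\<pi> (g \<otimes>\<^bsub>F\<^esub> x \<otimes>\<^bsub>F\<^esub> inv\<^bsub>F\<^esub> g)) = \<phi> (\<pi> x)" if "g \<in> carrier F" "x \<in> N" for g x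
  proof -
    have "\<pi> (g \<otimes>\<^bsub>F\<^esub> x \<otimes>\<^bsub>F\<^esub> inv\<^bsub>F\<^esub> g) = \<pi> g \<otimes>\<^bsub>G\<^esub> \<pi> x \<otimes>\<^bsub>G\<^esub> inv\<^bsub>G\<^esub> (\<pi> g)"
      using that(1) Nc[OF that(2)] by (simp only: \<pi>.hom_mult \<pi>.hom_inv F.m_closed F.inv_closed)
    then show ?thesis using Q_invD(2)[OF \<phi> \<pi>.hom_closed[OF that(1)] imageI[OF that(2)]] by (simp only:)
  qed
  note mem = F.normal_mult_mem[OF N] F.subgroup_int_pow_closed[OF normal_imp_subgroup[OF N]] F.conj_mem[OF N]
  show ?thesis unfolding Q_inv_def hom_qm_def
    by (intro CollectI conjI exI[of _ D] allI ballI impI) (simp_all only: mem if_True if_False q h c)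
qed

lemma zero_on_R:
  assumes add: "\<And>x y. x \<in> R \<Longrightarrow> y \<in> R \<Longrightarrow> u (x \<otimes>\<^bsub>F\<^esub> y) = u x + (u y :: real)"
    and conj: "\<And>g x. g \<in> carrier F \<Longrightarrow> x \<in> R \<Longrightarrow> u (g \<otimes>\<^bsub>F\<^esub> x \<otimes>\<^bsub>F\<^esub> inv\<^bsub>F\<^esub> g) = u x"
    and 0: "u r = 0" and \<rho>: "\<rho> \<in> R"
  shows "u \<rho> = 0"
proof -
  have base: "h \<in> R \<and> u h = 0" if h: "h \<in> (\<Union>g\<in>carrier F. (\<lambda>s. g \<otimes>\<^bsub>F\<^esub> s \<otimes>\<^bsub>F\<^esub> inv\<^bsub>F\<^esub> g) ` {r})" for h
  proof -
    obtain g where g: "g \<in> carrier F" "h = g \<otimes>\<^bsub>F\<^esub> r \<otimes>\<^bsub>F\<^esub> inv\<^bsub>F\<^esub> g" using h by auto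
    show ?thesis unfolding g(2) using F.conj_mem[OF R_normal g(1) r_in_R] conj[OF g(1) r_in_R] 0 by simp
  qed
  have one: "u \<one>\<^bsub>F\<^esub> = 0" using add[OF R.one_closed R.one_closed] by simp
  have "\<rho> \<in> generate F (\<Union>g\<in>carrier F. (\<lambda>s. g \<otimes>\<^bsub>F\<^esub> s \<otimes>\<^bsub>F\<^esub> inv\<^bsub>F\<^esub> g) ` {r})"
    using \<rho> unfolding normal_closure_def .
  then have "\<rho> \<in> R \<and> u \<rho> = 0"
  proof (induction rule: generate.induct)
    case one show ?case by (rule conjI[OF R.one_closed \<open>u \<one>\<^bsub>F\<^esub> = 0\<close>])
  next
    case (incl h) then show ?case by (rule base)
  next
    case (inv h)
    note h = conjunct1[OF base[OF inv]] conjunct2[OF base[OF inv]]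
    have "u (inv\<^bsub>F\<^esub> h) + u h = 0"
      using add[OF R.m_inv_closed[OF h(1)] h(1)] one R.mem_carrier[OF h(1)] by simp
    then show ?case using h R.m_inv_closed[OF h(1)] by simp
  next
    case (eng a b)
    then show ?case using add[of a b] R.m_closed[of a b] by simp
  qed
  then show ?thesis by (rule conjunct2)
qed

text \<open>The last clause couples the two summands: the projection collapses \<open>R\<close> to
  the identity, where \<phi> is 0. So if one summand vanishes on \<open>R\<close>, both
  descend.\<close>

lemma Q_inv_decompose:
  assumes sub: "R \<subseteq> lcs_aux F k" and \<phi>: "\<phi> \<in> Q_inv G (lcs_aux G k)"
  obtains a \<psi> where "a \<in> H1_inv F (lcs_aux F k)" "hom_qm F (carrier F) \<psi>"
    "\<And>x. x \<in> lcs_aux F k \<Longrightarrow> \<phi> (\<pi> x) = a x + \<psi> x" "\<And>\<rho>. \<rho> \<in> R \<Longrightarrow> \<psi> \<rho> = - a \<rho>"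
proof -
  note N = F.lcs_normal[of k]
  have "(\<lambda>x. if x \<in> lcs_aux F k then \<phi> (\<pi> x) else 0) \<in> Q_inv F (lcs_aux F k)"
    by (rule pull_Q_inv[OF N]) (use \<phi> in \<open>simp only: lcs_G\<close>)
  from F.extend_invariant_qm[OF real_split this]
  obtain a \<psi> where a: "a \<in> H1_inv F (lcs_aux F k)" "hom_qm F (carrier F) \<psi>"
    "\<And>x. x \<in> lcs_aux F k \<Longrightarrow> \<phi> (\<pi> x) = a x + \<psi> x" by auto
  have "\<psi> \<rho> = - a \<rho>" if \<rho>: "\<rho> \<in> R" for \<rho>
  proof -
    have "\<one>\<^bsub>G\<^esub> \<in> lcs_aux G k" by (rule subgroup.one_closed[OF G.lcs_subgroup])
    then have "\<phi> \<one>\<^bsub>G\<^esub> = 0" by (rule G.hom_qm_one[OF Q_invD(1)[OF \<phi>]])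
    then show ?thesis using a(3)[OF subsetD[OF sub \<rho>]] unfolding \<pi>_R[OF \<rho>] by simp
  qed
  then show ?thesis using a by (intro that)
qed

lemma descend_hom_qm:
  assumes \<psi>: "hom_qm F (carrier F) \<psi>" and z: "\<And>\<rho>. \<rho> \<in> R \<Longrightarrow> \<psi> \<rho> = 0"
  shows "descend (carrier F) \<psi> \<in> Q_inv G (carrier G)" "x \<in> carrier F \<Longrightarrow> descend (carrier F) \<psi> (\<pi> x) = \<psi> x"
proof -
  have inv: "\<psi> (x \<otimes>\<^bsub>F\<^esub> \<rho>) = \<psi> x" if "x \<in> carrier F" "\<rho> \<in> R" for x \<rho>
    by (rule F.hom_qm_mod[OF \<psi> F.subgroup_self R_normal R.subset _ that]) (rule z)
  show "descend (carrier F) \<psi> \<in> Q_inv G (carrier G)"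
    unfolding carrier_G by (rule descend_Q_inv[OF F.normal_self R.subset _ F.hom_qm_Q_inv[OF \<psi>]]) (rule inv)
  show "x \<in> carrier F \<Longrightarrow> descend (carrier F) \<psi> (\<pi> x) = \<psi> x"
    by (rule descend_apply[OF F.normal_self R.subset]) (rule inv)
qed

lemma Q_inv_extends_below:
  assumes r: "r \<in> lcs_aux F (Suc k)" and \<phi>: "\<phi> \<in> Q_inv G (lcs_aux G k)"
  shows "\<exists>a\<in>H1_inv G (lcs_aux G k). \<exists>\<psi>\<in>Q_inv G (carrier G). \<forall>y\<in>lcs_aux G k. \<phi> y = a y + \<psi> y"
proof -
  have R1: "R \<subseteq> lcs_aux F (Suc k)" by (rule R_minimal[OF F.lcs_normal r])
  then have R0: "R \<subseteq> lcs_aux F k" using F.lcs_Suc_subset by blast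
  obtain a \<psi> where a: "a \<in> H1_inv F (lcs_aux F k)" "hom_qm F (carrier F) \<psi>"
    "\<And>x. x \<in> lcs_aux F k \<Longrightarrow> \<phi> (\<pi> x) = a x + \<psi> x" "\<And>\<rho>. \<rho> \<in> R \<Longrightarrow> \<psi> \<rho> = - a \<rho>"
    using Q_inv_decompose[OF R0 \<phi>] by blast
  have za: "a \<rho> = 0" if "\<rho> \<in> R" for \<rho> by (rule F.H1_inv_lcs_Suc[OF a(1) subsetD[OF R1 that]])
  have z\<psi>: "\<psi> \<rho> = 0" if "\<rho> \<in> R" for \<rho> using a(4)[OF that] za[OF that] by simp
  have da: "descend (lcs_aux F k) a \<in> H1_inv G (\<pi> ` lcs_aux F k)"
    "\<And>x. x \<in> lcs_aux F k \<Longrightarrow> descend (lcs_aux F k) a (\<pi> x) = a x"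
    by (rule descend_H1_inv[OF F.lcs_normal R0 a(1)], rule za, assumption+)+
  have d\<psi>: "descend (carrier F) \<psi> \<in> Q_inv G (carrier G)"
    "\<And>x. x \<in> carrier F \<Longrightarrow> descend (carrier F) \<psi> (\<pi> x) = \<psi> x"
    by (rule descend_hom_qm[OF a(2)], rule z\<psi>, assumption+)+
  have "\<phi> y = descend (lcs_aux F k) a y + descend (carrier F) \<psi> y" if y: "y \<in> lcs_aux G k" for y
  proof -
    obtain x where x: "x \<in> lcs_aux F k" "y = \<pi> x" using y unfolding lcs_G by blast
    show ?thesis unfolding x(2) using a(3)[OF x(1)] da(2)[OF x(1)] d\<psi>(2)[OF F.lcs_carrier[OF x(1)]] by simp
  qed
  then show ?thesis using da(1) d\<psi>(1) unfolding lcs_G by blast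
qed

end

section \<open>Computing \<open>quot_dim\<close> and the subspace that is divided out\<close>

lemma quot_dim_eq_0:
  assumes "V \<subseteq> U" shows "quot_dim V U = 0"
proof -
  have "V \<subseteq> {(\<lambda>x. u x + s x) | u s. u \<in> U \<and> s \<in> fspan {}}"
  proof
    fix v assume "v \<in> V"
    then have "v \<in> U" using assms by blast
    moreover have "(\<lambda>x. 0) \<in> fspan ({} :: ('a \<Rightarrow> real) set)" by (simp add: fspan_def)
    ultimately show "v \<in> {(\<lambda>x. u x + s x) | u s. u \<in> U \<and> s \<in> fspan {}}"
      by (intro CollectI exI[of _ v] exI[of _ "\<lambda>x. 0"]) simp
  qed
  then have "enat 0 \<in> {enat (card B) | B. finite B \<and> B \<subseteq> V \<and>
      V \<subseteq> {(\<lambda>x. u x + s x) | u s. u \<in> U \<and> s \<in> fspan B}}"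
    by (intro CollectI exI[of _ "{}"]) simp
  then have "quot_dim V U \<le> enat 0" unfolding quot_dim_def by (rule Inf_lower)
  then show ?thesis by (simp add: zero_enat_def[symmetric])
qed

lemma quot_dim_eq_1:
  assumes v: "v \<in> V" "v \<notin> U"
    and dec: "\<And>f. f \<in> V \<Longrightarrow> \<exists>u\<in>U. \<exists>t::real. \<forall>x. f x = u x + t * v x"
  shows "quot_dim V U = 1"
proof (rule antisym)
  have "V \<subseteq> {(\<lambda>x. u x + s x) | u s. u \<in> U \<and> s \<in> fspan {v}}"
  proof
    fix f assume "f \<in> V"
    then obtain u t where u: "u \<in> U" "\<And>x. f x = u x + t * v x" using dec by blast
    have "(\<lambda>x. t * v x) \<in> fspan {v}" unfolding fspan_def by (intro CollectI exI[of _ "\<lambda>_. t"]) simp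
    then show "f \<in> {(\<lambda>x. u x + s x) | u s. u \<in> U \<and> s \<in> fspan {v}}"
      using u by (intro CollectI exI[of _ u] exI[of _ "\<lambda>x. t * v x"]) auto
  qed
  then have "enat 1 \<in> {enat (card B) | B. finite B \<and> B \<subseteq> V \<and>
      V \<subseteq> {(\<lambda>x. u x + s x) | u s. u \<in> U \<and> s \<in> fspan B}}"
    using v by (intro CollectI exI[of _ "{v}"]) simp
  then have "quot_dim V U \<le> enat 1" unfolding quot_dim_def by (rule Inf_lower)
  then show "quot_dim V U \<le> 1" by (simp add: one_enat_def)
  show "1 \<le> quot_dim V U" unfolding quot_dim_def
  proof (rule Inf_greatest)
    fix d assume "d \<in> {enat (card B) | B. finite B \<and> B \<subseteq> V \<and>
      V \<subseteq> {(\<lambda>x. u x + s x) | u s. u \<in> U \<and> s \<in> fspan B}}"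
    then obtain B where B: "d = enat (card B)" "finite B"
      "V \<subseteq> {(\<lambda>x. u x + s x) | u s. u \<in> U \<and> s \<in> fspan B}" by blast
    have "B \<noteq> {}"
    proof
      assume "B = {}"
      then obtain u s where u: "v = (\<lambda>x. u x + s x)" "u \<in> U" "s \<in> fspan {}" using B(3) v(1) by blast
      then have "v = u" by (simp add: fspan_def)
      then show False using u(2) v(2) by simp
    qed
    then have "0 < card B" using B(2) by (simp add: card_gt_0_iff)
    then show "1 \<le> d" unfolding B(1) one_enat_def by simp
  qed
qed

text \<open>The denominator in the definition of the W-spaces, in the very form that unfolding
  \<open>dim_W3_def\<close> produces.\<close>

abbreviation extendable :: "('a, 'b) monoid_scheme \<Rightarrow> 'a set \<Rightarrow> 'a set \<Rightarrow> ('a \<Rightarrow> real) set" where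
  "extendable G L N \<equiv> {(\<lambda>x. a x + b x) | a b. a \<in> H1_inv G N \<and> b \<in> restr_Q G L N}"

lemma extendableI:
  assumes a: "a \<in> H1_inv G N" and \<psi>: "\<psi> \<in> Q_inv G L"
    and out: "\<And>x. x \<notin> N \<Longrightarrow> f x = 0" and eq: "\<And>x. x \<in> N \<Longrightarrow> f x = a x + \<psi> x"
  shows "f \<in> extendable G L N"
proof (intro CollectI exI conjI)
  show "f = (\<lambda>x. a x + (if x \<in> N then \<psi> x else 0))"
    using out eq H1_invD(1)[OF a] by (intro ext) simp
  show "(\<lambda>x. if x \<in> N then \<psi> x else 0) \<in> restr_Q G L N" unfolding restr_Q_def using \<psi> by blast
qed (rule a)

lemma extendableE:
  assumes "f \<in> extendable G L N"
  obtains a \<psi> where "a \<in> H1_inv G N" "\<psi> \<in> Q_inv G L" "\<And>x. x \<in> N \<Longrightarrow> f x = a x + \<psi> x"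
  using assms unfolding restr_Q_def by fastforce

section \<open>The dimension count\<close>

context one_relator
begin

lemma non_extendable_spans:
  assumes r: "r \<in> lcs_aux F (Suc k)" "r \<notin> lcs_aux F (Suc (Suc k))" and sv: "simplicial_volume G \<noteq> 0"
  obtains \<phi>0 where "\<phi>0 \<in> Q_inv G (lcs_aux G (Suc k))" "\<phi>0 \<notin> extendable G (carrier G) (lcs_aux G (Suc k))"
    "\<And>\<phi>. \<phi> \<in> Q_inv G (lcs_aux G (Suc k)) \<Longrightarrow>
      \<exists>u\<in>extendable G (carrier G) (lcs_aux G (Suc k)). \<exists>t. \<forall>x. \<phi> x = u x + t * \<phi>0 x"
proof -
  let ?N = "lcs_aux F (Suc k)" and ?M = "lcs_aux G (Suc k)"
  note N = F.lcs_normal[of "Suc k"]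
  have RN: "R \<subseteq> ?N" by (rule R_minimal[OF N r(1)])
  obtain h where h: "h \<in> H1_inv F ?N" "h r = 1" using separating_hom[OF r] .
  obtain \<mu>' where \<mu>': "hom_qm F (carrier F) \<mu>'"
    "\<And>x y. x \<in> R \<Longrightarrow> y \<in> R \<Longrightarrow> \<mu>' (x \<otimes>\<^bsub>F\<^esub> y) = \<mu>' x + \<mu>' y" "\<mu>' r \<noteq> 0"
    using quasimorphism_of_simplicial_volume[OF sv] by blast
  \<comment> \<open>Normalized to agree with \<open>h\<close> at \<open>r\<close>; both are
    conjugation invariant and additive on \<open>R\<close>, so their difference vanishes on all of
    \<open>R\<close> and descends.\<close>
  define \<mu> where "\<mu> x = (1 / \<mu>' r) * \<mu>' x" for x
  have \<mu>: "hom_qm F (carrier F) \<mu>" using hom_qm_linear[OF \<mu>'(1) \<mu>'(1), of "1 / \<mu>' r" 0] by (simp add: \<mu>_def[abs_def])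
  have \<mu>_add: "\<mu> (x \<otimes>\<^bsub>F\<^esub> y) = \<mu> x + \<mu> y" if "x \<in> R" "y \<in> R" for x y
    using \<mu>'(2)[OF that] by (simp add: \<mu>_def add_divide_distrib)
  have \<mu>r: "\<mu> r = 1" using \<mu>'(3) by (simp add: \<mu>_def)
  note \<mu>_conj = F.hom_qm_conj[OF \<mu>]
  have \<mu>h: "\<mu> \<rho> - h \<rho> = 0" if "\<rho> \<in> R" for \<rho>
    by (rule zero_on_R[of "\<lambda>x. \<mu> x - h x", OF _ _ _ that])
      (use \<mu>_add \<mu>_conj \<mu>r h H1_invD(2,3)[OF h(1)] subsetD[OF RN] R.mem_carrier in auto)
  define g where "g x = (if x \<in> ?N then \<mu> x - h x else 0)" for x
  have g: "g \<in> Q_inv F ?N"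
  proof -
    have "(\<lambda>x. (if x \<in> ?N then \<mu> x else 0) - h x) \<in> Q_inv F ?N"
      by (rule F.Q_inv_minus_H1_inv[OF F.Q_inv_restrict[OF F.hom_qm_Q_inv[OF \<mu>] N] h(1) N])
        (use F.lcs_carrier in blast)
    moreover have "(\<lambda>x. (if x \<in> ?N then \<mu> x else 0) - h x) = g"
      using H1_invD(1)[OF h(1)] by (auto simp: g_def)
    ultimately show ?thesis by simp
  qed
  have gR: "g \<rho> = 0" if "\<rho> \<in> R" for \<rho> using \<mu>h[OF that] by (simp add: g_def)
  have g_inv: "g (x \<otimes>\<^bsub>F\<^esub> \<rho>) = g x" if "x \<in> ?N" "\<rho> \<in> R" for x \<rho>
    by (rule F.hom_qm_mod[OF Q_invD(1)[OF g] F.lcs_subgroup R_normal RN _ that]) (rule gR)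
  define \<phi>0 where "\<phi>0 = descend ?N g"
  have \<phi>0: "\<phi>0 \<in> Q_inv G ?M"
    unfolding \<phi>0_def lcs_G by (rule descend_Q_inv[OF N RN _ g]) (rule g_inv)
  have \<phi>0_app: "\<phi>0 (\<pi> x) = \<mu> x - h x" if "x \<in> ?N" for x
  proof -
    have "\<phi>0 (\<pi> x) = g x" unfolding \<phi>0_def by (rule descend_apply[OF N RN _ that]) (rule g_inv)
    then show ?thesis using that by (simp add: g_def)
  qed
  have \<pi>M: "\<pi> x \<in> ?M" if "x \<in> ?N" for x unfolding lcs_G using that by (rule imageI)
  have not_ext: "\<phi>0 \<notin> extendable G (carrier G) ?M"
  proof
    assume "\<phi>0 \<in> extendable G (carrier G) ?M"
    then obtain a \<psi> where a: "a \<in> H1_inv G ?M" and \<psi>: "\<psi> \<in> Q_inv G (carrier G)"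
      and eq: "\<And>x. x \<in> ?M \<Longrightarrow> \<phi>0 x = a x + \<psi> x" by (rule extendableE) blast
    define \<psi>' where "\<psi>' x = (if x \<in> carrier F then \<psi> (\<pi> x) else 0)" for x
    have \<psi>': "hom_qm F (carrier F) \<psi>'"
      using Q_invD(1)[OF pull_Q_inv[OF F.normal_self, of \<psi>]] \<psi> unfolding carrier_G \<psi>'_def[abs_def] by blast
    \<comment> \<open>On \<open>?N\<close> this equals \<open>h\<close> plus the pullback of
      \<open>a\<close>, hence is additive there although it is a quasimorphism on all of
      \<open>F\<close>.\<close>
    define \<nu> where "\<nu> x = \<mu> x - \<psi>' x" for x
    have \<nu>: "hom_qm F (carrier F) \<nu>" using hom_qm_linear[OF \<mu> \<psi>', of 1 "-1"] by (simp add: \<nu>_def[abs_def])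
    have \<nu>N: "\<nu> x = h x + a (\<pi> x)" if x: "x \<in> ?N" for x
      using \<phi>0_app[OF x] eq[OF \<pi>M[OF x]] F.lcs_carrier[OF x] by (simp add: \<nu>_def \<psi>'_def)
    have "\<nu> (x \<otimes>\<^bsub>F\<^esub> y) = \<nu> x + \<nu> y" if xy: "x \<in> ?N" "y \<in> ?N" for x y
    proof -
      have "\<pi> (x \<otimes>\<^bsub>F\<^esub> y) = \<pi> x \<otimes>\<^bsub>G\<^esub> \<pi> y" by (rule \<pi>.hom_mult[OF F.lcs_carrier[OF xy(1)] F.lcs_carrier[OF xy(2)]])
      then have "a (\<pi> (x \<otimes>\<^bsub>F\<^esub> y)) = a (\<pi> x) + a (\<pi> y)"
        using H1_invD(2)[OF a \<pi>M[OF xy(1)] \<pi>M[OF xy(2)]] by (simp only:)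
      then show ?thesis
        using \<nu>N[OF F.normal_mult_mem[OF N xy]] \<nu>N[OF xy(1)] \<nu>N[OF xy(2)] H1_invD(2)[OF h(1) xy] by simp
    qed
    note add = F.hom_qm_additive_of_lcs[OF \<nu> this]
    \<comment> \<open>Now \<nu> is a homomorphism on \<open>F\<close> and kills commutators,
      \<open>r\<close> among them; but its value at \<open>r\<close> is \<open>h r = 1\<close>,
      because \<open>r\<close> projects to the identity.\<close>
    have "\<nu> \<in> H1_inv F (lcs_aux F 0)"
      unfolding lcs_aux.simps(1)
      by (rule H1_invI) (use hom_qm_outside[OF \<nu>] add F.hom_qm_conj[OF \<nu>] in auto)
    moreover have "r \<in> lcs_aux F (Suc 0)" using F.lcs_antimono[of "Suc 0" "Suc k"] r(1) by auto
    ultimately have "\<nu> r = 0" by (rule F.H1_inv_lcs_Suc)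
    moreover have "a (\<pi> r) = 0" unfolding \<pi>_R[OF r_in_R] by (rule G.H1_inv_one[OF a G.lcs_normal])
    ultimately show False using \<nu>N[OF r(1)] h(2) by simp
  qed
  have "\<exists>u\<in>extendable G (carrier G) ?M. \<exists>t. \<forall>x. \<phi> x = u x + t * \<phi>0 x" if \<phi>: "\<phi> \<in> Q_inv G ?M" for \<phi>
  proof -
    obtain a \<psi> where a: "a \<in> H1_inv F ?N" "hom_qm F (carrier F) \<psi>"
      "\<And>x. x \<in> ?N \<Longrightarrow> \<phi> (\<pi> x) = a x + \<psi> x" "\<And>\<rho>. \<rho> \<in> R \<Longrightarrow> \<psi> \<rho> = - a \<rho>"
      using Q_inv_decompose[OF RN \<phi>] by blast
    \<comment> \<open>Since \<open>a r = - \<psi> r\<close>, this is the coefficient for which a + t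
      h vanishes at \<open>r\<close>, hence on \<open>R\<close>; then \<psi> - t \<mu> vanishes on
      \<open>R\<close> too, and both descend.\<close>
    define t where "t = \<psi> r"
    have ah: "(\<lambda>x. 1 * a x + t * h x) \<in> H1_inv F ?N" by (rule H1_inv_linear[OF a(1) h(1)])
    have zah: "1 * a \<rho> + t * h \<rho> = 0" if "\<rho> \<in> R" for \<rho>
      by (rule zero_on_R[of "\<lambda>x. 1 * a x + t * h x", OF _ _ _ that])
        (use H1_invD(2,3)[OF ah] subsetD[OF RN] a(4)[OF r_in_R] h(2) in \<open>auto simp: t_def\<close>)
    have \<psi>\<mu>: "hom_qm F (carrier F) (\<lambda>x. 1 * \<psi> x + (- t) * \<mu> x)" by (rule hom_qm_linear[OF a(2) \<mu>])
    have z\<psi>: "1 * \<psi> \<rho> + (- t) * \<mu> \<rho> = 0" if "\<rho> \<in> R" for \<rho>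
      using zah[OF that] a(4)[OF that] \<mu>h[OF that] by (simp add: algebra_simps)
    define a' where "a' = descend ?N (\<lambda>x. 1 * a x + t * h x)"
    define \<psi>' where "\<psi>' = descend (carrier F) (\<lambda>x. 1 * \<psi> x + (- t) * \<mu> x)"
    have a': "a' \<in> H1_inv G ?M" "\<And>x. x \<in> ?N \<Longrightarrow> a' (\<pi> x) = 1 * a x + t * h x"
      unfolding a'_def lcs_G by (rule descend_H1_inv[OF N RN ah], rule zah, assumption+)+
    have \<psi>': "\<psi>' \<in> Q_inv G (carrier G)" "\<And>x. x \<in> carrier F \<Longrightarrow> \<psi>' (\<pi> x) = 1 * \<psi> x + (- t) * \<mu> x"
      unfolding \<psi>'_def by (rule descend_hom_qm[OF \<psi>\<mu>], rule z\<psi>, assumption+)+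
    have "(\<lambda>x. \<phi> x - t * \<phi>0 x) \<in> extendable G (carrier G) ?M"
    proof (rule extendableI[OF a'(1) \<psi>'(1)])
      show "\<phi> x - t * \<phi>0 x = 0" if "x \<notin> ?M" for x
        using hom_qm_outside[OF Q_invD(1)[OF \<phi>] that] hom_qm_outside[OF Q_invD(1)[OF \<phi>0] that] by simp
      show "\<phi> y - t * \<phi>0 y = a' y + \<psi>' y" if "y \<in> ?M" for y
      proof -
        obtain x where x: "x \<in> ?N" "y = \<pi> x" using \<open>y \<in> ?M\<close> unfolding lcs_G by blast
        show ?thesis
          unfolding x(2) a(3)[OF x(1)] \<phi>0_app[OF x(1)] a'(2)[OF x(1)] \<psi>'(2)[OF F.lcs_carrier[OF x(1)]]
          by (simp add: algebra_simps)
      qed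
    qed
    then show ?thesis by (intro bexI[of _ "\<lambda>x. \<phi> x - t * \<phi>0 x"] exI[of _ t]) auto
  qed
  then show ?thesis by (rule that[OF \<phi>0 not_ext])
qed

lemma Q_inv_extendable_below:
  assumes "r \<in> lcs_aux F (Suc k)"
  shows "Q_inv G (lcs_aux G k) \<subseteq> extendable G (carrier G) (lcs_aux G k)"
proof
  fix \<phi> assume \<phi>: "\<phi> \<in> Q_inv G (lcs_aux G k)"
  obtain a \<psi> where a: "a \<in> H1_inv G (lcs_aux G k)" "\<psi> \<in> Q_inv G (carrier G)"
    "\<forall>y\<in>lcs_aux G k. \<phi> y = a y + \<psi> y" using Q_inv_extends_below[OF assms \<phi>] by blast
  show "\<phi> \<in> extendable G (carrier G) (lcs_aux G k)"
    by (rule extendableI[OF a(1,2)]) (use hom_qm_outside[OF Q_invD(1)[OF \<phi>]] a(3) in auto)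
qed

text \<open>A quasimorphism on \<open>lcs_aux G k\<close> is already an invariant homomorphism plus
  a restriction from \<open>G\<close>, and the homomorphism restricts further. So the relative space
  has the same denominator as the absolute one, and therefore the same dimension.\<close>

lemma extendable_intermediate:
  assumes r: "r \<in> lcs_aux F (Suc k)"
  shows "extendable G (lcs_aux G k) (lcs_aux G (Suc k)) = extendable G (carrier G) (lcs_aux G (Suc k))"
proof (intro equalityI subsetI)
  fix f assume f: "f \<in> extendable G (carrier G) (lcs_aux G (Suc k))"
  then obtain a \<psi> where a: "a \<in> H1_inv G (lcs_aux G (Suc k))" "\<psi> \<in> Q_inv G (carrier G)"
    "f = (\<lambda>x. a x + (if x \<in> lcs_aux G (Suc k) then \<psi> x else 0))" unfolding restr_Q_def by blast
  show "f \<in> extendable G (lcs_aux G k) (lcs_aux G (Suc k))"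
  proof (rule extendableI[OF a(1) G.Q_inv_restrict[OF a(2) G.lcs_normal[of k]]])
    show "lcs_aux G k \<subseteq> carrier G" using G.lcs_carrier by blast
    show "f x = 0" if "x \<notin> lcs_aux G (Suc k)" for x using that H1_invD(1)[OF a(1)] by (simp add: a(3))
    show "f x = a x + (if x \<in> lcs_aux G k then \<psi> x else 0)" if x: "x \<in> lcs_aux G (Suc k)" for x
      using x subsetD[OF G.lcs_Suc_subset x] by (simp add: a(3))
  qed
next
  fix f assume f: "f \<in> extendable G (lcs_aux G k) (lcs_aux G (Suc k))"
  then obtain a \<psi> where a: "a \<in> H1_inv G (lcs_aux G (Suc k))" "\<psi> \<in> Q_inv G (lcs_aux G k)"
    "f = (\<lambda>x. a x + (if x \<in> lcs_aux G (Suc k) then \<psi> x else 0))" unfolding restr_Q_def by blast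
  obtain b \<chi> where b: "b \<in> H1_inv G (lcs_aux G k)" "\<chi> \<in> Q_inv G (carrier G)"
    "\<forall>y\<in>lcs_aux G k. \<psi> y = b y + \<chi> y" using Q_inv_extends_below[OF r a(2)] by blast
  have "(\<lambda>x. 1 * a x + 1 * (if x \<in> lcs_aux G (Suc k) then b x else 0)) \<in> H1_inv G (lcs_aux G (Suc k))"
    by (rule H1_inv_linear[OF a(1) G.H1_inv_restrict[OF b(1) G.lcs_normal G.lcs_Suc_subset]])
  then show "f \<in> extendable G (carrier G) (lcs_aux G (Suc k))"
  proof (rule extendableI[OF _ b(2)])
    show "f x = 0" if "x \<notin> lcs_aux G (Suc k)" for x using that H1_invD(1)[OF a(1)] by (simp add: a(3))
    show "f x = 1 * a x + 1 * (if x \<in> lcs_aux G (Suc k) then b x else 0) + \<chi> x"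
      if x: "x \<in> lcs_aux G (Suc k)" for x
      using x b(3) subsetD[OF G.lcs_Suc_subset x] by (simp add: a(3))
  qed
qed

end

theorem theorem11p15:
  fixes n q :: nat and r :: "(nat \<times> bool) list"
  defines "F \<equiv> free_grp n"
  defines "G \<equiv> F Mod (normal_closure F {r})"
  assumes "q \<ge> 2"
    and "r \<in> gamma F q" and "r \<notin> gamma F (q + 1)"
    and "simplicial_volume G \<noteq> 0"
  shows "dim_W G (gamma G (q - 1)) = 0 \<and> dim_W G (gamma G q) = 1
         \<and> dim_W3 G (gamma G (q - 1)) (gamma G q) = 1"
proof -
  \<comment> \<open>With \<open>k = q - 2\<close> the terms of index q-1, q and q+1 are
    \<open>lcs_aux\<close> at \<open>k\<close>, \<open>Suc k\<close> and
    \<open>Suc (Suc k)\<close>.\<close>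
  obtain k where k: "q = Suc (Suc k)" using assms(3) by (metis Suc_le_D add_2_eq_Suc le_Suc_ex)
  have r: "r \<in> lcs_aux (free_grp n) (Suc k)" "r \<notin> lcs_aux (free_grp n) (Suc (Suc k))"
    using assms(4,5) unfolding F_def gamma_def k by simp_all
  interpret O: one_relator n r
    by unfold_locales (rule group.lcs_carrier[OF free_grp_group r(1)])
  have G: "G = O.G" unfolding G_def F_def ..
  have gam: "gamma O.G (q - 1) = lcs_aux O.G k" "gamma O.G q = lcs_aux O.G (Suc k)"
    unfolding gamma_def k by simp_all
  obtain \<phi>0 where \<phi>0: "\<phi>0 \<in> Q_inv O.G (lcs_aux O.G (Suc k))"
    "\<phi>0 \<notin> extendable O.G (carrier O.G) (lcs_aux O.G (Suc k))"
    "\<And>\<phi>. \<phi> \<in> Q_inv O.G (lcs_aux O.G (Suc k)) \<Longrightarrow>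
      \<exists>u\<in>extendable O.G (carrier O.G) (lcs_aux O.G (Suc k)). \<exists>t. \<forall>x. \<phi> x = u x + t * \<phi>0 x"
    using O.non_extendable_spans[OF r] assms(6) unfolding G by blast
  note one = quot_dim_eq_1[OF \<phi>0]
  have "dim_W G (gamma G (q - 1)) = 0"
    unfolding G gam dim_W_def dim_W3_def by (rule quot_dim_eq_0[OF O.Q_inv_extendable_below[OF r(1)]])
  moreover have "dim_W G (gamma G q) = 1"
    unfolding G gam dim_W_def dim_W3_def by (rule one)
  moreover have "dim_W3 G (gamma G (q - 1)) (gamma G q) = 1"
    unfolding G gam dim_W3_def O.extendable_intermediate[OF r(1)] by (rule one)
  ultimately show ?thesis by blast
qed

end
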